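(* Let $\Delta=(\Sigma,C,w^\pm)$ be a (not necessarily simplicial) multi-fan in a lattice $L$ of rank $n$ such that every $J\in\Sigma$ satisfies $J\preceq I$ for some $I\in\Sigma^{(n)}$, and let $\mathcal V=\{v_i\}_{i\in\Sigma^{(1)}}$ be a set of non-zero vectors $v_i\in L\cap C(i)$ such that the pair $(\Delta,\mathcal V)$ is $\mathbb Q$-Gorenstein. Then, for a triangulation $\Delta'$ of $\Delta$, the orbifold elliptic genus $\hat\varphi_{st}(\Delta',\mathcal V)$ does not depend on the triangulation $\Delta'$, and hence gives an invariant of $(\Delta,\mathcal V)$.
   Context: **Multi-fans.** Let $L$ be a lattice of rank $n$, $L_{\mathbb R}=L\otimes\mathbb R$, $L_{\mathbb C}=L\otimes\mathbb C$, $L_{\mathbb Q}^*=L^*\otimes\mathbb Q$. A (not necessarily simplicial) multi-fan in $L$ is a triple $\Delta=(\Sigma,C,w^\pm)$, where $\Sigma$ is a (finite) partially ordered set with order $\preceq$ and unique minimum $*$, $C$ is a map from $\Sigma$ to the set of strongly convex rational cones in $L_{\mathbb R}$ such that (i) $C( * )=\{0\}$; (ii) if $K\preceq J$ then $C(K)$ is a face of $C(J)$; (iii) for any $J\in\Sigma$, $C$ restricted to $\{K\in\Sigma: K\preceq J\}$ is an isomorphism of ordered sets onto the set of faces of $C(J)$. Put $\Sigma^{(k)}=\{K\in\Sigma:\dim C(K)=k\}$; $w^\pm:\Sigma^{(n)}\to\mathbb Z_{\ge0}$ are maps, $w=w^+-w^-$. The multi-fan is simplicial if moreover $\Sigma$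 is a finite abstract simplicial complex including the empty simplex, with $\Sigma^{(k)}$ the simplices with $k$ vertices, $\Sigma=\coprod_{k=0}^n\Sigma^{(k)}$, $\Sigma^{(n)}\neq\emptyset$, every simplex lying in some $I\in\Sigma^{(n)}$, and all cones simplicial with $\dim C(J)=|J|$. **Triangulations.** A triangulation of $\Delta$ is a simplicial multi-fan $\Delta'=(\Sigma',C',w'^\pm)$ in $L$ together with an order-preserving map $\rho:\Sigma'\to\Sigma$ such that: a) there is a bijection $\kappa:\Sigma^{(1)}\to\Sigma'^{(1)}$ with $C(i)=C'(\kappa(i))$ and $\rho(\kappa(i))=i$; b) for each $J'\in\Sigma'$, $C'(J')\subset C(\rho(J'))$ with $\rho(J')$ the minimal such element, and for each $J\in\Sigma$ the cones $C'(J')$ with $\rho(J')\preceq J$ (pairwise distinct) form a subdivision of $C(J)$; c) $w'^\pm(I')=w^\pm(\rho(I'))$ for $I'\in\Sigma'^{(n)}$. $\Sigma'^{(1)}$ is identified with $\Sigma^{(1)}$ via $\kappa$, so $\mathcal V$ is also a set of edge vectors for $\Delta'$. **$\mathbb Q$-Gorenstein.** $(\Delta,\mathcal V)$ is $\mathbb Q$-Gorenstein if for each $I\in\Sigma^{(n)}$ there is $u(I)\in L_{\mathbb Q}^*$ with $\langle u(I),v_i\rangle=1$ for all $i\in\Sigma^{(1)}$ with $i\preceq I$. **Orbifold elliptic genus.** For a simplicial multi-fan $\Delta'$ with edge vectors $\mathcal V$, and $I\in\Sigma'^{(n)}$, let $L_{I,\mathcal V}\subset L$ be the sublattice generated by $\{v_i\}_{i\in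 I}$, $\{u_i^I\}_{i\in I}$ the basis of $L_{I,\mathcal V}^*$ dual to $\{v_i\}_{i\in I}$, $H_I=L/L_{I,\mathcal V}$. Put $q=e^{2\pi\sqrt{-1}\tau}$ ($\Im\tau>0$), $\zeta=e^{2\pi\sqrt{-1}\sigma}$, $\zeta^a:=e^{2\pi\sqrt{-1}a\sigma}$, and with $t=e^{2\pi\sqrt{-1}z}$, $$\phi_{st}(z,\tau,\sigma)=\frac{1-\zeta t}{(1-\zeta)(1-t)}\prod_{k\ge1}\frac{(1-q^k)^2(1-\zeta tq^k)(1-\zeta^{-1}t^{-1}q^k)}{(1-\zeta q^k)(1-\zeta^{-1}q^k)(1-tq^k)(1-t^{-1}q^k)}.$$ The genus $\hat\varphi_{st}(\Delta',\mathcal V)$ of the pair is the orbifold elliptic genus for the divisor $\sum_ix_i$ (all coefficients $1$), i.e. the function of $w\in L_{\mathbb C}$ (meromorphic in $w$) $$\hat\varphi_{st}(\Delta',\mathcal V)(w)=\sum_{I\in\Sigma'^{(n)}}\frac{w'(I)}{|H_I|}\sum_{(h_1,h_2)\in H_I\times H_I}\prod_{i\in I}\zeta^{\langle u_i^I,v(h_1)\rangle}\phi_{st}\bigl(\langle u_i^I,-w+\tau v(h_1)-v(h_2)\rangle,\tau,\sigma\bigr),$$ with $v(h)\in L$ any representative of $h$, $w'=w'^+-w'^-$, and $\sigma\notin\mathbb Z+\mathbb Z\tau$. *)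

theory Defs
  imports "HOL-Analysis.Analysis"
begin

section \<open>Lattices and cones\<close>

text \<open>A lattice \<open>L\<close> sits inside a real vector space \<open>'a\<close>, possibly with smaller linear span,
  so that rank 0 is allowed. Then \<open>L \<otimes> \<real>\<close> is \<open>span L\<close>, and \<open>L \<otimes> \<complex>\<close> is
  \<open>span L \<times> span L\<close>, the pair \<open>(x, y)\<close> standing for \<open>x + \<i> y\<close>.\<close>

text \<open>Only used for finite \<open>S\<close>.\<close>
definition int_span :: "'a::real_vector set \<Rightarrow> 'a set" where
  "int_span S = {\<Sum>x\<in>S. of_int (c x) *\<^sub>R x | c :: 'a \<Rightarrow> int. True}"

definition lattice_of_rank :: "'a::euclidean_space set \<Rightarrow> nat \<Rightarrow> bool" where
  "lattice_of_rank L n \<longleftrightarrow> (\<exists>B. independent B \<and> card B = n \<and> L = int_span B)"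

definition complexification :: "'a::euclidean_space set \<Rightarrow> ('a \<times> 'a) set" where
  "complexification L = span L \<times> span L"

definition complex_ext :: "('a \<Rightarrow> real) \<Rightarrow> 'a \<times> 'a \<Rightarrow> complex" where
  "complex_ext u w = of_real (u (fst w)) + \<i> * of_real (u (snd w))"

definition strongly_convex_rational_cone :: "'a::euclidean_space set \<Rightarrow> 'a set \<Rightarrow> bool" where
  "strongly_convex_rational_cone L C \<longleftrightarrow>
     (\<exists>S. finite S \<and> S \<subseteq> L \<and> C = convex_cone hull S) \<and> C \<inter> uminus ` C = {0}"

definition simplicial_cone :: "'a::euclidean_space set \<Rightarrow> bool" where
  "simplicial_cone C \<longleftrightarrow> (\<exists>S. independent S \<and> C = convex_cone hull S)"

text \<open>Unlike \<open>face_of\<close>, the faces of a cone do not include the empty set.\<close>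
definition cone_face :: "'a::euclidean_space set \<Rightarrow> 'a set \<Rightarrow> bool" where
  "cone_face F C \<longleftrightarrow> F face_of C \<and> F \<noteq> {}"

definition subdivides :: "'a::euclidean_space set \<Rightarrow> 'a set set \<Rightarrow> 'a set \<Rightarrow> bool" where
  "subdivides L \<C> C \<longleftrightarrow>
     finite \<C> \<and> (\<forall>A\<in>\<C>. strongly_convex_rational_cone L A) \<and>
     (\<forall>A\<in>\<C>. \<forall>F. cone_face F A \<longrightarrow> F \<in> \<C>) \<and>
     (\<forall>A\<in>\<C>. \<forall>B\<in>\<C>. cone_face (A \<inter> B) A \<and> cone_face (A \<inter> B) B) \<and>
     \<Union>\<C> = C"

section \<open>Multi-fans\<close>

record ('s, 'a) multi_fan =
  simplices :: "'s set"
  le :: "'s \<Rightarrow> 's \<Rightarrow> bool"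
  cone_at :: "'s \<Rightarrow> 'a set"
  w_plus :: "'s \<Rightarrow> nat"
  w_minus :: "'s \<Rightarrow> nat"

definition stratum :: "('s, 'a::euclidean_space, 'z) multi_fan_scheme \<Rightarrow> nat \<Rightarrow> 's set" where
  "stratum \<Delta> k = {K \<in> simplices \<Delta>. dim (cone_at \<Delta> K) = k}"

definition weight :: "('s, 'a, 'z) multi_fan_scheme \<Rightarrow> 's \<Rightarrow> int" where
  "weight \<Delta> I = int (w_plus \<Delta> I) - int (w_minus \<Delta> I)"

definition is_minimum :: "('s, 'a, 'z) multi_fan_scheme \<Rightarrow> 's \<Rightarrow> bool" where
  "is_minimum \<Delta> m \<longleftrightarrow> m \<in> simplices \<Delta> \<and> (\<forall>J\<in>simplices \<Delta>. le \<Delta> m J)"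

definition is_multi_fan :: "'a::euclidean_space set \<Rightarrow> ('s, 'a) multi_fan \<Rightarrow> bool" where
  "is_multi_fan L \<Delta> \<longleftrightarrow>
     finite (simplices \<Delta>) \<and>
     reflp_on (simplices \<Delta>) (le \<Delta>) \<and> antisymp_on (simplices \<Delta>) (le \<Delta>) \<and>
     transp_on (simplices \<Delta>) (le \<Delta>) \<and>
     (\<forall>J\<in>simplices \<Delta>. strongly_convex_rational_cone L (cone_at \<Delta> J)) \<and>
     (\<exists>!m. is_minimum \<Delta> m) \<and>
     (\<forall>m. is_minimum \<Delta> m \<longrightarrow> cone_at \<Delta> m = {0}) \<and>
     (\<forall>K\<in>simplices \<Delta>. \<forall>J\<in>simplices \<Delta>. le \<Delta> K J \<longrightarrow> cone_face (cone_at \<Delta> K) (cone_at \<Delta> J)) \<and>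
     (\<forall>J\<in>simplices \<Delta>.
        bij_betw (cone_at \<Delta>) {K \<in> simplices \<Delta>. le \<Delta> K J} {F. cone_face F (cone_at \<Delta> J)} \<and>
        (\<forall>K\<in>simplices \<Delta>. \<forall>K'\<in>simplices \<Delta>. le \<Delta> K J \<longrightarrow> le \<Delta> K' J \<longrightarrow>
           (le \<Delta> K K' \<longleftrightarrow> cone_at \<Delta> K \<subseteq> cone_at \<Delta> K')))"

text \<open>The simplices of a simplicial multi-fan are finite sets of vertices of type \<open>'b\<close>; the
  elements of \<open>stratum \<Delta> 1\<close> are singletons.\<close>
definition is_simplicial_multi_fan ::
    "'a::euclidean_space set \<Rightarrow> nat \<Rightarrow> ('b set, 'a) multi_fan \<Rightarrow> bool" where
  "is_simplicial_multi_fan L n \<Delta> \<longleftrightarrow>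
     is_multi_fan L \<Delta> \<and>
     (\<forall>J\<in>simplices \<Delta>. finite J) \<and> {} \<in> simplices \<Delta> \<and>
     (\<forall>J\<in>simplices \<Delta>. \<forall>K. K \<subseteq> J \<longrightarrow> K \<in> simplices \<Delta>) \<and>
     (\<forall>J\<in>simplices \<Delta>. \<forall>K\<in>simplices \<Delta>. le \<Delta> J K \<longleftrightarrow> J \<subseteq> K) \<and>
     (\<forall>J\<in>simplices \<Delta>. simplicial_cone (cone_at \<Delta> J) \<and> dim (cone_at \<Delta> J) = card J) \<and>
     simplices \<Delta> = (\<Union>k\<le>n. stratum \<Delta> k) \<and>
     stratum \<Delta> n \<noteq> {} \<and>
     (\<forall>J\<in>simplices \<Delta>. \<exists>I\<in>stratum \<Delta> n. J \<subseteq> I)"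

definition edge_vectors ::
    "'a::euclidean_space set \<Rightarrow> ('s, 'a) multi_fan \<Rightarrow> ('s \<Rightarrow> 'a) \<Rightarrow> bool" where
  "edge_vectors L \<Delta> v \<longleftrightarrow> (\<forall>i\<in>stratum \<Delta> 1. v i \<noteq> 0 \<and> v i \<in> L \<and> v i \<in> cone_at \<Delta> i)"

text \<open>An element of \<open>L\<^sup>* \<otimes> \<rat>\<close> is a linear form taking rational values on \<open>L\<close>.\<close>
definition Q_Gorenstein ::
    "'a::euclidean_space set \<Rightarrow> nat \<Rightarrow> ('s, 'a) multi_fan \<Rightarrow> ('s \<Rightarrow> 'a) \<Rightarrow> bool" where
  "Q_Gorenstein L n \<Delta> v \<longleftrightarrow>
     (\<forall>I\<in>stratum \<Delta> n. \<exists>u :: 'a \<Rightarrow> real. linear u \<and> u ` L \<subseteq> \<rat> \<and>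
        (\<forall>i\<in>stratum \<Delta> 1. le \<Delta> i I \<longrightarrow> u (v i) = 1))"

definition is_triangulation ::
    "'a::euclidean_space set \<Rightarrow> nat \<Rightarrow> ('s, 'a) multi_fan \<Rightarrow> ('b set, 'a) multi_fan \<Rightarrow>
     ('b set \<Rightarrow> 's) \<Rightarrow> bool" where
  "is_triangulation L n \<Delta> \<Delta>' \<rho> \<longleftrightarrow>
     is_simplicial_multi_fan L n \<Delta>' \<and>
     \<rho> ` simplices \<Delta>' \<subseteq> simplices \<Delta> \<and> monotone_on (simplices \<Delta>') (le \<Delta>') (le \<Delta>) \<rho> \<and>
     (\<exists>\<kappa>. bij_betw \<kappa> (stratum \<Delta> 1) (stratum \<Delta>' 1) \<and>
        (\<forall>i\<in>stratum \<Delta> 1. cone_at \<Delta> i = cone_at \<Delta>' (\<kappa> i) \<and> \<rho> (\<kappa> i) = i)) \<and>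
     (\<forall>J'\<in>simplices \<Delta>'. cone_at \<Delta>' J' \<subseteq> cone_at \<Delta> (\<rho> J') \<and>
        (\<forall>K\<in>simplices \<Delta>. le \<Delta> K (\<rho> J') \<longrightarrow> cone_at \<Delta>' J' \<subseteq> cone_at \<Delta> K \<longrightarrow> K = \<rho> J')) \<and>
     (\<forall>J\<in>simplices \<Delta>.
        inj_on (cone_at \<Delta>') {J'\<in>simplices \<Delta>'. le \<Delta> (\<rho> J') J} \<and>
        subdivides L (cone_at \<Delta>' ` {J'\<in>simplices \<Delta>'. le \<Delta> (\<rho> J') J}) (cone_at \<Delta> J)) \<and>
     (\<forall>I'\<in>stratum \<Delta>' n. w_plus \<Delta>' I' = w_plus \<Delta> (\<rho> I') \<and> w_minus \<Delta>' I' = w_minus \<Delta> (\<rho> I'))"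

text \<open>On \<open>stratum \<Delta>' 1\<close> the map \<open>\<rho>\<close> is the inverse of the bijection \<open>\<kappa>\<close>, which is therefore
  unique; so \<open>v \<circ> \<rho>\<close> is the family of edge vectors carried over to \<open>\<Delta>'\<close> by \<open>\<kappa>\<close>.\<close>
definition induced_edge_vectors :: "('s \<Rightarrow> 'a) \<Rightarrow> ('b set \<Rightarrow> 's) \<Rightarrow> 'b set \<Rightarrow> 'a" where
  "induced_edge_vectors v \<rho> = v \<circ> \<rho>"

section \<open>The orbifold elliptic genus\<close>

definition e2pi :: "complex \<Rightarrow> complex" where
  "e2pi x = exp (2 * of_real pi * \<i> * x)"

definition period_lattice :: "complex \<Rightarrow> complex set" where
  "period_lattice \<tau> = {of_int a + of_int b * \<tau> | a b :: int. True}"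

definition phi_st :: "complex \<Rightarrow> complex \<Rightarrow> complex \<Rightarrow> complex" where
  "phi_st z \<tau> \<sigma> = (let t = e2pi z; q = e2pi \<tau>; \<zeta> = e2pi \<sigma> in
     (1 - \<zeta> * t) / ((1 - \<zeta>) * (1 - t)) *
     prodinf (\<lambda>j. let k = Suc j in
       ((1 - q ^ k)\<^sup>2 * (1 - \<zeta> * t * q ^ k) * (1 - inverse \<zeta> * inverse t * q ^ k)) /
       ((1 - \<zeta> * q ^ k) * (1 - inverse \<zeta> * q ^ k) * (1 - t * q ^ k) * (1 - inverse t * q ^ k))))"

definition edge_lattice :: "('b set \<Rightarrow> 'a::euclidean_space) \<Rightarrow> 'b set \<Rightarrow> 'a set" where
  "edge_lattice v I = int_span ((\<lambda>i. v {i}) ` I)"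

definition dual_vector :: "('b set \<Rightarrow> 'a::euclidean_space) \<Rightarrow> 'b set \<Rightarrow> 'b \<Rightarrow> 'a \<Rightarrow> real" where
  "dual_vector v I i x = representation ((\<lambda>i. v {i}) ` I) x (v {i})"

definition H_group ::
    "'a::euclidean_space set \<Rightarrow> ('b set \<Rightarrow> 'a) \<Rightarrow> 'b set \<Rightarrow> 'a set set" where
  "H_group L v I = L // {(x, y). x \<in> L \<and> y \<in> L \<and> x - y \<in> edge_lattice v I}"

text \<open>The summands of the genus do not depend on the representative chosen here.\<close>
definition coset_rep :: "'a set \<Rightarrow> 'a" where
  "coset_rep h = (SOME x. x \<in> h)"

text \<open>\<open>\<langle>u\<^sub>i\<^sup>I, -w + \<tau> x - y\<rangle>\<close>\<close>
definition orbi_arg :: "('b set \<Rightarrow> 'a::euclidean_space) \<Rightarrow> 'b set \<Rightarrow> 'b \<Rightarrow>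
     complex \<Rightarrow> 'a \<times> 'a \<Rightarrow> 'a \<Rightarrow> 'a \<Rightarrow> complex" where
  "orbi_arg v I i \<tau> w x y =
     - complex_ext (dual_vector v I i) w
     + \<tau> * of_real (dual_vector v I i x) - of_real (dual_vector v I i y)"

definition orbifold_elliptic_genus ::
    "'a::euclidean_space set \<Rightarrow> nat \<Rightarrow> ('b set, 'a) multi_fan \<Rightarrow> ('b set \<Rightarrow> 'a) \<Rightarrow>
     complex \<Rightarrow> complex \<Rightarrow> 'a \<times> 'a \<Rightarrow> complex" where
  "orbifold_elliptic_genus L n \<Delta> v \<tau> \<sigma> w =
     (\<Sum>I\<in>stratum \<Delta> n. of_int (weight \<Delta> I) / of_nat (card (H_group L v I)) *
        (\<Sum>(h1, h2)\<in>H_group L v I \<times> H_group L v I.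
           \<Prod>i\<in>I. e2pi (of_real (dual_vector v I i (coset_rep h1)) * \<sigma>) *
             phi_st (orbi_arg v I i \<tau> w (coset_rep h1) (coset_rep h2)) \<tau> \<sigma>))"

text \<open>The poles of \<open>\<lambda>z. phi_st z \<tau> \<sigma>\<close> lie in \<open>period_lattice \<tau>\<close>. The following set is
  the complement in \<open>L \<otimes> \<complex>\<close> of a locally finite union of affine complex hyperplanes, and every
  summand of the genus is holomorphic on it. Two genera are therefore equal as meromorphic
  functions iff they agree at the points that are regular for both.\<close>
definition regular_points ::
    "'a::euclidean_space set \<Rightarrow> nat \<Rightarrow> ('b set, 'a) multi_fan \<Rightarrow> ('b set \<Rightarrow> 'a) \<Rightarrow>
     complex \<Rightarrow> ('a \<times> 'a) set" where
  "regular_points L n \<Delta> v \<tau> = {w \<in> complexification L.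
     \<forall>I\<in>stratum \<Delta> n. \<forall>i\<in>I. \<forall>x\<in>L. \<forall>y\<in>L. orbi_arg v I i \<tau> w x y \<notin> period_lattice \<tau>}"

end

theory Submission
  imports Defs "HOL-Complex_Analysis.Complex_Analysis"
begin

text \<open>Write \<open>q = e2pi \<tau>\<close>, \<open>\<zeta> = e2pi \<sigma>\<close>, \<open>t = e2pi z\<close>. For \<open>\<bar>q\<bar> < \<bar>t\<bar> < 1\<close>, Kronecker's formula gives
  \<open>phi_st z \<tau> \<sigma> = (\<Sum>k\<in>\<int>. t ^ k / (1 - \<zeta> * q ^ k))\<close>. Put \<open>p = Im w / Im \<tau>\<close> and suppose that no wall of a
  cone shifted by \<open>p\<close> contains a lattice point. Since the summands of the genus do not depend on the
  representatives, these may be taken in the half-open parallelepipeds at \<open>p\<close>, where the formula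
  applies to every factor. After summation over the second group variable, the contribution of a
  simplex becomes a Fourier series over the dual lattice whose coefficient at \<open>m\<close> is the rational
  form of the sum of \<open>\<zeta> powr u x * q powr (m \<bullet> x)\<close> over the lattice points \<open>x\<close> of the simplicial cone
  shifted by \<open>p\<close>; here \<open>u\<close> is the sum of the dual vectors, which by the Gorenstein condition is the
  same linear form for all simplices subdividing a maximal cone. The coefficients of these simplices
  therefore add up to the lattice point sum of the shifted maximal cone, which does not involve the
  triangulation. The remaining regular points \<open>w\<close> are limits of such points.\<close>

text \<open>The shift by \<open>p\<close> is what makes the subdivision additive: unshifted
  simplicial cones meet along walls, and their lattice point sums would count wall points
  repeatedly. The choice of \<open>p\<close> is forced, since the imaginary part of the argument of
  \<open>phi_st\<close> is \<open>Im \<tau> * (D i x - D i p)\<close>, so that the strip of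
  Kronecker's formula is exactly the box condition on \<open>x\<close>. The obstacle is convergence.
  The lattice point sum belonging to \<open>m\<close> needs
  \<open>Im \<sigma> + (m \<bullet> v i) * Im \<tau> > 0\<close> on all edges, and \<open>m\<close>
  runs through a whole dual lattice, so for positive rank no single \<open>\<sigma>\<close> serves
  every \<open>m\<close>. Hence there is no double series to rearrange: coefficients are compared
  for one \<open>m\<close> at a time, each continued separately, and only then inserted into the
  Fourier series. Kronecker's formula is itself proved by a Liouville argument: the difference of
  its two sides extends holomorphically across the pole and obeys a quasi-periodicity that only the
  zero function satisfies.\<close>

section \<open>The exponential with period 1 and the period lattice\<close>

lemma e2pi_add: "e2pi (x + y) = e2pi x * e2pi y"
  by (simp add: e2pi_def algebra_simps exp_add)

lemma e2pi_0 [simp]: "e2pi 0 = 1"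
  by (simp add: e2pi_def)

lemma e2pi_nonzero [simp]: "e2pi x \<noteq> 0"
  by (simp add: e2pi_def)

lemma e2pi_minus: "e2pi (- x) = inverse (e2pi x)"
  by (simp add: e2pi_def exp_minus)

lemma e2pi_diff: "e2pi (x - y) = e2pi x / e2pi y"
  by (simp add: e2pi_def algebra_simps exp_diff)

lemma e2pi_sum: "finite A \<Longrightarrow> e2pi (\<Sum>i\<in>A. f i) = (\<Prod>i\<in>A. e2pi (f i))"
  by (simp add: e2pi_def sum_distrib_left exp_sum)

lemma e2pi_of_int [simp]: "e2pi (of_int k) = 1"
  by (auto simp: e2pi_def exp_eq_1 intro!: exI[of _ k])

lemma e2pi_1 [simp]: "e2pi 1 = 1"
  using e2pi_of_int[of 1] by simp

lemma e2pi_eq_1_iff: "e2pi x = 1 \<longleftrightarrow> x \<in> \<int>"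
proof
  assume "e2pi x = 1"
  then obtain k :: int where "Im (2 * of_real pi * \<i> * x) = real_of_int (2 * k) * pi"
      "Re (2 * of_real pi * \<i> * x) = 0"
    by (auto simp: e2pi_def exp_eq_1)
  hence "x = of_int k" by (auto simp: complex_eq_iff)
  thus "x \<in> \<int>" by simp
qed (auto elim!: Ints_cases)

lemma norm_e2pi: "norm (e2pi x) = exp (- (2 * pi * Im x))"
  by (simp add: e2pi_def)

lemma norm_e2pi_less_iff: "norm (e2pi x) < norm (e2pi y) \<longleftrightarrow> Im y < Im x"
  by (simp add: norm_e2pi)

lemma e2pi_nat_mult: "e2pi (of_nat n * x) = e2pi x ^ n"
  by (induction n) (auto simp: algebra_simps e2pi_add)

lemma holomorphic_on_e2pi [holomorphic_intros]:
  "f holomorphic_on A \<Longrightarrow> (\<lambda>x. e2pi (f x)) holomorphic_on A"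
  unfolding e2pi_def by (intro holomorphic_intros)

text \<open>The multiplicative form of membership, \<open>t * q ^ k = 1\<close> for some integer
  \<open>k\<close>, is the one in which zeros of theta functions and of the denominators
  \<open>1 - \<zeta> * q ^ k\<close> appear.\<close>

lemma in_period_lattice_iff:
  "z \<in> period_lattice \<tau> \<longleftrightarrow> (\<exists>k::int. e2pi (z + of_int k * \<tau>) = 1)"
proof
  assume "z \<in> period_lattice \<tau>"
  then obtain a b :: int where "z = of_int a + of_int b * \<tau>"
    unfolding period_lattice_def by blast
  hence "z + of_int (- b) * \<tau> = of_int a" by simp
  thus "\<exists>k::int. e2pi (z + of_int k * \<tau>) = 1" using e2pi_of_int by metis
next
  assume "\<exists>k::int. e2pi (z + of_int k * \<tau>) = 1"
  then obtain k a :: int where "z + of_int k * \<tau> = of_int a"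
    by (auto simp: e2pi_eq_1_iff elim!: Ints_cases)
  hence "z = of_int a + of_int (- k) * \<tau>" by (simp add: algebra_simps)
  thus "z \<in> period_lattice \<tau>" unfolding period_lattice_def by blast
qed

section \<open>Kronecker's expansion of \<open>phi_st\<close>\<close>

text \<open>The infinite q-Pochhammer symbol \<open>(x; q)\<close>.\<close>

definition qpoch :: "complex \<Rightarrow> complex \<Rightarrow> complex" where
  "qpoch q x = (\<Prod>k. 1 - x * q ^ k)"

text \<open>The theta function in multiplicative form; for \<open>0 < norm q < 1\<close> it vanishes
  on nonzero \<open>x\<close> exactly at the integer powers of \<open>q\<close>.\<close>

definition qtheta :: "complex \<Rightarrow> complex \<Rightarrow> complex" where
  "qtheta q x = qpoch q x * qpoch q (q / x)"

context
  fixes q :: complex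
  assumes q: "norm q < 1"
begin

lemma convergent_prod_qpoch: "convergent_prod (\<lambda>k. 1 - x * q ^ k)"
proof -
  have "summable (\<lambda>k. norm x * norm q ^ k)"
    using q by (intro summable_mult summable_geometric) auto
  thus ?thesis
    by (intro abs_convergent_prod_imp_convergent_prod summable_imp_abs_convergent_prod)
      (simp add: norm_mult norm_power)
qed

lemma qpoch_LIMSEQ: "(\<lambda>n. \<Prod>k\<le>n. 1 - x * q ^ k) \<longlonglongrightarrow> qpoch q x"
  unfolding qpoch_def by (rule convergent_prod_LIMSEQ[OF convergent_prod_qpoch])

lemma qpoch_rec: "qpoch q x = (1 - x) * qpoch q (q * x)"
proof (rule LIMSEQ_unique)
  show "(\<lambda>n. \<Prod>k\<le>Suc n. 1 - x * q ^ k) \<longlonglongrightarrow> qpoch q x"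
    using qpoch_LIMSEQ by (rule LIMSEQ_Suc)
  have "(\<Prod>k\<le>Suc n. 1 - x * q ^ k) = (1 - x) * (\<Prod>k\<le>n. 1 - (q * x) * q ^ k)" for n
    by (subst prod.atMost_Suc_shift) (simp add: mult_ac)
  moreover have "(\<lambda>n. (1 - x) * (\<Prod>k\<le>n. 1 - (q * x) * q ^ k)) \<longlonglongrightarrow> (1 - x) * qpoch q (q * x)"
    by (intro tendsto_intros qpoch_LIMSEQ)
  ultimately show "(\<lambda>n. \<Prod>k\<le>Suc n. 1 - x * q ^ k) \<longlonglongrightarrow> (1 - x) * qpoch q (q * x)"
    by simp
qed

lemma qpoch_nonzero:
  assumes "\<And>k. x * q ^ k \<noteq> 1"
  shows "qpoch q x \<noteq> 0"
proof -
  have "1 - x * q ^ k \<noteq> 0" for k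
    using assms[of k] by (metis right_minus_eq)
  thus ?thesis
    unfolding qpoch_def by (intro prodinf_nonzero convergent_prod_qpoch)
qed

text \<open>On each ball of radius 1 the partial products converge uniformly, by comparison with a
  geometric series of ratio \<open>norm q\<close>; holomorphy passes to the limit.\<close>

lemma holomorphic_qpoch: "qpoch q holomorphic_on UNIV"
proof (rule holomorphic_uniform_sequence[where f = "\<lambda>n x. \<Prod>k<n. 1 - x * q ^ k"])
  fix x :: complex
  have "uniform_limit (cball x 1) (\<lambda>n x. \<Prod>k<n. 1 - x * q ^ k) (qpoch q) sequentially"
  proof -
    have "uniformly_convergent_on (cball x 1) (\<lambda>N x. \<Prod>n<N. 1 - x * q ^ n)"
    proof (rule uniformly_convergent_on_prod')
      have "uniform_limit (cball x 1) (\<lambda>n y. \<Sum>k<n. norm (y * q ^ k))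
              (\<lambda>y. \<Sum>k. norm (y * q ^ k)) sequentially"
      proof (rule Weierstrass_m_test)
        show "summable (\<lambda>k. (norm x + 1) * norm q ^ k)"
          using q by (intro summable_mult summable_geometric) auto
        fix n y assume "y \<in> cball x 1"
        hence "norm y \<le> norm x + 1"
          using norm_triangle_sub[of y x] by (simp add: dist_norm norm_minus_commute)
        thus "norm (norm (y * q ^ n)) \<le> (norm x + 1) * norm q ^ n"
          by (auto simp: norm_mult norm_power intro!: mult_right_mono)
      qed
      thus "uniformly_convergent_on (cball x 1) (\<lambda>N x. \<Sum>n<N. norm (1 - x * q ^ n - 1))"
        by (auto simp: uniformly_convergent_on_def)
    qed (auto intro!: continuous_intros)
    then obtain l where l: "uniform_limit (cball x 1) (\<lambda>N x. \<Prod>k<N. 1 - x * q ^ k) l sequentially"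
      by (auto simp: uniformly_convergent_on_def)
    have "qpoch q y = l y" if "y \<in> cball x 1" for y
      using LIMSEQ_unique tendsto_uniform_limitI[OF l that]
        qpoch_LIMSEQ[of y, folded LIMSEQ_lessThan_iff_atMost] by blast
    hence "?thesis \<longleftrightarrow> uniform_limit (cball x 1) (\<lambda>N x. \<Prod>k<N. 1 - x * q ^ k) l sequentially"
      by (intro uniform_limit_cong') simp_all
    thus ?thesis using l by simp
  qed
  thus "\<exists>d>0. cball x d \<subseteq> UNIV \<and>
    uniform_limit (cball x d) (\<lambda>n x. \<Prod>k<n. 1 - x * q ^ k) (qpoch q) sequentially"
    by (intro exI[of _ 1]) auto
qed (auto intro!: holomorphic_intros)

lemma holomorphic_on_qpoch [holomorphic_intros]:
  "f holomorphic_on A \<Longrightarrow> (\<lambda>x. qpoch q (f x)) holomorphic_on A"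
  using holomorphic_on_compose_gen[OF _ holomorphic_qpoch, of f A] by (simp add: o_def)

text \<open>By \<open>qpoch_rec\<close> the first product loses the factor \<open>1 - x\<close> and
  the second gains \<open>1 - 1 / x\<close>; their ratio is \<open>- 1 / x\<close>.\<close>

lemma qtheta_shift:
  assumes "q \<noteq> 0" "x \<noteq> 0"
  shows "qtheta q (q * x) = - qtheta q x / x"
proof -
  have "qtheta q (q * x) = qpoch q (q * x) * qpoch q (1 / x)"
    using assms by (simp add: qtheta_def)
  also have "qpoch q (1 / x) = (1 - 1 / x) * qpoch q (q / x)"
    by (subst qpoch_rec) simp
  finally show ?thesis
    unfolding qtheta_def using assms by (subst qpoch_rec[of x]) (simp add: field_simps)
qed

end

context
  fixes \<tau> :: complex
  assumes \<tau>: "Im \<tau> > 0"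
begin

lemma norm_e2pi_tau: "norm (e2pi \<tau>) < 1"
  using \<tau> by (simp add: norm_e2pi)

lemma qtheta_nonzero:
  assumes "z \<notin> period_lattice \<tau>"
  shows "qtheta (e2pi \<tau>) (e2pi z) \<noteq> 0"
proof -
  have *: "e2pi (z + of_int k * \<tau>) \<noteq> 1" for k :: int
    using assms in_period_lattice_iff by blast
  have "e2pi z * e2pi \<tau> ^ k \<noteq> 1" for k
    using *[of "int k"] by (simp add: e2pi_add e2pi_nat_mult)
  moreover have "e2pi \<tau> / e2pi z * e2pi \<tau> ^ k \<noteq> 1" for k
  proof
    assume "e2pi \<tau> / e2pi z * e2pi \<tau> ^ k = 1"
    hence "e2pi z = e2pi (of_nat (Suc k) * \<tau>)"
      unfolding e2pi_nat_mult by (simp add: field_simps)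
    moreover have "z + of_int (- int (Suc k)) * \<tau> = z - of_nat (Suc k) * \<tau>"
      by (simp add: algebra_simps)
    ultimately have "e2pi (z + of_int (- int (Suc k)) * \<tau>) = 1"
      by (simp only: e2pi_diff) simp
    thus False using * by blast
  qed
  ultimately show ?thesis
    unfolding qtheta_def using qpoch_nonzero[OF norm_e2pi_tau] by simp
qed

text \<open>The prefactor of \<open>phi_st\<close> consists of the factors with \<open>k = 0\<close>
  that the infinite product lacks; \<open>qpoch_rec\<close> merges them into the three theta
  functions.\<close>

lemma phi_st_eq_qtheta:
  "phi_st z \<tau> \<sigma> = qtheta (e2pi \<tau>) (e2pi \<sigma> * e2pi z) * (qpoch (e2pi \<tau>) (e2pi \<tau>))\<^sup>2 /
     (qtheta (e2pi \<tau>) (e2pi \<sigma>) * qtheta (e2pi \<tau>) (e2pi z))"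
proof -
  define q where "q = e2pi \<tau>"
  define t where "t = e2pi z"
  define \<zeta> where "\<zeta> = e2pi \<sigma>"
  have q: "norm q < 1" using norm_e2pi_tau by (simp add: q_def)
  have P: "(\<lambda>k. 1 - (x * q) * q ^ k) has_prod qpoch q (x * q)" for x
    unfolding qpoch_def using convergent_prod_qpoch[OF q] by (rule convergent_prod_has_prod)
  have P': "(\<lambda>k. 1 - x * q ^ Suc k) has_prod qpoch q (q * x)" for x
    using P[of x] by (simp add: mult_ac)
  \<comment> \<open>The redundant \<open>1 *\<close> makes the squared factor an instance of
    \<open>P'\<close> at \<open>x = 1\<close>.\<close>
  have "(\<lambda>k. ((1 - 1 * q ^ Suc k)\<^sup>2 * (1 - \<zeta> * t * q ^ Suc k) * (1 - inverse \<zeta> * inverse t * q ^ Suc k)) /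
       ((1 - \<zeta> * q ^ Suc k) * (1 - inverse \<zeta> * q ^ Suc k) * (1 - t * q ^ Suc k) * (1 - inverse t * q ^ Suc k)))
     has_prod ((qpoch q (q * 1))\<^sup>2 * qpoch q (q * (\<zeta> * t)) * qpoch q (q * (inverse \<zeta> * inverse t)) /
        (qpoch q (q * \<zeta>) * qpoch q (q * inverse \<zeta>) * qpoch q (q * t) * qpoch q (q * inverse t)))"
    unfolding power2_eq_square by (intro has_prod_divide has_prod_mult P')
  from has_prod_unique[OF this]
  have "phi_st z \<tau> \<sigma> = (1 - \<zeta> * t) / ((1 - \<zeta>) * (1 - t)) *
     ((qpoch q q)\<^sup>2 * qpoch q (q * (\<zeta> * t)) * qpoch q (q / (\<zeta> * t)) /
        (qpoch q (q * \<zeta>) * qpoch q (q / \<zeta>) * qpoch q (q * t) * qpoch q (q / t)))"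
    unfolding phi_st_def Let_def q_def t_def \<zeta>_def by (simp add: divide_inverse)
  also have "\<dots> = ((1 - \<zeta> * t) * qpoch q (q * (\<zeta> * t)) * qpoch q (q / (\<zeta> * t))) * (qpoch q q)\<^sup>2 /
     (((1 - \<zeta>) * qpoch q (q * \<zeta>) * qpoch q (q / \<zeta>)) * ((1 - t) * qpoch q (q * t) * qpoch q (q / t)))"
    by (simp add: mult_ac)
  also have "\<dots> = qtheta q (\<zeta> * t) * (qpoch q q)\<^sup>2 / (qtheta q \<zeta> * qtheta q t)"
    unfolding qtheta_def qpoch_rec[OF q, symmetric] ..
  finally show ?thesis by (simp add: q_def t_def \<zeta>_def)
qed

lemma phi_st_add_int: "phi_st (z + of_int k) \<tau> \<sigma> = phi_st z \<tau> \<sigma>"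
  by (simp add: phi_st_def e2pi_add)

text \<open>The theta functions at \<open>\<zeta> * t\<close> and at \<open>t\<close> acquire the
  factors \<open>- 1 / (\<zeta> * t)\<close> and \<open>- 1 / t\<close>, whose quotient is
  \<open>1 / \<zeta>\<close>.\<close>

lemma phi_st_add_tau: "phi_st (z + \<tau>) \<tau> \<sigma> = phi_st z \<tau> \<sigma> / e2pi \<sigma>"
proof -
  have *: "qtheta (e2pi \<tau>) (e2pi \<tau> * e2pi x) = - qtheta (e2pi \<tau>) (e2pi x) / e2pi x" for x
    by (rule qtheta_shift) (auto simp: norm_e2pi_tau)
  have "qtheta (e2pi \<tau>) (e2pi \<sigma> * e2pi (z + \<tau>)) =
      - qtheta (e2pi \<tau>) (e2pi \<sigma> * e2pi z) / (e2pi \<sigma> * e2pi z)"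
    using *[of "\<sigma> + z"] by (simp add: e2pi_add mult_ac)
  moreover have "qtheta (e2pi \<tau>) (e2pi (z + \<tau>)) = - qtheta (e2pi \<tau>) (e2pi z) / e2pi z"
    using *[of z] by (simp add: e2pi_add mult_ac)
  ultimately show ?thesis by (simp add: phi_st_eq_qtheta)
qed

lemma phi_st_add_nat_tau: "phi_st (z + of_nat k * \<tau>) \<tau> \<sigma> = phi_st z \<tau> \<sigma> / e2pi (of_nat k * \<sigma>)"
proof (induction k)
  case (Suc k)
  show ?case
    using phi_st_add_tau[of "z + of_nat k * \<tau>" \<sigma>] Suc
    by (simp add: algebra_simps e2pi_add)
qed auto

lemma phi_st_add_int_tau:
  "phi_st (z + of_int k * \<tau>) \<tau> \<sigma> = phi_st z \<tau> \<sigma> / e2pi (of_int k * \<sigma>)"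
proof (cases "k \<ge> 0")
  case True
  thus ?thesis using phi_st_add_nat_tau[of z "nat k" \<sigma>] by simp
next
  case False
  define n where "n = nat (- k)"
  have k: "k = - int n" using False by (simp add: n_def)
  have "phi_st z \<tau> \<sigma> = phi_st (z + of_int k * \<tau>) \<tau> \<sigma> / e2pi (of_nat n * \<sigma>)"
    using phi_st_add_nat_tau[of "z + of_int k * \<tau>" n \<sigma>] by (simp add: k)
  hence "phi_st (z + of_int k * \<tau>) \<tau> \<sigma> = phi_st z \<tau> \<sigma> * e2pi (of_nat n * \<sigma>)"
    by (simp add: field_simps)
  also have "e2pi (of_nat n * \<sigma>) = 1 / e2pi (of_int k * \<sigma>)"
    by (simp add: k e2pi_minus divide_inverse)
  finally show ?thesis by simp
qed

text \<open>The denominator is a product of theta values at \<open>\<sigma>\<close> and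
  \<open>z\<close>, nonzero off the period lattice. Continuity serves the passage from generic to
  arbitrary regular points.\<close>

lemma isCont_phi_st:
  assumes "z \<notin> period_lattice \<tau>" "\<sigma> \<notin> period_lattice \<tau>"
  shows "isCont (\<lambda>z. phi_st z \<tau> \<sigma>) z"
proof -
  have "continuous_on UNIV (qpoch (e2pi \<tau>))"
    by (rule holomorphic_on_imp_continuous_on[OF holomorphic_qpoch[OF norm_e2pi_tau]])
  hence "isCont (qpoch (e2pi \<tau>)) x" for x
    by (simp add: continuous_on_eq_continuous_at)
  hence c: "isCont (\<lambda>x. qpoch (e2pi \<tau>) (f x)) z" if "isCont f z" for f
    using isCont_o2[OF that] by blast
  have th: "isCont (\<lambda>x. qtheta (e2pi \<tau>) (f x)) z" if "isCont f z" "f z \<noteq> 0" for f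
    unfolding qtheta_def
    by (rule isCont_mult[OF c[OF that(1)] c[OF isCont_divide[OF continuous_const that]]])
  have e: "isCont e2pi z"
    unfolding e2pi_def by (intro continuous_intros)
  have "isCont (\<lambda>x. qtheta (e2pi \<tau>) (e2pi \<sigma> * e2pi x)) z"
    by (rule th) (simp_all add: e isCont_mult)
  moreover have "isCont (\<lambda>x. qtheta (e2pi \<tau>) (e2pi x)) z"
    by (rule th) (simp_all add: e)
  ultimately show ?thesis
    unfolding phi_st_eq_qtheta
    using assms by (intro isCont_divide isCont_mult continuous_const) (simp_all add: qtheta_nonzero)
qed

end

text \<open>A Liouville argument: a twist by an exponential makes the modulus doubly periodic, so it
  attains its maximum inside the strip and the twisted function is constant; a nonzero constant
  would put \<open>\<sigma>\<close> into the period lattice. The law for \<open>\<tau>\<close> is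
  assumed just where both \<open>z\<close> and \<open>z + \<tau>\<close> lie in the strip.\<close>

lemma quasi_periodic_strip_eq_0:
  assumes \<tau>: "Im \<tau> > 0" and \<sigma>: "\<sigma> \<notin> period_lattice \<tau>"
    and hol: "h holomorphic_on {z. \<bar>Im z\<bar> < Im \<tau>}"
    and per1: "\<And>z. h (z + 1) = h z"
    and per\<tau>: "\<And>z. \<lbrakk>- Im \<tau> < Im z; Im z < 0\<rbrakk> \<Longrightarrow> h (z + \<tau>) = h z / e2pi \<sigma>"
    and z: "\<bar>Im z\<bar> < Im \<tau>"
  shows "h z = 0"
proof -
  define S where "S = {z. \<bar>Im z\<bar> < Im \<tau>}"
  define b where "b = complex_of_real (Im \<sigma> / Im \<tau>)"
  \<comment> \<open>\<open>b\<close> is chosen so that \<open>\<bar>H\<bar>\<close> is doubly periodic\<close>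
  define H where "H = (\<lambda>z. h z * e2pi (b * z))"
  have S: "open S" "connected S"
  proof -
    have S_eq: "S = {z. Im z < Im \<tau>} \<inter> {z. Im z > - Im \<tau>}" by (auto simp: S_def)
    show "open S" unfolding S_eq by (intro open_Int open_halfspace_Im_lt open_halfspace_Im_gt)
    show "connected S" unfolding S_eq
      by (intro convex_connected convex_Int convex_halfspace_Im_lt convex_halfspace_Im_gt)
  qed
  have holH: "H holomorphic_on S"
    unfolding H_def S_def by (intro holomorphic_intros hol)
  have norm_b: "norm (e2pi b) = 1"
    by (simp add: norm_e2pi b_def)
  have "Im (b * \<tau>) = Im \<sigma>"
    using \<tau> by (simp add: b_def)
  hence norm_b\<tau>: "norm (e2pi (b * \<tau>)) = norm (e2pi \<sigma>)"
    by (simp add: norm_e2pi)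
  have H1: "norm (H (z + 1)) = norm (H z)" for z
    by (simp add: H_def per1 distrib_left e2pi_add norm_mult norm_b)
  have Hint: "norm (H (z + of_int k)) = norm (H z)" for z k
  proof (induction k rule: int_induct[where k = 0])
    case (step1 i)
    thus ?case using H1[of "z + of_int i"] by (simp add: add_ac)
  next
    case (step2 i)
    thus ?case using H1[of "z + of_int (i - 1)"] by (simp add: algebra_simps)
  qed auto
  have H\<tau>: "norm (H (z + \<tau>)) = norm (H z)" if "- Im \<tau> < Im z" "Im z < 0" for z
    using norm_b\<tau> by (simp add: H_def per\<tau>[OF that] distrib_left e2pi_add norm_mult norm_divide)
  \<comment> \<open>A closed fundamental domain inside the open strip: the maximum over
    \<open>K\<close> bounds \<open>H\<close> on all of \<open>S\<close> and is attained at an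
    interior point of \<open>S\<close>.\<close>
  define K where "K = cbox (Complex 0 (- (Im \<tau> / 2))) (Complex 1 (Im \<tau> / 2))"
  have "K \<subseteq> S"
    using \<tau> by (auto simp: K_def S_def in_cbox_complex_iff)
  have "compact K" unfolding K_def by (rule compact_cbox)
  moreover have "0 \<in> K" using \<tau> by (auto simp: K_def in_cbox_complex_iff)
  moreover have "continuous_on K (\<lambda>z. norm (H z))"
    using holomorphic_on_imp_continuous_on[OF holomorphic_on_subset[OF holH \<open>K \<subseteq> S\<close>]]
    by (rule continuous_on_norm)
  ultimately obtain \<xi> where \<xi>: "\<xi> \<in> K" "\<And>z. z \<in> K \<Longrightarrow> norm (H z) \<le> norm (H \<xi>)"
    using continuous_attains_sup[of K "\<lambda>z. norm (H z)"] by blast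
  have le1: "norm (H z) \<le> norm (H \<xi>)" if "\<bar>Im z\<bar> \<le> Im \<tau> / 2" for z
  proof -
    have "z + of_int (- \<lfloor>Re z\<rfloor>) \<in> K"
      using that by (auto simp: K_def in_cbox_complex_iff) linarith
    thus ?thesis using \<xi>(2) Hint by metis
  qed
  have le: "norm (H z) \<le> norm (H \<xi>)" if "z \<in> S" for z
  proof -
    consider "\<bar>Im z\<bar> \<le> Im \<tau> / 2" | "Im z > Im \<tau> / 2" | "Im z < - (Im \<tau> / 2)" by linarith
    thus ?thesis
    proof cases
      case 2
      have "norm (H (z - \<tau>)) \<le> norm (H \<xi>)"
        by (rule le1) (use that 2 in \<open>auto simp: S_def\<close>)
      moreover have "norm (H (z - \<tau> + \<tau>)) = norm (H (z - \<tau>))"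
        by (rule H\<tau>) (use that 2 \<tau> in \<open>auto simp: S_def\<close>)
      ultimately show ?thesis by simp
    next
      case 3
      have "norm (H (z + \<tau>)) \<le> norm (H \<xi>)"
        by (rule le1) (use that 3 in \<open>auto simp: S_def\<close>)
      moreover have "norm (H (z + \<tau>)) = norm (H z)"
        by (rule H\<tau>) (use that 3 \<tau> in \<open>auto simp: S_def\<close>)
      ultimately show ?thesis by simp
    qed (rule le1)
  qed
  have "H constant_on S"
    by (rule maximum_modulus_principle[OF holH S, of S \<xi>]) (use S le \<xi>(1) \<open>K \<subseteq> S\<close> in auto)
  then obtain C where C: "\<And>z. z \<in> S \<Longrightarrow> H z = C"
    unfolding constant_on_def by blast
  have "C = 0"
  proof (rule ccontr)
    assume "C \<noteq> 0"
    \<comment> \<open>For constant \<open>H\<close>, the translation laws of \<open>h\<close> under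
      1 and \<open>\<tau>\<close> turn into \<open>e2pi b = 1\<close> and
      \<open>e2pi (b * \<tau>) = e2pi \<sigma>\<close>; together they contradict the hypothesis on
      \<open>\<sigma>\<close>.\<close>
    have in_S: "0 \<in> S" "1 \<in> S" "\<tau> / 2 \<in> S" "- \<tau> / 2 \<in> S" using \<tau> by (auto simp: S_def)
    have "H 1 = H 0" using C in_S by simp
    moreover have "h 1 = h 0" using per1[of 0] by simp
    moreover have "h 0 \<noteq> 0" using C[OF in_S(1)] \<open>C \<noteq> 0\<close> by (auto simp: H_def)
    ultimately have "e2pi b = 1" by (simp add: H_def)
    then obtain k where k: "b = of_int k"
      by (auto simp: e2pi_eq_1_iff elim: Ints_cases)
    have "H (\<tau> / 2) = H (- \<tau> / 2)" using C in_S by simp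
    moreover have "h (\<tau> / 2) = h (- \<tau> / 2) / e2pi \<sigma>"
      using per\<tau>[of "- \<tau> / 2"] \<tau> by simp
    moreover have "h (- \<tau> / 2) \<noteq> 0" using C[OF in_S(4)] \<open>C \<noteq> 0\<close> by (auto simp: H_def)
    ultimately have "e2pi (b * (\<tau> / 2)) = e2pi \<sigma> * e2pi (b * (- \<tau> / 2))"
      by (simp add: H_def divide_simps mult.commute)
    moreover have "b * (- \<tau> / 2) = - (b * (\<tau> / 2))" by simp
    ultimately have "e2pi (b * (\<tau> / 2)) * e2pi (b * (\<tau> / 2)) = e2pi \<sigma>"
      by (simp only: e2pi_minus) (simp add: field_simps)
    hence "e2pi (b * \<tau>) = e2pi \<sigma>"
      by (simp flip: e2pi_add add: mult.commute)
    hence "e2pi (\<sigma> + of_int (- k) * \<tau>) = 1"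
      by (simp add: e2pi_diff k)
    thus False using \<sigma> in_period_lattice_iff by blast
  qed
  thus ?thesis using C[of z] z by (simp add: S_def H_def)
qed

section \<open>Kronecker's series on an annulus in the variable \<open>t\<close>\<close>

context
  fixes \<tau> \<sigma> :: complex
  assumes \<tau>: "Im \<tau> > 0" and \<sigma>: "\<sigma> \<notin> period_lattice \<tau>"
begin

private definition "q = e2pi \<tau>"
private definition "\<zeta> = e2pi \<sigma>"
text \<open>The image of the strip \<open>\<bar>Im z\<bar> < Im \<tau>\<close> under
  \<open>e2pi\<close>. Its only point among the powers of \<open>q\<close>, hence the only possible
  pole of \<open>phi_st\<close>, is \<open>t = 1\<close>.\<close>

private definition "An = {t. norm q < norm t \<and> norm t < 1 / norm q}"
text \<open>This is \<open>(1 - t) * phi_st\<close>, the factor \<open>1 - t\<close> having been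
  cancelled from \<open>qtheta q t\<close>; its value at \<open>t = 1\<close> is 1.\<close>

private definition "P = (\<lambda>t. qtheta q (\<zeta> * t) * (qpoch q q)\<^sup>2 /
  (qtheta q \<zeta> * (qpoch q (q * t) * qpoch q (q / t))))"
text \<open>Off \<open>t = 1\<close> this equals \<open>1 / (1 - t) - phi_st\<close>; as a
  difference quotient of \<open>P\<close> it extends holomorphically over the pole.\<close>

private definition "K = (\<lambda>t. if t = 1 then deriv P 1 else (P t - P 1) / (t - 1))"
text \<open>Separating \<open>1 / (1 - t)\<close> from Kronecker's series leaves two power series, in \<open>t\<close> and in
  \<open>1 / t\<close>, with coefficients \<open>a\<close> and \<open>b\<close>; they converge on \<open>An\<close>, on both sides of the pole at
  \<open>t = 1\<close>. In terms of \<open>t = e2pi z\<close>, \<open>- h\<close> is the difference of \<open>phi_st\<close> and its expansion.\<close>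
private definition "a = (\<lambda>n::nat. \<zeta> * q ^ n / (1 - \<zeta> * q ^ n))"
private definition "b = (\<lambda>n::nat. if n = 0 then 0 else q ^ n / (q ^ n - \<zeta>))"
private definition "h = (\<lambda>t. K t + (\<Sum>n. a n * t ^ n) + (\<Sum>n. b n * inverse t ^ n))"

private lemma q: "q \<noteq> 0" "norm q < 1" "norm q > 0"
  using norm_e2pi_tau[OF \<tau>] by (auto simp: q_def)

private lemma \<zeta>_nz: "\<zeta> \<noteq> 0" by (simp add: \<zeta>_def)

private lemma \<zeta>_neq: "\<zeta> * q ^ n \<noteq> 1" "q ^ n \<noteq> \<zeta>"
proof -
  have *: "e2pi (\<sigma> + of_int k * \<tau>) \<noteq> 1" for k :: int
    using \<sigma> in_period_lattice_iff by blast
  show "\<zeta> * q ^ n \<noteq> 1"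
    using *[of "int n"] by (simp add: e2pi_add e2pi_nat_mult \<zeta>_def q_def)
  show "q ^ n \<noteq> \<zeta>"
    using *[of "- int n"] by (auto simp: e2pi_diff e2pi_nat_mult \<zeta>_def q_def)
qed

private lemma q_pow_lim: "(\<lambda>n. q ^ n) \<longlonglongrightarrow> 0"
  using q(2) by (rule LIMSEQ_power_zero)

text \<open>Coefficients of size \<open>O(q ^ n)\<close> give radius of convergence at least
  \<open>1 / norm q\<close>, which is what carries both series across the circle
  \<open>norm t = 1\<close>.\<close>

private lemma bound_imp_summable:
  assumes "(\<lambda>n. c n / q ^ n) \<longlonglongrightarrow> l" "norm t < 1 / norm q"
  shows "summable (\<lambda>n. norm (c n * t ^ n))"
proof -
  obtain B where B: "\<And>n. norm (c n / q ^ n) \<le> B"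
    using convergentI[OF assms(1), THEN convergent_imp_Bseq] by (auto simp: Bseq_def)
  have "norm q * norm t < 1"
    using assms(2) q by (simp add: field_simps)
  hence "summable (\<lambda>n. B * (norm q * norm t) ^ n)"
    by (intro summable_mult summable_geometric) simp
  thus ?thesis
  proof (rule summable_comparison_test')
    fix n
    have "norm (c n) \<le> B * norm q ^ n"
      using B[of n] q by (simp add: norm_divide norm_power field_simps)
    thus "norm (norm (c n * t ^ n)) \<le> B * (norm q * norm t) ^ n"
      by (auto simp: norm_mult norm_power power_mult_distrib mult.assoc[symmetric] intro!: mult_right_mono)
  qed
qed

private lemma summable_a: "norm t < 1 / norm q \<Longrightarrow> summable (\<lambda>n. norm (a n * t ^ n))"
proof (rule bound_imp_summable)
  have "(\<lambda>n. \<zeta> / (1 - \<zeta> * q ^ n)) \<longlonglongrightarrow> \<zeta> / (1 - \<zeta> * 0)"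
    by (intro tendsto_intros q_pow_lim) simp
  thus "(\<lambda>n. a n / q ^ n) \<longlonglongrightarrow> \<zeta> / (1 - \<zeta> * 0)"
    using q by (simp add: a_def)
qed

private lemma summable_b: "norm t < 1 / norm q \<Longrightarrow> summable (\<lambda>n. norm (b n * t ^ n))"
proof (rule bound_imp_summable)
  have "(\<lambda>n. 1 / (q ^ n - \<zeta>)) \<longlonglongrightarrow> 1 / (0 - \<zeta>)"
    by (intro tendsto_intros q_pow_lim) (simp add: \<zeta>_nz)
  moreover have "eventually (\<lambda>n. b n / q ^ n = 1 / (q ^ n - \<zeta>)) sequentially"
    using eventually_gt_at_top[of 0] by eventually_elim (use q in \<open>simp add: b_def\<close>)
  ultimately show "(\<lambda>n. b n / q ^ n) \<longlonglongrightarrow> 1 / (0 - \<zeta>)"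
    using tendsto_cong by fast
qed

private lemma holomorphic_series:
  assumes "\<And>t. norm t < r \<Longrightarrow> summable (\<lambda>n. norm (c n * t ^ n))"
  shows "(\<lambda>t. \<Sum>n. c n * t ^ n :: complex) holomorphic_on ball 0 r"
  by (rule power_series_holomorphic[where a = c])
    (use assms in \<open>auto intro!: summable_sums intro: summable_norm_cancel\<close>)

private lemma phi_P: "phi_st z \<tau> \<sigma> = P (e2pi z) / (1 - e2pi z)"
proof -
  have "qtheta q (e2pi z) = (1 - e2pi z) * (qpoch q (q * e2pi z) * qpoch q (q / e2pi z))"
    unfolding qtheta_def using qpoch_rec[OF q(2), of "e2pi z"] by simp
  thus ?thesis unfolding phi_st_eq_qtheta[OF \<tau>] P_def q_def[symmetric] \<zeta>_def[symmetric]
    by (simp add: mult_ac)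
qed

private lemma qtheta_\<zeta>: "qtheta q \<zeta> \<noteq> 0"
  unfolding q_def \<zeta>_def by (rule qtheta_nonzero[OF \<tau> \<sigma>])

private lemma qpoch_nz: "norm x < 1 \<Longrightarrow> qpoch q x \<noteq> 0"
proof (rule qpoch_nonzero[OF q(2)])
  fix k assume x: "norm x < 1"
  have "norm (x * q ^ k) \<le> norm x * 1"
    unfolding norm_mult norm_power using q by (intro mult_left_mono power_le_one) auto
  thus "x * q ^ k \<noteq> 1" using x by auto
qed

private lemma P_1: "P 1 = 1"
  using qtheta_\<zeta> qpoch_nz[of q] q by (simp add: P_def power2_eq_square)

private lemma An_nz: "t \<in> An \<Longrightarrow> t \<noteq> 0"
  using q by (auto simp: An_def)

private lemma open_An: "open An"
  unfolding An_def by (intro open_Collect_conj open_Collect_less continuous_intros)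

text \<open>On \<open>An\<close> both \<open>q * t\<close> and \<open>q / t\<close> have norm below
  1, so the denominator of \<open>P\<close> has no zeros and \<open>pole_lemma_open\<close> applies
  to \<open>K\<close>. Since \<open>An\<close> is stable under inversion, the series in
  \<open>1 / t\<close> is a power series composed with \<open>inverse\<close>.\<close>

private lemma holomorphic_h: "h holomorphic_on An"
proof -
  have "norm (q * t) < 1 \<and> norm (q / t) < 1" if "t \<in> An" for t
    using that q An_nz[OF that] by (auto simp: An_def norm_mult norm_divide field_simps)
  hence "P holomorphic_on An"
    unfolding P_def qtheta_def
    by (intro holomorphic_intros q(2)) (use qtheta_\<zeta> qpoch_nz An_nz \<zeta>_nz in \<open>auto simp: qtheta_def\<close>)
  hence "K holomorphic_on An"
    unfolding K_def using open_An by (rule pole_lemma_open)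
  moreover have "(\<lambda>t. \<Sum>n. a n * t ^ n) holomorphic_on An"
    by (rule holomorphic_on_subset[OF holomorphic_series[OF summable_a, of "1 / norm q"]])
      (auto simp: An_def)
  moreover have "((\<lambda>t. \<Sum>n. b n * t ^ n) \<circ> inverse) holomorphic_on An"
    by (rule holomorphic_on_compose_gen[OF _ holomorphic_series[OF summable_b, of "1 / norm q"]])
      (use An_nz q in \<open>auto intro!: holomorphic_intros simp: An_def inverse_eq_divide norm_divide frac_less2\<close>)
  ultimately show ?thesis
    unfolding h_def o_def by (intro holomorphic_intros)
qed

private lemma h_eq:
  assumes "e2pi z \<noteq> 1"
  shows "h (e2pi z) = 1 / (1 - e2pi z) + (\<Sum>n. a n * e2pi z ^ n) +
    (\<Sum>n. b n * inverse (e2pi z) ^ n) - phi_st z \<tau> \<sigma>"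
proof -
  have "K (e2pi z) = 1 / (1 - e2pi z) - phi_st z \<tau> \<sigma>"
    using assms by (simp add: K_def P_1 phi_P field_simps)
  thus ?thesis by (simp add: h_def)
qed

text \<open>Here \<open>1 < norm t < 1 / norm q\<close>, so the geometric series converge at
  \<open>q * t\<close> and at \<open>1 / t\<close>. They turn \<open>1 / (1 - q * t)\<close> and
  \<open>1 / (1 - t)\<close> into series that combine term by term with those of \<open>a\<close>
  and \<open>b\<close>.\<close>

private lemma h_shift:
  assumes z: "- Im \<tau> < Im z" "Im z < 0"
  shows "h (e2pi (z + \<tau>)) = h (e2pi z) / \<zeta>"
proof -
  define t where "t = e2pi z"
  have t: "norm t > 1" "norm t < 1 / norm q" "t \<noteq> 0"
    using z norm_e2pi_less_iff[of 0 z] norm_e2pi_less_iff[of z "- \<tau>"]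
    by (simp_all add: t_def q_def e2pi_minus inverse_eq_divide norm_divide)
  have qt: "norm (q * t) < 1" using t q by (simp add: norm_mult field_simps)
  have qt': "norm (inverse (q * t)) < 1 / norm q"
    using t q by (simp add: norm_mult inverse_eq_divide norm_divide divide_simps)
  have t': "norm (inverse t) < 1" using t by (simp add: inverse_eq_divide norm_divide field_simps)
  have t'': "norm (inverse t) < 1 / norm q" "norm (q * t) < 1 / norm q"
  proof -
    have "1 < 1 / norm q" using q by simp
    thus "norm (inverse t) < 1 / norm q" "norm (q * t) < 1 / norm q"
      using t' qt by linarith+
  qed
  have sm: "summable (\<lambda>n. a n * x ^ n)" "summable (\<lambda>n. b n * x ^ n)" if "norm x < 1 / norm q" for x
    by (rule summable_norm_cancel[OF summable_a[OF that]] summable_norm_cancel[OF summable_b[OF that]])+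
  have "(\<lambda>n. (q * t) ^ n + a n * (q * t) ^ n) sums (1 / (1 - q * t) + (\<Sum>n. a n * (q * t) ^ n))"
    by (intro sums_add geometric_sums qt summable_sums sm t'')
  moreover have "(q * t) ^ n + a n * (q * t) ^ n = a n * t ^ n / \<zeta>" for n
    using \<zeta>_neq(1)[of n] \<zeta>_nz by (simp add: a_def power_mult_distrib divide_simps) (simp add: algebra_simps)
  moreover have "(\<lambda>n. a n * t ^ n / \<zeta>) sums ((\<Sum>n. a n * t ^ n) / \<zeta>)"
    by (intro sums_divide summable_sums sm t)
  ultimately have 1: "1 / (1 - q * t) + (\<Sum>n. a n * (q * t) ^ n) = (\<Sum>n. a n * t ^ n) / \<zeta>"
    using sums_unique2 by simp
  have "(\<lambda>n. b n * inverse t ^ n / \<zeta> - inverse t ^ n / \<zeta>) sums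
      ((\<Sum>n. b n * inverse t ^ n) / \<zeta> - 1 / (1 - inverse t) / \<zeta>)"
    by (intro sums_diff sums_divide geometric_sums t' summable_sums sm t'')
  \<comment> \<open>Because \<open>b 0 = 0\<close>, the dropped term with \<open>n = 0\<close> is
    \<open>- 1 / \<zeta>\<close>. The resulting \<open>+ 1 / \<zeta>\<close> is what converts the
    geometric sum in \<open>1 / t\<close> into \<open>1 / (1 - t)\<close> in fact
    \<open>3\<close>.\<close>
  hence "(\<lambda>n. b (Suc n) * inverse t ^ Suc n / \<zeta> - inverse t ^ Suc n / \<zeta>) sums
      ((\<Sum>n. b n * inverse t ^ n) / \<zeta> - 1 / (1 - inverse t) / \<zeta> + 1 / \<zeta>)"
    by (subst sums_Suc_iff) (simp add: b_def)
  moreover have "b (Suc n) * inverse t ^ Suc n / \<zeta> - inverse t ^ Suc n / \<zeta> =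
      b (Suc n) * inverse (q * t) ^ Suc n" for n
    using \<zeta>_neq(2)[of "Suc n"] \<zeta>_nz q t
    by (simp add: b_def power_mult_distrib divide_simps del: power_Suc)
  moreover have "(\<lambda>n. b (Suc n) * inverse (q * t) ^ Suc n) sums (\<Sum>n. b n * inverse (q * t) ^ n)"
    by (subst sums_Suc_iff) (use summable_sums[OF sm(2)[OF qt']] in \<open>simp add: b_def\<close>)
  ultimately have 2: "(\<Sum>n. b n * inverse t ^ n) / \<zeta> - 1 / (1 - inverse t) / \<zeta> + 1 / \<zeta> =
      (\<Sum>n. b n * inverse (q * t) ^ n)"
    using sums_unique2 by simp
  have 3: "1 / \<zeta> - 1 / (1 - inverse t) / \<zeta> = 1 / (1 - t) / \<zeta>"
    using t \<zeta>_nz by (auto simp: divide_simps)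
  have ne: "e2pi z \<noteq> 1" "e2pi (z + \<tau>) \<noteq> 1" and qt_eq: "e2pi (z + \<tau>) = q * t"
    using t qt by (auto simp: t_def e2pi_add q_def mult_ac)
  have "h (q * t) = (1 / (1 - q * t) + (\<Sum>n. a n * (q * t) ^ n)) +
      (\<Sum>n. b n * inverse (q * t) ^ n) - phi_st z \<tau> \<sigma> / \<zeta>"
    using h_eq[OF ne(2)] by (simp only: qt_eq phi_st_add_tau[OF \<tau>] \<zeta>_def)
  also have "\<dots> = (\<Sum>n. a n * t ^ n) / \<zeta> + (\<Sum>n. b n * inverse t ^ n) / \<zeta> +
      (1 / \<zeta> - 1 / (1 - inverse t) / \<zeta>) - phi_st z \<tau> \<sigma> / \<zeta>"
    unfolding 1 2[symmetric] by (simp only: add_ac diff_conv_add_uminus)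
  also have "\<dots> = h t / \<zeta>"
    using h_eq[OF ne(1)] by (simp only: 3 t_def[symmetric] add_divide_distrib diff_divide_distrib add_ac)
  finally show ?thesis by (simp only: qt_eq t_def)
qed

private lemma phi_st_eq_series:
  assumes z: "0 < Im z" "Im z < Im \<tau>"
  shows "phi_st z \<tau> \<sigma> = 1 / (1 - e2pi z) + (\<Sum>n. a n * e2pi z ^ n) + (\<Sum>n. b n * inverse (e2pi z) ^ n)"
proof -
  have "(h \<circ> e2pi) z = 0"
  proof (rule quasi_periodic_strip_eq_0[OF \<tau> \<sigma>, where h = "h \<circ> e2pi"])
    show "(h \<circ> e2pi) holomorphic_on {z. \<bar>Im z\<bar> < Im \<tau>}"
    proof (rule holomorphic_on_compose_gen[OF _ holomorphic_h])
      show "e2pi ` {z. \<bar>Im z\<bar> < Im \<tau>} \<subseteq> An"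
        using norm_e2pi_less_iff[of \<tau>] norm_e2pi_less_iff[of _ "- \<tau>"]
        by (auto simp: An_def q_def e2pi_minus inverse_eq_divide norm_divide)
    qed (intro holomorphic_intros)
  qed (use z h_shift in \<open>auto simp: e2pi_add \<zeta>_def\<close>)
  moreover have "norm (e2pi z) \<noteq> 1" using z by (simp add: norm_e2pi)
  hence "e2pi z \<noteq> 1" by auto
  ultimately show ?thesis using h_eq by simp
qed

text \<open>The terms with \<open>k \<ge> 0\<close> come from the geometric series together with
  \<open>a\<close>, those with \<open>k < 0\<close> from \<open>b\<close>. Each half converges
  absolutely, so the halves join to an unordered sum over the integers.\<close>

lemma phi_st_has_sum:
  assumes z: "0 < Im z" "Im z < Im \<tau>"
  shows "((\<lambda>k::int. e2pi (of_int k * z) / (1 - e2pi (\<sigma> + of_int k * \<tau>))) has_sum phi_st z \<tau> \<sigma>) UNIV"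
    (is "(?f has_sum _) _")
proof -
  define t where "t = e2pi z"
  have t: "norm t < 1" "norm t > norm q"
    using z by (auto simp: t_def norm_e2pi q_def)
  have t': "norm t < 1 / norm q" "norm (inverse t) < 1 / norm q"
  proof -
    have "norm t * norm q < 1 * 1" by (rule mult_strict_mono) (use t q in auto)
    thus "norm t < 1 / norm q" using q by (simp add: field_simps)
    show "norm (inverse t) < 1 / norm q"
      using t q by (simp add: inverse_eq_divide norm_divide frac_less2)
  qed
  have f1: "t ^ n + a n * t ^ n = ?f (int n)" for n
    using \<zeta>_neq(1)[of n]
    by (simp add: a_def t_def e2pi_add e2pi_nat_mult \<zeta>_def[symmetric] q_def[symmetric] divide_simps)
      (simp add: algebra_simps)
  have f2: "b n * inverse t ^ n = ?f (- int n)" if "n \<noteq> 0" for n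
    using \<zeta>_neq(2)[of n] that q
    by (simp add: b_def t_def e2pi_diff e2pi_minus e2pi_nat_mult \<zeta>_def[symmetric] q_def[symmetric] divide_simps)
  have "((\<lambda>n. t ^ n + a n * t ^ n) has_sum (1 / (1 - t) + (\<Sum>n. a n * t ^ n))) UNIV"
    by (intro has_sum_add norm_summable_imp_has_sum geometric_sums t summable_sums
      summable_a t' summable_norm_cancel[OF summable_a])
      (use t in \<open>simp add: norm_power\<close>)
  hence "((?f \<circ> int) has_sum (1 / (1 - t) + (\<Sum>n. a n * t ^ n))) UNIV"
    by (simp add: f1 o_def)
  hence 1: "(?f has_sum (1 / (1 - t) + (\<Sum>n. a n * t ^ n))) (int ` UNIV)"
    by (subst has_sum_reindex) auto
  have "((\<lambda>n. b n * inverse t ^ n) has_sum (\<Sum>n. b n * inverse t ^ n)) UNIV"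
    by (intro norm_summable_imp_has_sum summable_b t' summable_sums summable_norm_cancel[OF summable_b])
  also have "?this \<longleftrightarrow> ((\<lambda>n. b n * inverse t ^ n) has_sum (\<Sum>n. b n * inverse t ^ n)) {1..}"
    by (rule has_sum_cong_neutral) (auto simp: b_def)
  also have "\<dots> \<longleftrightarrow> ((?f \<circ> (\<lambda>n. - int n)) has_sum (\<Sum>n. b n * inverse t ^ n)) {1..}"
    by (rule has_sum_cong) (simp add: f2)
  finally have 2: "(?f has_sum (\<Sum>n. b n * inverse t ^ n)) ((\<lambda>n. - int n) ` {1..})"
    by (subst has_sum_reindex) (auto intro: inj_onI)
  have "int ` UNIV \<inter> (\<lambda>n. - int n) ` {1..} = {}" by auto
  from has_sum_Un_disjoint[OF 1 2 this]
  have "(?f has_sum phi_st z \<tau> \<sigma>) (int ` UNIV \<union> (\<lambda>n. - int n) ` {1..})"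
    using phi_st_eq_series[OF z] by (simp add: t_def)
  moreover have "int ` UNIV \<union> (\<lambda>n. - int n) ` {1..} = UNIV"
  proof -
    have "x \<in> int ` UNIV \<union> (\<lambda>n. - int n) ` {1..}" for x
      by (cases "x \<ge> 0") (auto intro: rev_image_eqI[of "nat x"] rev_image_eqI[of "nat (- x)"])
    thus ?thesis by blast
  qed
  ultimately show ?thesis by simp
qed

end

section \<open>Full-dimensional simplices of lattice vectors\<close>

text \<open>Summable complex families are absolutely summable, so finitely many of them may be
  multiplied out. This turns a product of Kronecker expansions into one sum over tuples of
  exponents.\<close>

lemma has_sum_prod_PiE:
  fixes f :: "'i \<Rightarrow> 'j \<Rightarrow> complex"
  assumes "finite I" and "\<And>i. i \<in> I \<Longrightarrow> (f i has_sum s i) (B i)"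
  shows "((\<lambda>g. \<Prod>i\<in>I. f i (g i)) has_sum (\<Prod>i\<in>I. s i)) (PiE I B)"
  using assms
proof (induction I rule: finite_induct)
  case (insert i I)
  define F where "F = (\<lambda>g. \<Prod>i\<in>I. f i (g i))"
  have 1: "(F has_sum (\<Prod>i\<in>I. s i)) (PiE I B)"
    unfolding F_def using insert by blast
  have 2: "(f i has_sum s i) (B i)" using insert by blast
  have "(\<lambda>x. norm (case x of (g, y) \<Rightarrow> F g * f i y)) summable_on (PiE I B \<times> B i)"
    using has_sum_imp_summable[OF 1] has_sum_imp_summable[OF 2]
    unfolding summable_on_iff_abs_summable_on_complex
    by (subst Infinite_Sum.abs_summable_on_Sigma_iff) 
      (auto simp: norm_mult infsum_cmult_right' infsum_nonneg
        intro!: summable_on_cmult_right summable_on_cmult_left)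
  hence summ: "(\<lambda>(g, y). F g * f i y) summable_on (PiE I B \<times> B i)"
    by (rule abs_summable_summable)
  have "((\<lambda>(g, y). F g * f i y) has_sum ((\<Prod>i\<in>I. s i) * s i)) (PiE I B \<times> B i)"
    by (rule has_sum_SigmaI[OF _ has_sum_cmult_left[OF 1] summ])
      (auto intro: has_sum_cmult_right 2)
  also have "?this \<longleftrightarrow> (((\<lambda>g. \<Prod>i\<in>insert i I. f i (g i)) \<circ> (\<lambda>(g, y). g(i := y))) has_sum
      ((\<Prod>i\<in>I. s i) * s i)) (PiE I B \<times> B i)"
  proof (rule has_sum_cong)
    fix x assume "x \<in> PiE I B \<times> B i"
    obtain g y where x: "x = (g, y)" by force
    have "(\<Prod>j\<in>I. f j ((g(i := y)) j)) = F g"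
      unfolding F_def using insert.hyps by (intro prod.cong) auto
    thus "(case x of (g, y) \<Rightarrow> F g * f i y) =
        ((\<lambda>g. \<Prod>i\<in>insert i I. f i (g i)) \<circ> (\<lambda>(g, y). g(i := y))) x"
      using insert.hyps by (simp add: x mult.commute)
  qed
  finally have "((\<lambda>g. \<Prod>i\<in>insert i I. f i (g i)) has_sum ((\<Prod>i\<in>I. s i) * s i))
      ((\<lambda>(g, y). g(i := y)) ` (PiE I B \<times> B i))"
    by (subst has_sum_reindex[OF inj_combinator'[OF insert.hyps(2)]])
  moreover have "(\<lambda>(g, y). g(i := y)) ` (PiE I B \<times> B i) = PiE (insert i I) B"
    unfolding PiE_insert_eq
    by (subst swap_product [symmetric]) (simp add: image_image case_prod_unfold)
  ultimately show ?case using insert.hyps by (simp add: mult.commute)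
qed (auto simp: has_sum_finite_iff)

lemma has_sum_finite_sum:
  fixes f :: "'i \<Rightarrow> 'j \<Rightarrow> complex"
  assumes "finite A" "\<And>a. a \<in> A \<Longrightarrow> (f a has_sum s a) B"
  shows "((\<lambda>x. \<Sum>a\<in>A. f a x) has_sum (\<Sum>a\<in>A. s a)) B"
  using assms by (induction A rule: finite_induct) (auto intro: has_sum_add)

text \<open>Frees the genus from the arbitrary choice in \<open>coset_rep\<close>: a class function
  may be summed over any transversal, in particular over one adapted to \<open>p\<close>.\<close>

lemma sum_quotient_transversal:
  assumes eq: "equiv A r" and X: "X \<subseteq> A" "\<And>x. x \<in> A \<Longrightarrow> \<exists>!y. y \<in> X \<and> (x, y) \<in> r"
    and inv: "\<And>x y. (x, y) \<in> r \<Longrightarrow> F x = F y"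
  shows "(\<Sum>h\<in>A // r. F (coset_rep h)) = sum F X" "card (A // r) = card X"
proof -
  have bij: "bij_betw (\<lambda>x. r `` {x}) X (A // r)"
  proof (rule bij_betwI')
    fix x y assume xy: "x \<in> X" "y \<in> X"
    show "r `` {x} = r `` {y} \<longleftrightarrow> x = y"
    proof
      assume "r `` {x} = r `` {y}"
      hence "(x, y) \<in> r" using eq_equiv_class[OF _ eq] xy X by blast
      moreover have "(x, x) \<in> r" using eq xy X by (auto simp: equiv_def refl_on_def)
      ultimately show "x = y" using X xy by blast
    qed auto
  next
    fix h assume "h \<in> A // r"
    then obtain x where x: "x \<in> A" "h = r `` {x}" by (auto elim: quotientE)
    obtain y where "y \<in> X" "(x, y) \<in> r" using X(2)[OF x(1)] by blast
    thus "\<exists>y\<in>X. h = r `` {y}" using equiv_class_eq[OF eq] x by blast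
  qed (use X in \<open>auto intro: quotientI\<close>)
  have "F (coset_rep (r `` {x})) = F x" if "x \<in> X" for x
  proof -
    have "x \<in> r `` {x}" using eq that X by (auto simp: equiv_def refl_on_def)
    hence "coset_rep (r `` {x}) \<in> r `` {x}" unfolding coset_rep_def by (rule someI)
    thus ?thesis using inv by fastforce
  qed
  thus "(\<Sum>h\<in>A // r. F (coset_rep h)) = sum F X"
    using sum.reindex_bij_betw[OF bij, of "\<lambda>h. F (coset_rep h)"] by simp
  show "card (A // r) = card X" using bij_betw_same_card[OF bij] by simp
qed

text \<open>Since \<open>card I\<close> is the rank, the vectors \<open>v {i}\<close> form a basis
  of \<open>span L\<close>. No multi-fan occurs, so the results apply to the top simplices of every
  triangulation.\<close>

locale lattice_simplex =
  fixes L :: "'a::euclidean_space set" and n :: nat and v :: "'b set \<Rightarrow> 'a" and I :: "'b set"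
  assumes lat: "lattice_of_rank L n"
    and finI: "finite I" and cardI: "card I = n"
    and injv: "inj_on (\<lambda>i. v {i}) I"
    and ind: "independent ((\<lambda>i. v {i}) ` I)"
    and vL: "\<And>i. i \<in> I \<Longrightarrow> v {i} \<in> L"
begin

abbreviation e where "e \<equiv> \<lambda>i. v {i}"
abbreviation D where "D \<equiv> dual_vector v I"

end

section \<open>Integer coordinates in a lattice\<close>

context
  fixes L :: "'a::euclidean_space set" and n :: nat
  assumes lat: "lattice_of_rank L n"
begin

text \<open>Describing \<open>L\<close> by integrality of coordinates reduces its closure properties
  to linearity of \<open>representation\<close>.\<close>

lemma lattice_basis:
  obtains B where "independent B" "finite B" "card B = n" "span L = span B" "B \<subseteq> L"
    "\<And>x. x \<in> L \<longleftrightarrow> x \<in> span B \<and> (\<forall>b\<in>B. representation B x b \<in> \<int>)"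
proof -
  obtain B where B: "independent B" "card B = n" "L = int_span B"
    using lat unfolding lattice_of_rank_def by blast
  have fin: "finite B" using B(1) by (rule independent_imp_finite)
  have L: "x \<in> L \<longleftrightarrow> x \<in> span B \<and> (\<forall>b\<in>B. representation B x b \<in> \<int>)" for x
  proof
    assume "x \<in> L"
    then obtain c :: "'a \<Rightarrow> int" where x: "x = (\<Sum>b\<in>B. of_int (c b) *\<^sub>R b)"
      unfolding B(3) int_span_def by blast
    have "x \<in> span B" unfolding x by (intro span_sum span_scale span_base)
    moreover have "representation B x b = of_int (c b)" if "b \<in> B" for b
    proof -
      have "representation B x b = (\<Sum>b'\<in>B. of_int (c b') * representation B b' b)"
        unfolding x using B(1)
        by (subst representation_sum) (auto simp: representation_scale span_scale span_base)
      also have "\<dots> = (\<Sum>b'\<in>B. if b' = b then of_int (c b') else 0)"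
        by (rule sum.cong) (use B(1) in \<open>auto simp: representation_basis\<close>)
      also have "\<dots> = of_int (c b)" using fin that by simp
      finally show ?thesis .
    qed
    ultimately show "x \<in> span B \<and> (\<forall>b\<in>B. representation B x b \<in> \<int>)" by simp
  next
    assume x: "x \<in> span B \<and> (\<forall>b\<in>B. representation B x b \<in> \<int>)"
    have "x = (\<Sum>b\<in>B. representation B x b *\<^sub>R b)"
      using sum_representation_eq[OF B(1) _ fin subset_refl] x by simp
    also have "\<dots> = (\<Sum>b\<in>B. of_int \<lfloor>representation B x b\<rfloor> *\<^sub>R b)"
      using x by (intro sum.cong) (auto elim: Ints_cases)
    finally show "x \<in> L"
      unfolding B(3) int_span_def by (auto intro!: exI[of _ "\<lambda>b. \<lfloor>representation B x b\<rfloor>"])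
  qed
  have "B \<subseteq> L"
    using B(1) by (auto simp: L representation_basis span_base)
  moreover have "L \<subseteq> span B" using L by blast
  ultimately have "span L = span B"
    by (metis span_eq span_superset subset_trans)
  thus ?thesis using that B fin L \<open>B \<subseteq> L\<close> by blast
qed

lemma lattice_add: "x \<in> L \<Longrightarrow> y \<in> L \<Longrightarrow> x + y \<in> L"
  by (rule lattice_basis) (auto simp: span_add representation_add)

lemma lattice_diff: "x \<in> L \<Longrightarrow> y \<in> L \<Longrightarrow> x - y \<in> L"
  by (rule lattice_basis) (auto simp: span_diff representation_diff)

lemma lattice_0: "0 \<in> L"
  by (rule lattice_basis) (auto simp: span_zero representation_zero)

lemma lattice_scale: "x \<in> L \<Longrightarrow> of_int k *\<^sub>R x \<in> L"
  by (rule lattice_basis) (auto simp: span_scale representation_scale)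

lemma lattice_sum: "(\<And>i. i \<in> A \<Longrightarrow> f i \<in> L) \<Longrightarrow> sum f A \<in> L"
  by (induction A rule: infinite_finite_induct) (auto intro: lattice_0 lattice_add)

lemma dim_lattice: "dim L = n"
  by (rule lattice_basis) (metis dim_eq_card_independent dim_span)

text \<open>Countability makes the exceptional shifts along a line avoidable in the final limit
  argument.\<close>

lemma countable_lattice: "countable L"
proof -
  obtain B where B: "independent B" "card B = n" "L = int_span B"
    using lat unfolding lattice_of_rank_def by blast
  have fin: "finite B" using B(1) by (rule independent_imp_finite)
  have "L \<subseteq> (\<lambda>c. \<Sum>b\<in>B. of_int (c b) *\<^sub>R b) ` (PiE B (\<lambda>_. UNIV :: int set))"
  proof
    fix x assume "x \<in> L"
    then obtain c :: "'a \<Rightarrow> int" where x: "x = (\<Sum>b\<in>B. of_int (c b) *\<^sub>R b)"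
      unfolding B(3) int_span_def by blast
    have "x = (\<Sum>b\<in>B. of_int (restrict c B b) *\<^sub>R b)"
      unfolding x by (rule sum.cong) simp_all
    thus "x \<in> (\<lambda>c. \<Sum>b\<in>B. of_int (c b) *\<^sub>R b) ` (PiE B (\<lambda>_. UNIV :: int set))"
      by (rule image_eqI[of _ _ "restrict c B"]) simp
  qed
  moreover have "countable (PiE B (\<lambda>_. UNIV :: int set))"
    by (rule countable_PiE[OF fin]) simp
  ultimately show ?thesis by (rule countable_subset[OF _ countable_image])
qed

end

context lattice_simplex
begin

lemma span_e: "span (e ` I) = span L"
proof -
  have sub: "e ` I \<subseteq> span L" using vL span_base by blast
  have "card (e ` I) = dim (span L)"
    using cardI injv by (simp add: card_image dim_lattice[OF lat])
  hence "span L \<subseteq> span (e ` I)"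
    using card_eq_dim[OF sub] ind finI by simp
  thus ?thesis using sub by (metis span_minimal subspace_span subset_antisym)
qed

lemma L_span: "x \<in> L \<Longrightarrow> x \<in> span L" by (rule span_base)

lemma e_span: "i \<in> I \<Longrightarrow> e i \<in> span L" using vL span_base by blast

lemma D_add: "x \<in> span L \<Longrightarrow> y \<in> span L \<Longrightarrow> D i (x + y) = D i x + D i y"
  by (simp add: dual_vector_def representation_add[OF ind] span_e)

lemma D_diff: "x \<in> span L \<Longrightarrow> y \<in> span L \<Longrightarrow> D i (x - y) = D i x - D i y"
  by (simp add: dual_vector_def representation_diff[OF ind] span_e)

lemma D_scale: "x \<in> span L \<Longrightarrow> D i (c *\<^sub>R x) = c * D i x"
  by (simp add: dual_vector_def representation_scale[OF ind] span_e)

lemma D_sum: "(\<And>a. a \<in> A \<Longrightarrow> f a \<in> span L) \<Longrightarrow> D i (sum f A) = (\<Sum>a\<in>A. D i (f a))"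
  by (simp add: dual_vector_def representation_sum[OF ind] span_e)

lemma D_e: "i \<in> I \<Longrightarrow> j \<in> I \<Longrightarrow> D i (e j) = (if i = j then 1 else 0)"
  unfolding dual_vector_def using injv ind by (auto simp: representation_basis dest: inj_onD)

lemma D_comb: "i \<in> I \<Longrightarrow> D i (\<Sum>j\<in>I. c j *\<^sub>R e j) = c i"
proof -
  assume i: "i \<in> I"
  have "D i (\<Sum>j\<in>I. c j *\<^sub>R e j) = (\<Sum>j\<in>I. c j * D i (e j))"
    by (subst D_sum) (auto simp: D_scale e_span span_scale)
  also have "\<dots> = (\<Sum>j\<in>I. if i = j then c j else 0)"
    by (rule sum.cong) (use i in \<open>auto simp: D_e\<close>)
  also have "\<dots> = c i" using i finI by simp
  finally show ?thesis .
qed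

lemma D_expand: "x \<in> span L \<Longrightarrow> x = (\<Sum>j\<in>I. D j x *\<^sub>R e j)"
  using sum_representation_eq[OF ind, of x "e ` I"] finI injv
  by (simp add: span_e dual_vector_def sum.reindex)

lemma D_eqI: "x \<in> span L \<Longrightarrow> y \<in> span L \<Longrightarrow> (\<And>i. i \<in> I \<Longrightarrow> D i x = D i y) \<Longrightarrow> x = y"
  using D_expand[of x] D_expand[of y] by simp

lemma comb_span: "(\<Sum>j\<in>I. c j *\<^sub>R e j) \<in> span L"
  by (intro span_sum span_scale e_span)

lemma comb_L: "(\<Sum>j\<in>I. of_int (c j) *\<^sub>R e j) \<in> L"
  by (intro lattice_sum[OF lat] lattice_scale[OF lat] vL)

lemma edge_lattice_iff: "x \<in> edge_lattice v I \<longleftrightarrow> x \<in> span L \<and> (\<forall>i\<in>I. D i x \<in> \<int>)"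
proof
  assume "x \<in> edge_lattice v I"
  then obtain c :: "'a \<Rightarrow> int" where "x = (\<Sum>y\<in>e ` I. of_int (c y) *\<^sub>R y)"
    unfolding edge_lattice_def int_span_def by blast
  hence x: "x = (\<Sum>i\<in>I. of_int (c (e i)) *\<^sub>R e i)"
    using injv by (simp add: sum.reindex)
  show "x \<in> span L \<and> (\<forall>i\<in>I. D i x \<in> \<int>)"
    unfolding x using comb_span[of "\<lambda>i. of_int (c (e i))"] D_comb[of _ "\<lambda>i. of_int (c (e i))"] by auto
next
  assume x: "x \<in> span L \<and> (\<forall>i\<in>I. D i x \<in> \<int>)"
  have "x = (\<Sum>i\<in>I. D i x *\<^sub>R e i)" using x D_expand by blast
  also have "\<dots> = (\<Sum>i\<in>I. of_int \<lfloor>D i x\<rfloor> *\<^sub>R e i)"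
    using x by (intro sum.cong) (auto elim!: Ints_cases)
  also have "\<dots> = (\<Sum>y\<in>e ` I. of_int \<lfloor>representation (e ` I) x y\<rfloor> *\<^sub>R y)"
    using injv by (simp add: sum.reindex dual_vector_def)
  finally show "x \<in> edge_lattice v I"
    unfolding edge_lattice_def int_span_def
    by (auto intro!: exI[of _ "\<lambda>y. \<lfloor>representation (e ` I) x y\<rfloor>"])
qed

section \<open>The quotient group and its representatives in a box\<close>

definition R where "R = {(x, y). x \<in> L \<and> y \<in> L \<and> x - y \<in> edge_lattice v I}"

lemma R_iff: "(x, y) \<in> R \<longleftrightarrow> x \<in> L \<and> y \<in> L \<and> (\<forall>i\<in>I. D i x - D i y \<in> \<int>)"
  by (auto simp: R_def edge_lattice_iff D_diff L_span span_diff)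

lemma equiv_R: "equiv L R"
proof (rule equivI)
  show "refl_on L R" by (auto simp: refl_on_def R_iff)
  show "R \<subseteq> L \<times> L" by (auto simp: R_iff)
  show "sym R"
  proof (rule symI)
    fix x y assume "(x, y) \<in> R"
    thus "(y, x) \<in> R" unfolding R_iff by (metis Ints_minus minus_diff_eq)
  qed
  show "trans R"
  proof (rule transI)
    fix x y z assume "(x, y) \<in> R" "(y, z) \<in> R"
    moreover from this have "D i x - D i z \<in> \<int>" if "i \<in> I" for i
      using Ints_add[of "D i x - D i y" "D i y - D i z"] that by (simp add: R_iff)
    ultimately show "(x, z) \<in> R" by (simp add: R_iff)
  qed
qed

definition generic where "generic p \<longleftrightarrow> p \<in> span L \<and> (\<forall>x\<in>L. \<forall>i\<in>I. D i x \<noteq> D i p)"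

text \<open>Strict at both ends: for generic \<open>p\<close> no lattice point satisfies
  \<open>D i x = D i p\<close>, and none satisfies \<open>D i x = D i p + 1\<close>, as subtracting
  \<open>e i\<close> shows. It thus contains the same lattice points as the half-open
  parallelepiped.\<close>

definition Box where "Box p = {x \<in> L. \<forall>i\<in>I. D i p < D i x \<and> D i x < D i p + 1}"

lemma finite_Box: "finite (Box p)"
proof (rule lattice_basis[OF lat])
  fix B assume B: "independent B" "finite B" "span L = span B"
    "\<And>x. x \<in> L \<longleftrightarrow> x \<in> span B \<and> (\<forall>b\<in>B. representation B x b \<in> \<int>)"
  \<comment> \<open>On the box \<open>\<bar>D i x\<bar>\<close> is at most
    \<open>\<bar>D i p\<bar> + 1\<close>, so \<open>N b\<close> bounds the coordinate along
    \<open>b\<close> in the lattice basis; only finitely many integer vectors remain.\<close>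
  define N where "N b = (\<Sum>i\<in>I. (\<bar>D i p\<bar> + 1) * \<bar>representation B (e i) b\<bar>)" for b
  define F where "F x = restrict (\<lambda>b. \<lfloor>representation B x b\<rfloor>) B" for x
  have "F ` Box p \<subseteq> PiE B (\<lambda>b. {-\<lceil>N b\<rceil>..\<lceil>N b\<rceil>})"
  proof (rule image_subsetI)
    fix x assume x: "x \<in> Box p"
    hence xL: "x \<in> L" by (simp add: Box_def)
    have "\<lfloor>representation B x b\<rfloor> \<in> {-\<lceil>N b\<rceil>..\<lceil>N b\<rceil>}" if "b \<in> B" for b
    proof -
      have "representation B x b = representation B (\<Sum>i\<in>I. D i x *\<^sub>R e i) b"
        using D_expand[OF L_span[OF xL]] by simp
      also have "\<dots> = (\<Sum>i\<in>I. D i x * representation B (e i) b)"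
        using e_span B by (subst representation_sum) (auto simp: representation_scale span_scale)
      finally have "\<bar>representation B x b\<bar> \<le> (\<Sum>i\<in>I. \<bar>D i x\<bar> * \<bar>representation B (e i) b\<bar>)"
        by (simp add: sum_abs[THEN order_trans] abs_mult)
      also have "\<dots> \<le> N b" unfolding N_def
        by (intro sum_mono mult_right_mono) (use x in \<open>force simp: Box_def\<close>)+
      finally have "\<bar>representation B x b\<bar> \<le> N b" .
      thus ?thesis by (auto simp: le_floor_iff floor_le_iff) linarith+
    qed
    thus "F x \<in> PiE B (\<lambda>b. {-\<lceil>N b\<rceil>..\<lceil>N b\<rceil>})" by (auto simp: F_def)
  qed
  hence "finite (F ` Box p)" using B(2) finite_subset by (blast intro: finite_PiE)
  moreover have "inj_on F (Box p)"
  proof (rule inj_onI)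
    fix x y assume xy: "x \<in> Box p" "y \<in> Box p" "F x = F y"
    have L: "x \<in> L" "y \<in> L" using xy by (auto simp: Box_def)
    have "representation B x b = representation B y b" if "b \<in> B" for b
      using fun_cong[OF xy(3), of b] that L B(4) unfolding F_def by (auto elim!: Ints_cases)
    moreover have "x = (\<Sum>b\<in>B. representation B x b *\<^sub>R b)" "y = (\<Sum>b\<in>B. representation B y b *\<^sub>R b)"
      using sum_representation_eq[OF B(1) _ B(2) subset_refl] L B(4) by auto
    ultimately show "x = y" by simp
  qed
  ultimately show ?thesis by (rule finite_imageD)
qed

text \<open>Subtracting the integer parts of \<open>D i x - D i p\<close> moves \<open>x\<close>
  into the box, where genericity makes the lower bound strict. Two representatives have coordinate
  differences that are integers of absolute value below 1.\<close>

lemma Box_transversal: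
  assumes p: "generic p" and x: "x \<in> L"
  shows "\<exists>!y. y \<in> Box p \<and> (x, y) \<in> R"
proof -
  define k where "k i = \<lfloor>D i x - D i p\<rfloor>" for i
  define y where "y = x - (\<Sum>i\<in>I. of_int (k i) *\<^sub>R e i)"
  have yL: "y \<in> L" unfolding y_def using lattice_diff[OF lat x comb_L] .
  have Dy: "D i y = D i x - k i" if "i \<in> I" for i
    unfolding y_def using that x by (simp add: D_diff L_span comb_span D_comb)
  have "y \<in> Box p"
  proof -
    have "D i p < D i y \<and> D i y < D i p + 1" if "i \<in> I" for i
    proof -
      have "D i p \<noteq> D i y" using p yL that unfolding generic_def by metis
      moreover have "D i p \<le> D i y" "D i y < D i p + 1"
        unfolding Dy[OF that] k_def by linarith+
      ultimately show ?thesis by linarith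
    qed
    thus ?thesis using yL by (simp add: Box_def)
  qed
  moreover have "(x, y) \<in> R"
    using x yL by (auto simp: R_iff Dy)
  moreover have "y1 = y2" if "y1 \<in> Box p" "(x, y1) \<in> R" "y2 \<in> Box p" "(x, y2) \<in> R" for y1 y2
  proof (rule D_eqI)
    show "y1 \<in> span L" "y2 \<in> span L" using that by (auto simp: Box_def L_span)
    fix i assume i: "i \<in> I"
    have "D i x - D i y1 \<in> \<int>" "D i x - D i y2 \<in> \<int>" using that i by (auto simp: R_iff)
    hence "D i y1 - D i y2 \<in> \<int>" using Ints_diff by fastforce
    moreover have "\<bar>D i y1 - D i y2\<bar> < 1" using that i by (force simp: Box_def)
    ultimately show "D i y1 = D i y2"
      using Ints_nonzero_abs_less1 by fastforce
  qed
  ultimately show ?thesis by blast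
qed

lemma H_group_eq: "H_group L v I = L // R"
  by (simp add: H_group_def R_def)

lemma sum_H_group:
  assumes "generic p" and "\<And>x y. (x, y) \<in> R \<Longrightarrow> F x = F y"
  shows "(\<Sum>h\<in>H_group L v I. F (coset_rep h)) = sum F (Box p)"
  unfolding H_group_eq
  by (rule sum_quotient_transversal(1)[OF equiv_R])
    (use assms Box_transversal in \<open>auto simp: Box_def\<close>)

lemma card_H_group: "generic p \<Longrightarrow> card (H_group L v I) = card (Box p)"
  unfolding H_group_eq
  by (rule sum_quotient_transversal(2)[OF equiv_R, where F = "\<lambda>_. 0 :: nat"])
    (use Box_transversal in \<open>auto simp: Box_def\<close>)

end

section \<open>The dual lattice and character sums\<close>

text \<open>The inner product realises linear forms as vectors; membership in \<open>span L\<close>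
  makes the representing vector unique although the ambient space may be larger.\<close>

definition dual_lattice :: "'a::euclidean_space set \<Rightarrow> 'a set" where
  "dual_lattice L = {m \<in> span L. \<forall>x\<in>L. m \<bullet> x \<in> \<int>}"

context lattice_simplex
begin

lemma inner_expand: "x \<in> span L \<Longrightarrow> m \<bullet> x = (\<Sum>i\<in>I. (m \<bullet> e i) * D i x)"
  by (subst D_expand[of x]) (auto simp: inner_sum_right mult.commute)

text \<open>Integer tuples on \<open>I\<close> are the dual of the edge lattice, which contains the
  dual of \<open>L\<close> as the subgroup of forms integral on all of \<open>L\<close>. That
  subgroup is what survives the character sums.\<close>

lemma dual_lattice_bij:
  "bij_betw (\<lambda>m. restrict (\<lambda>i. \<lfloor>m \<bullet> e i\<rfloor>) I) (dual_lattice L)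
     {k \<in> PiE I (\<lambda>_. UNIV :: int set). \<forall>y\<in>L. (\<Sum>i\<in>I. k i * D i y) \<in> \<int>}"
proof (rule bij_betwI')
  fix m m' assume m: "m \<in> dual_lattice L" "m' \<in> dual_lattice L"
  show "restrict (\<lambda>i. \<lfloor>m \<bullet> e i\<rfloor>) I = restrict (\<lambda>i. \<lfloor>m' \<bullet> e i\<rfloor>) I \<longleftrightarrow> m = m'"
  proof
    assume eq: "restrict (\<lambda>i. \<lfloor>m \<bullet> e i\<rfloor>) I = restrict (\<lambda>i. \<lfloor>m' \<bullet> e i\<rfloor>) I"
    have "m \<bullet> e i = m' \<bullet> e i" if "i \<in> I" for i
      using fun_cong[OF eq, of i] m that vL[OF that]
      by (auto simp: dual_lattice_def elim!: Ints_cases dest!: bspec[of L _ "e i"])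
    hence "(m - m') \<bullet> x = 0" if "x \<in> span L" for x
      using that by (simp add: inner_diff_left inner_expand)
    moreover have "m - m' \<in> span L" using m by (auto simp: dual_lattice_def span_diff)
    ultimately show "m = m'" by fastforce
  qed auto
next
  fix m assume m: "m \<in> dual_lattice L"
  have fl: "of_int \<lfloor>m \<bullet> e i\<rfloor> = m \<bullet> e i" if "i \<in> I" for i
    using m vL[OF that] by (auto simp: dual_lattice_def elim!: Ints_cases dest!: bspec[of L _ "e i"])
  have "(\<Sum>i\<in>I. restrict (\<lambda>i. \<lfloor>m \<bullet> e i\<rfloor>) I i * D i y) = m \<bullet> y" if "y \<in> L" for y
    unfolding inner_expand[OF L_span[OF that]] by (rule sum.cong) (simp_all add: fl)
  thus "restrict (\<lambda>i. \<lfloor>m \<bullet> e i\<rfloor>) I \<in>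
      {k \<in> PiE I (\<lambda>_. UNIV :: int set). \<forall>y\<in>L. (\<Sum>i\<in>I. k i * D i y) \<in> \<int>}"
    using m by (auto simp: dual_lattice_def)
next
  fix k assume k: "k \<in> {k \<in> PiE I (\<lambda>_. UNIV :: int set). \<forall>y\<in>L. (\<Sum>i\<in>I. k i * D i y) \<in> \<int>}"
  obtain f :: "'a \<Rightarrow> real" where f: "linear f"
      "\<And>x. x \<in> e ` I \<Longrightarrow> f x = of_int (k (the_inv_into I e x))"
    using linear_independent_extend[OF ind, of "\<lambda>x. of_int (k (the_inv_into I e x))"] by blast
  \<comment> \<open>\<open>adjoint f 1\<close> represents the form \<open>f\<close> in the ambient
    space; its component in \<open>span L\<close> takes the same values on the edge vectors.\<close>
  obtain y z where yz: "y \<in> span L" "\<And>x. x \<in> span L \<Longrightarrow> orthogonal z x" "adjoint f 1 = y + z"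
    using orthogonal_subspace_decomp_exists[of L "adjoint f 1"] by blast
  have y: "y \<bullet> e i = of_int (k i)" if "i \<in> I" for i
  proof -
    have "f (e i) = of_int (k i)" using f(2)[of "e i"] that the_inv_into_f_f[OF injv that] by simp
    moreover have "f (e i) = e i \<bullet> adjoint f 1"
      using adjoint_works[OF f(1), of "e i" 1] by simp
    moreover have "z \<bullet> e i = 0" using yz(2)[OF e_span[OF that]] by (simp add: orthogonal_def)
    ultimately show ?thesis using yz(3) by (simp add: inner_add_left inner_commute)
  qed
  have "y \<bullet> x \<in> \<int>" if "x \<in> L" for x
    using k that y by (simp add: inner_expand[OF L_span[OF that]])
  hence "y \<in> dual_lattice L" using yz by (simp add: dual_lattice_def)
  moreover have "k = restrict (\<lambda>i. \<lfloor>y \<bullet> e i\<rfloor>) I"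
  proof
    fix i
    show "k i = restrict (\<lambda>i. \<lfloor>y \<bullet> e i\<rfloor>) I i"
    proof (cases "i \<in> I")
      case True
      thus ?thesis using y[OF True] by simp
    next
      case False
      have "k \<in> PiE I (\<lambda>_. UNIV)" using k by simp
      hence "k i = undefined" using False by (rule PiE_arb)
      thus ?thesis using False by simp
    qed
  qed
  ultimately show "\<exists>m\<in>dual_lattice L. k = restrict (\<lambda>i. \<lfloor>m \<bullet> e i\<rfloor>) I" by blast
qed

text \<open>Orthogonality of characters of the quotient of \<open>L\<close> by the edge lattice. If
  the character is nontrivial at \<open>z\<close>, then \<open>Box p\<close> and its translate
  \<open>Box (p + z)\<close> are both transversals, so the sum equals itself times
  \<open>F z\<close>, and \<open>F z\<close> differs from 1.\<close>

lemma sum_character: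
  assumes p: "generic p" and k: "\<And>i. i \<in> I \<Longrightarrow> k i \<in> \<int>"
  shows "(\<Sum>y\<in>Box p. e2pi (- of_real (\<Sum>i\<in>I. k i * D i y))) =
    (if \<forall>y\<in>L. (\<Sum>i\<in>I. k i * D i y) \<in> \<int> then of_nat (card (Box p)) else 0)"
proof (cases "\<forall>y\<in>L. (\<Sum>i\<in>I. k i * D i y) \<in> \<int>")
  case True
  hence "e2pi (- of_real (\<Sum>i\<in>I. k i * D i y)) = 1" if "y \<in> Box p" for y
    using that by (auto simp: e2pi_eq_1_iff Box_def simp del: of_real_sum)
  thus ?thesis using True by simp
next
  case False
  then obtain z where z: "z \<in> L" "(\<Sum>i\<in>I. k i * D i z) \<notin> \<int>" by blast
  define F where "F = (\<lambda>y. e2pi (- of_real (\<Sum>i\<in>I. k i * D i y)))"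
  have inv: "F x = F y" if "(x, y) \<in> R" for x y
  proof -
    have "(\<Sum>i\<in>I. k i * D i x) - (\<Sum>i\<in>I. k i * D i y) = (\<Sum>i\<in>I. k i * (D i x - D i y))"
      by (simp add: sum_subtractf algebra_simps)
    also have "\<dots> \<in> \<int>" using that k by (intro Ints_sum Ints_mult) (auto simp: R_iff)
    finally obtain j :: int where "(\<Sum>i\<in>I. k i * D i x) = (\<Sum>i\<in>I. k i * D i y) + of_int j"
      by (auto elim!: Ints_cases simp: algebra_simps)
    thus ?thesis unfolding F_def by (simp del: of_real_sum add: e2pi_diff)
  qed
  have pz: "generic (p + z)"
    unfolding generic_def
  proof (intro conjI ballI)
    fix x i assume xi: "x \<in> L" "i \<in> I"
    have "D i (x - z) \<noteq> D i p"
      using p xi lattice_diff[OF lat xi(1) z(1)] by (auto simp: generic_def)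
    thus "D i x \<noteq> D i (p + z)"
      using xi z p by (auto simp: D_diff D_add L_span generic_def)
  qed (use p z in \<open>auto simp: generic_def span_add L_span\<close>)
  have Box_eq: "Box (p + z) = (\<lambda>y. y + z) ` Box p"
  proof (intro subset_antisym subsetI)
    fix x assume "x \<in> Box (p + z)"
    hence "x - z \<in> Box p" using z p lattice_diff[OF lat]
      by (auto simp: Box_def D_diff D_add L_span generic_def)
    thus "x \<in> (\<lambda>y. y + z) ` Box p" by (intro image_eqI[of _ _ "x - z"]) auto
  qed (use z p lattice_add[OF lat] in \<open>auto simp: Box_def D_add L_span generic_def\<close>)
  have "sum F (Box p) = sum F (Box (p + z))"
    using sum_H_group[OF p inv] sum_H_group[OF pz inv] by simp
  also have "\<dots> = (\<Sum>y\<in>Box p. F (y + z))"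
    unfolding Box_eq by (simp add: sum.reindex)
  also have "\<dots> = (\<Sum>y\<in>Box p. F y * F z)"
  proof (rule sum.cong)
    fix y assume "y \<in> Box p"
    hence "(\<Sum>i\<in>I. k i * D i (y + z)) = (\<Sum>i\<in>I. k i * D i y) + (\<Sum>i\<in>I. k i * D i z)"
      using z by (simp add: D_add L_span Box_def distrib_left sum.distrib)
    thus "F (y + z) = F y * F z"
      unfolding F_def by (simp del: of_real_sum add: e2pi_add[symmetric])
  qed auto
  also have "\<dots> = F z * sum F (Box p)" by (simp add: sum_distrib_left mult.commute)
  finally have "(F z - 1) * sum F (Box p) = 0" by (simp add: algebra_simps)
  moreover have "F z \<noteq> 1"
  proof
    assume "F z = 1"
    hence "- complex_of_real (\<Sum>i\<in>I. k i * D i z) \<in> \<int>"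
      unfolding F_def e2pi_eq_1_iff .
    hence "complex_of_real (\<Sum>i\<in>I. k i * D i z) \<in> \<int>" using Ints_minus by fastforce
    then obtain j where "complex_of_real (\<Sum>i\<in>I. k i * D i z) = of_int j" by (rule Ints_cases)
    hence "(\<Sum>i\<in>I. k i * D i z) = of_int j" by (metis of_real_eq_iff of_real_of_int_eq)
    thus False using z(2) by simp
  qed
  ultimately have "sum F (Box p) = 0" by simp
  thus ?thesis by (subst if_not_P[OF False]) (simp only: F_def)
qed

section \<open>The contribution of one simplex and its Fourier coefficients\<close>

definition genus_summand :: "complex \<Rightarrow> complex \<Rightarrow> 'a \<times> 'a \<Rightarrow> 'a \<Rightarrow> 'a \<Rightarrow> complex" where
  "genus_summand \<tau> \<sigma> w x y =
     (\<Prod>i\<in>I. e2pi (of_real (D i x) * \<sigma>) * phi_st (orbi_arg v I i \<tau> w x y) \<tau> \<sigma>)"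

definition local_genus :: "complex \<Rightarrow> complex \<Rightarrow> 'a \<times> 'a \<Rightarrow> complex" where
  "local_genus \<tau> \<sigma> w = 1 / of_nat (card (H_group L v I)) *
     (\<Sum>(h1, h2)\<in>H_group L v I \<times> H_group L v I.
        genus_summand \<tau> \<sigma> w (coset_rep h1) (coset_rep h2))"

text \<open>The lattice points of the shifted cone are box points plus nonnegative integer
  combinations of the \<open>e i\<close>. The denominators are the summed geometric series in these
  directions, and they make sense beyond the region of convergence.\<close>

definition theta_coeff :: "complex \<Rightarrow> complex \<Rightarrow> 'a \<Rightarrow> 'a \<Rightarrow> complex" where
  "theta_coeff \<tau> \<sigma> p m =
     (\<Sum>x\<in>Box p. e2pi (of_real (\<Sum>i\<in>I. D i x) * \<sigma> + of_real (m \<bullet> x) * \<tau>)) /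
     (\<Prod>i\<in>I. 1 - e2pi (\<sigma> + of_real (m \<bullet> e i) * \<tau>))"

lemma R_E:
  assumes "(x, y) \<in> R" "i \<in> I"
  obtains k :: int where "D i x = D i y + of_int k"
  using assms unfolding R_iff by (metis Ints_cases add.commute diff_add_cancel)

text \<open>The factor that \<open>phi_st\<close> loses under translation by a multiple of
  \<open>\<tau>\<close> is restored by the factor \<open>e2pi (D i x * \<sigma>)\<close>.\<close>

lemma genus_summand_cong_left:
  assumes \<tau>: "Im \<tau> > 0" and xy: "(x, x') \<in> R"
  shows "genus_summand \<tau> \<sigma> w x y = genus_summand \<tau> \<sigma> w x' y"
  unfolding genus_summand_def
proof (rule prod.cong)
  fix i assume "i \<in> I"
  with xy obtain k :: int where k: "D i x = D i x' + of_int k" by (rule R_E)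
  have "orbi_arg v I i \<tau> w x y = orbi_arg v I i \<tau> w x' y + of_int k * \<tau>"
    by (simp add: orbi_arg_def k algebra_simps)
  thus "e2pi (of_real (D i x) * \<sigma>) * phi_st (orbi_arg v I i \<tau> w x y) \<tau> \<sigma> =
      e2pi (of_real (D i x') * \<sigma>) * phi_st (orbi_arg v I i \<tau> w x' y) \<tau> \<sigma>"
    by (simp add: phi_st_add_int_tau[OF \<tau>] k distrib_right e2pi_add)
qed auto

text \<open>Here the arguments change by integers only, and \<open>phi_st\<close> has period
  1.\<close>

lemma genus_summand_cong_right:
  assumes \<tau>: "Im \<tau> > 0" and xy: "(y, y') \<in> R"
  shows "genus_summand \<tau> \<sigma> w x y = genus_summand \<tau> \<sigma> w x y'"
  unfolding genus_summand_def
proof (rule prod.cong)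
  fix i assume "i \<in> I"
  with xy obtain k :: int where k: "D i y = D i y' + of_int k" by (rule R_E)
  have "orbi_arg v I i \<tau> w x y = orbi_arg v I i \<tau> w x y' + of_int (- k)"
    by (simp add: orbi_arg_def k algebra_simps)
  thus "e2pi (of_real (D i x) * \<sigma>) * phi_st (orbi_arg v I i \<tau> w x y) \<tau> \<sigma> =
      e2pi (of_real (D i x) * \<sigma>) * phi_st (orbi_arg v I i \<tau> w x y') \<tau> \<sigma>"
    by (simp only: phi_st_add_int[OF \<tau>])
qed auto

lemma local_genus_eq_Box:
  assumes \<tau>: "Im \<tau> > 0" and p: "generic p"
  shows "local_genus \<tau> \<sigma> w =
    1 / of_nat (card (Box p)) * (\<Sum>x\<in>Box p. \<Sum>y\<in>Box p. genus_summand \<tau> \<sigma> w x y)"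
proof -
  let ?H = "H_group L v I"
  have "(\<Sum>(h1, h2)\<in>?H \<times> ?H. genus_summand \<tau> \<sigma> w (coset_rep h1) (coset_rep h2)) =
      (\<Sum>h1\<in>?H. \<Sum>h2\<in>?H. genus_summand \<tau> \<sigma> w (coset_rep h1) (coset_rep h2))"
    by (simp add: sum.cartesian_product)
  also have "\<dots> = (\<Sum>h1\<in>?H. \<Sum>y\<in>Box p. genus_summand \<tau> \<sigma> w (coset_rep h1) y)"
    by (intro sum.cong refl sum_H_group[OF p] genus_summand_cong_right[OF \<tau>])
  also have "\<dots> = (\<Sum>x\<in>Box p. \<Sum>y\<in>Box p. genus_summand \<tau> \<sigma> w x y)"
    by (intro sum_H_group[OF p] sum.cong refl genus_summand_cong_left[OF \<tau>])
  finally show ?thesis by (simp add: local_genus_def card_H_group[OF p])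
qed

text \<open>The hypothesis on \<open>p\<close> puts every \<open>orbi_arg\<close> with \<open>x \<in> Box p\<close> into the strip on which Kronecker's
  expansion is valid. The sum over the second group variable is a character sum, which only leaves
  the exponents coming from the dual lattice.\<close>
lemma local_genus_has_sum:
  assumes \<tau>: "Im \<tau> > 0" and \<sigma>: "\<sigma> \<notin> period_lattice \<tau>"
    and w: "fst w \<in> span L" "snd w \<in> span L"
    and p: "p = (1 / Im \<tau>) *\<^sub>R snd w" "generic p"
  shows "((\<lambda>m. e2pi (- complex_ext ((\<bullet>) m) w) * theta_coeff \<tau> \<sigma> p m) has_sum
    local_genus \<tau> \<sigma> w) (dual_lattice L)"
proof -
  define c where "c = card (Box p)"
  have c: "c \<noteq> 0"
    using Box_transversal[OF p(2) lattice_0[OF lat]] finite_Box by (auto simp: c_def)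
  \<comment> \<open>Each expanded term splits into \<open>U g x\<close>, which carries
    \<open>w\<close> and the first group variable, and the character \<open>ch g y\<close>, which
    carries the second.\<close>
  define U where "U g x = (\<Prod>i\<in>I. e2pi (of_real (D i x) * \<sigma>) *
      (e2pi (of_int (g i) * (- complex_ext (D i) w + \<tau> * of_real (D i x))) /
        (1 - e2pi (\<sigma> + of_int (g i) * \<tau>))))" for g :: "'b \<Rightarrow> int" and x
  define ch where "ch g y = e2pi (- of_real (\<Sum>i\<in>I. of_int (g i) * D i y))" for g :: "'b \<Rightarrow> int" and y
  define K where "K = {k \<in> PiE I (\<lambda>_. UNIV :: int set). \<forall>y\<in>L. (\<Sum>i\<in>I. k i * D i y) \<in> \<int>}"
  have 1: "((\<lambda>g. U g x * ch g y) has_sum genus_summand \<tau> \<sigma> w x y) (PiE I (\<lambda>_. UNIV))"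
    if x: "x \<in> Box p" for x y
  proof -
    let ?z = "\<lambda>i. orbi_arg v I i \<tau> w x y"
    have "((\<lambda>k::int. e2pi (of_int k * ?z i) / (1 - e2pi (\<sigma> + of_int k * \<tau>))) has_sum
        phi_st (?z i) \<tau> \<sigma>) UNIV" if i: "i \<in> I" for i
    proof (rule phi_st_has_sum[OF \<tau> \<sigma>])
      have "Im (?z i) = Im \<tau> * (D i x - D i p)"
        using \<tau> w by (simp add: orbi_arg_def complex_ext_def p(1) D_scale right_diff_distrib)
      moreover have "0 < D i x - D i p" "D i x - D i p < 1"
        using x i by (auto simp: Box_def)
      ultimately show "0 < Im (?z i)" "Im (?z i) < Im \<tau>"
        using \<tau> by auto
    qed
    from has_sum_prod_PiE[OF finI has_sum_cmult_right[OF this]]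
    have "((\<lambda>g. \<Prod>i\<in>I. e2pi (of_real (D i x) * \<sigma>) *
        (e2pi (of_int (g i) * ?z i) / (1 - e2pi (\<sigma> + of_int (g i) * \<tau>)))) has_sum
        genus_summand \<tau> \<sigma> w x y) (PiE I (\<lambda>_. UNIV))"
      unfolding genus_summand_def .
    moreover have "(\<Prod>i\<in>I. e2pi (of_real (D i x) * \<sigma>) *
        (e2pi (of_int (g i) * ?z i) / (1 - e2pi (\<sigma> + of_int (g i) * \<tau>)))) = U g x * ch g y" for g
    proof -
      have "ch g y = (\<Prod>i\<in>I. e2pi (- of_int (g i) * of_real (D i y)))"
        by (simp add: ch_def sum_negf[symmetric] e2pi_sum finI)
      moreover have "of_int (g i) * ?z i = of_int (g i) * (- complex_ext (D i) w + \<tau> * of_real (D i x)) +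
          - of_int (g i) * of_real (D i y)" for i
        by (simp add: orbi_arg_def algebra_simps)
      ultimately show ?thesis
        by (simp only: U_def prod.distrib[symmetric] e2pi_add times_divide_eq_right times_divide_eq_left mult.assoc)
    qed
    ultimately show ?thesis by simp
  qed
  have "((\<lambda>g. 1 / of_nat c * (\<Sum>x\<in>Box p. \<Sum>y\<in>Box p. U g x * ch g y)) has_sum
      local_genus \<tau> \<sigma> w) (PiE I (\<lambda>_. UNIV))"
    unfolding local_genus_eq_Box[OF \<tau> p(2)] c_def[symmetric]
    by (intro has_sum_cmult_right has_sum_finite_sum finite_Box 1)
  \<comment> \<open>A trivial character sums to \<open>card (Box p)\<close>, which cancels the
    normalisation \<open>1 / c\<close>; all other tuples contribute 0.\<close>
  moreover have "(1 / of_nat c * (\<Sum>x\<in>Box p. \<Sum>y\<in>Box p. U g x * ch g y)) =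
      (if \<forall>y\<in>L. (\<Sum>i\<in>I. g i * D i y) \<in> \<int> then \<Sum>x\<in>Box p. U g x else 0)" for g
    using sum_character[OF p(2), of "\<lambda>i. of_int (g i)"] c
    by (simp add: ch_def sum_distrib_left[symmetric] sum_distrib_right[symmetric] c_def)
  ultimately have "((\<lambda>g. if \<forall>y\<in>L. (\<Sum>i\<in>I. g i * D i y) \<in> \<int> then \<Sum>x\<in>Box p. U g x else 0) has_sum
      local_genus \<tau> \<sigma> w) (PiE I (\<lambda>_. UNIV))" by simp
  also have "?this \<longleftrightarrow> ((\<lambda>g. \<Sum>x\<in>Box p. U g x) has_sum local_genus \<tau> \<sigma> w) K"
    by (rule has_sum_cong_neutral) (auto simp: K_def)
  also have "\<dots> \<longleftrightarrow> ((\<lambda>m. \<Sum>x\<in>Box p. U (restrict (\<lambda>i. \<lfloor>m \<bullet> e i\<rfloor>) I) x) has_sum local_genus \<tau> \<sigma> w)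
      (dual_lattice L)"
    unfolding K_def by (rule has_sum_reindex_bij_betw[OF dual_lattice_bij, symmetric])
  also have "\<dots> \<longleftrightarrow> ((\<lambda>m. e2pi (- complex_ext ((\<bullet>) m) w) * theta_coeff \<tau> \<sigma> p m) has_sum
    local_genus \<tau> \<sigma> w) (dual_lattice L)"
  proof (rule has_sum_cong)
    fix m assume m: "m \<in> dual_lattice L"
    have fl: "of_int \<lfloor>m \<bullet> e i\<rfloor> = complex_of_real (m \<bullet> e i)" if "i \<in> I" for i
      using m vL[OF that] by (auto simp: dual_lattice_def elim!: Ints_cases dest!: bspec[of L _ "e i"])
    have ext: "complex_ext ((\<bullet>) m) w = (\<Sum>i\<in>I. of_real (m \<bullet> e i) * complex_ext (D i) w)"
      using inner_expand[OF w(1), of m] inner_expand[OF w(2), of m]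
      by (simp add: complex_ext_def sum.distrib distrib_left sum_distrib_left algebra_simps)
    have "U (restrict (\<lambda>i. \<lfloor>m \<bullet> e i\<rfloor>) I) x = e2pi (- complex_ext ((\<bullet>) m) w) *
        (e2pi (of_real (\<Sum>i\<in>I. D i x) * \<sigma> + of_real (m \<bullet> x) * \<tau>) /
         (\<Prod>i\<in>I. 1 - e2pi (\<sigma> + of_real (m \<bullet> e i) * \<tau>)))" if x: "x \<in> Box p" for x
    proof -
      have xs: "x \<in> span L" using x by (simp add: Box_def L_span)
      have "U (restrict (\<lambda>i. \<lfloor>m \<bullet> e i\<rfloor>) I) x =
          (\<Prod>i\<in>I. e2pi (of_real (D i x) * \<sigma> + of_real (m \<bullet> e i) * (- complex_ext (D i) w + \<tau> * of_real (D i x))) /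
            (1 - e2pi (\<sigma> + of_real (m \<bullet> e i) * \<tau>)))"
        unfolding U_def by (rule prod.cong) (simp_all add: fl e2pi_add)
      also have "\<dots> = e2pi (\<Sum>i\<in>I. of_real (D i x) * \<sigma> +
            of_real (m \<bullet> e i) * (- complex_ext (D i) w + \<tau> * of_real (D i x))) /
          (\<Prod>i\<in>I. 1 - e2pi (\<sigma> + of_real (m \<bullet> e i) * \<tau>))"
        by (simp only: prod_dividef e2pi_sum[OF finI])
      also have "(\<Sum>i\<in>I. of_real (D i x) * \<sigma> +
            of_real (m \<bullet> e i) * (- complex_ext (D i) w + \<tau> * of_real (D i x))) =
          - complex_ext ((\<bullet>) m) w + (of_real (\<Sum>i\<in>I. D i x) * \<sigma> + of_real (m \<bullet> x) * \<tau>)"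
        unfolding ext inner_expand[OF xs]
        by (simp add: sum.distrib sum_negf sum_distrib_left sum_distrib_right algebra_simps sum_subtractf)
      finally show ?thesis by (simp only: e2pi_add times_divide_eq_right)
    qed
    thus "(\<Sum>x\<in>Box p. U (restrict (\<lambda>i. \<lfloor>m \<bullet> e i\<rfloor>) I) x) =
        e2pi (- complex_ext ((\<bullet>) m) w) * theta_coeff \<tau> \<sigma> p m"
      by (simp add: theta_coeff_def sum_distrib_left sum_divide_distrib)
  qed
  finally show ?thesis .
qed

text \<open>The variable is \<open>\<sigma>\<close> itself and not \<open>e2pi \<sigma>\<close>,
  because the coordinate sums in the numerator need not be integers.\<close>

lemma theta_coeff_holomorphic:
  "(\<lambda>\<sigma>. theta_coeff \<tau> \<sigma> p m) holomorphic_on {\<sigma>. \<forall>i\<in>I. e2pi (\<sigma> + of_real (m \<bullet> e i) * \<tau>) \<noteq> 1}"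
  unfolding theta_coeff_def using finI
  by (intro holomorphic_intros) auto

text \<open>Every lattice point of the open shifted cone is, in exactly one way, a box point plus a
  nonnegative integer combination of the \<open>e i\<close>. A step by \<open>e i\<close> multiplies
  the term by \<open>e2pi (\<sigma> + (m \<bullet> e i) * \<tau>)\<close>, of norm below 1 by the
  hypothesis on \<open>\<sigma>\<close>, so geometric series give the denominators.\<close>

lemma theta_coeff_has_sum:
  assumes m: "m \<in> dual_lattice L" and \<tau>: "Im \<tau> > 0" and p: "generic p"
    and \<sigma>: "\<And>i. i \<in> I \<Longrightarrow> Im \<sigma> + (m \<bullet> e i) * Im \<tau> > 0"
  shows "((\<lambda>x. e2pi (of_real (\<Sum>i\<in>I. D i x) * \<sigma> + of_real (m \<bullet> x) * \<tau>)) has_sum theta_coeff \<tau> \<sigma> p m)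
    {x \<in> L. \<forall>i\<in>I. D i p < D i x}"
proof -
  define f where "f x = e2pi (of_real (\<Sum>i\<in>I. D i x) * \<sigma> + of_real (m \<bullet> x) * \<tau>)" for x
  define P where "P = (\<Prod>i\<in>I. 1 / (1 - e2pi (\<sigma> + of_real (m \<bullet> e i) * \<tau>)))"
  define S where "S = PiE I (\<lambda>_. UNIV :: nat set)"
  define tr where "tr x k = x + (\<Sum>i\<in>I. of_int (int (k i)) *\<^sub>R e i)" for x and k :: "'b \<Rightarrow> nat"
  have D_tr: "D i (tr x k) = D i x + k i" if "i \<in> I" "x \<in> L" for i x k
    unfolding tr_def using that by (simp add: D_add L_span comb_span D_comb del: of_int_of_nat_eq)
  have tr_L: "tr x k \<in> L" if "x \<in> L" for x k
    unfolding tr_def by (rule lattice_add[OF lat that comb_L])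
  have f_tr: "f (tr x k) = f x * (\<Prod>i\<in>I. e2pi (\<sigma> + of_real (m \<bullet> e i) * \<tau>) ^ k i)" if "x \<in> L" for x k
  proof -
    have "f x * (\<Prod>i\<in>I. e2pi (\<sigma> + of_real (m \<bullet> e i) * \<tau>) ^ k i) =
        e2pi (of_real (\<Sum>i\<in>I. D i x) * \<sigma> + of_real (m \<bullet> x) * \<tau> +
          (\<Sum>i\<in>I. of_nat (k i) * (\<sigma> + of_real (m \<bullet> e i) * \<tau>)))"
      by (simp only: f_def e2pi_sum[OF finI] e2pi_nat_mult e2pi_add[of _ "sum _ _"])
    moreover have "(\<Sum>i\<in>I. D i (tr x k)) = (\<Sum>i\<in>I. D i x) + (\<Sum>i\<in>I. k i)"
      using that by (simp add: D_tr sum.distrib)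
    moreover have "m \<bullet> tr x k = m \<bullet> x + (\<Sum>i\<in>I. k i * (m \<bullet> e i))"
      by (simp add: tr_def inner_add_right inner_sum_right)
    ultimately show ?thesis
      unfolding f_def
      by (simp add: sum.distrib sum_distrib_left sum_distrib_right algebra_simps)
  qed
  have geo: "((\<lambda>k. e2pi (\<sigma> + of_real (m \<bullet> e i) * \<tau>) ^ k) has_sum
      1 / (1 - e2pi (\<sigma> + of_real (m \<bullet> e i) * \<tau>))) UNIV" if "i \<in> I" for i
  proof -
    have lt: "norm (e2pi (\<sigma> + of_real (m \<bullet> e i) * \<tau>)) < 1"
      using \<sigma>[OF that] by (simp add: norm_e2pi)
    show ?thesis
      by (rule norm_summable_imp_has_sum[OF _ geometric_sums[OF lt]])
        (use lt in \<open>simp add: norm_power summable_geometric\<close>)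
  qed
  have inj: "inj_on (tr x) S" if "x \<in> L" for x
  proof (rule inj_onI)
    fix k k' assume k: "k \<in> S" "k' \<in> S" "tr x k = tr x k'"
    have "k i = k' i" if "i \<in> I" for i
      using D_tr[OF that \<open>x \<in> L\<close>, of k] D_tr[OF that \<open>x \<in> L\<close>, of k'] k(3) by simp
    thus "k = k'" using k(1,2) unfolding S_def by (blast intro: PiE_ext)
  qed
  have 1: "(f has_sum (f x * P)) (tr x ` S)" if x: "x \<in> Box p" for x
  proof -
    have xL: "x \<in> L" using x by (simp add: Box_def)
    have "((\<lambda>k. f x * (\<Prod>i\<in>I. e2pi (\<sigma> + of_real (m \<bullet> e i) * \<tau>) ^ k i)) has_sum (f x * P)) S"
      unfolding P_def S_def by (intro has_sum_cmult_right has_sum_prod_PiE[OF finI] geo)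
    thus ?thesis
      by (subst has_sum_reindex[OF inj[OF xL]]) (simp add: o_def f_tr[OF xL])
  qed
  have 2: "tr x ` S \<inter> tr y ` S = {}" if xy: "x \<in> Box p" "y \<in> Box p" "x \<noteq> y" for x y
  proof -
    have "x = y" if k: "k \<in> S" "k' \<in> S" "tr x k = tr y k'" for k k'
    proof -
      have L: "x \<in> L" "y \<in> L" using xy by (auto simp: Box_def)
      have "(x, y) \<in> R" unfolding R_iff
      proof (intro conjI ballI L)
        fix i assume i: "i \<in> I"
        have "D i x - D i y = of_int (int (k' i) - int (k i))"
          using D_tr[OF i L(1), of k] D_tr[OF i L(2), of k'] k(3) by simp
        thus "D i x - D i y \<in> \<int>" by (metis Ints_of_int)
      qed
      moreover have "(x, x) \<in> R" using L by (simp add: R_iff)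
      ultimately show ?thesis using Box_transversal[OF p L(1)] xy by blast
    qed
    thus ?thesis using xy(3) by blast
  qed
  have 3: "(\<Union>x\<in>Box p. tr x ` S) = {x \<in> L. \<forall>i\<in>I. D i p < D i x}"
  proof (intro subset_antisym subsetI)
    fix y assume "y \<in> (\<Union>x\<in>Box p. tr x ` S)"
    then obtain x k where x: "x \<in> Box p" "y = tr x k" by blast
    hence xL: "x \<in> L" by (simp add: Box_def)
    have "D i p < D i y" if "i \<in> I" for i
    proof -
      have "D i p < D i x" using x that by (simp add: Box_def)
      also have "\<dots> \<le> D i y" using D_tr[OF that xL] x by simp
      finally show ?thesis .
    qed
    thus "y \<in> {x \<in> L. \<forall>i\<in>I. D i p < D i x}" using x tr_L[OF xL] by auto
  next
    fix y assume y: "y \<in> {x \<in> L. \<forall>i\<in>I. D i p < D i x}"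
    hence yL: "y \<in> L" by simp
    obtain x where x: "x \<in> Box p" "(y, x) \<in> R" using Box_transversal[OF p yL] by blast
    hence xL: "x \<in> L" by (simp add: Box_def)
    define k where "k = restrict (\<lambda>i. nat \<lfloor>D i y - D i x\<rfloor>) I"
    have "y = tr x k"
    proof (rule D_eqI)
      show "y \<in> span L" "tr x k \<in> span L" using yL tr_L[OF xL] L_span by auto
      fix i assume i: "i \<in> I"
      obtain j :: int where j: "D i y = D i x + of_int j" using R_E[OF x(2) i] .
      have "D i x < D i p + 1" "D i p < D i y" using x y i by (auto simp: Box_def)
      hence "real_of_int j > -1" using j by linarith
      hence "j \<ge> 0" by linarith
      thus "D i y = D i (tr x k)" using D_tr[OF i xL] i by (simp add: k_def j)
    qed
    moreover have "k \<in> S" by (simp add: k_def S_def)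
    ultimately show "y \<in> (\<Union>x\<in>Box p. tr x ` S)" using x by blast
  qed
  have "(f has_sum (\<Sum>x\<in>Box p. f x * P)) (\<Union>x\<in>Box p. tr x ` S)"
    by (rule sum_has_sum[OF finite_Box 1 2])
  also have "(\<Sum>x\<in>Box p. f x * P) = theta_coeff \<tau> \<sigma> p m"
    by (simp add: theta_coeff_def f_def P_def sum_divide_distrib prod_dividef)
  finally show ?thesis unfolding 3 f_def .
qed

end

section \<open>Simplicial cones and triangulations\<close>

lemma convex_cone_sum:
  "convex_cone S \<Longrightarrow> (\<And>i. i \<in> A \<Longrightarrow> f i \<in> S) \<Longrightarrow> sum f A \<in> S"
  by (induction A rule: infinite_finite_induct) (auto intro: convex_cone_contains_0 convex_cone_add)

lemma representation_hull_nonneg: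
  assumes S: "independent S" and x: "x \<in> convex_cone hull S"
  shows "x \<in> span S" "representation S x s \<ge> 0"
proof -
  let ?K = "{x \<in> span S. \<forall>s. representation S x s \<ge> 0}"
  have "convex_cone ?K"
    unfolding convex_cone_iff using S
    by (auto simp: span_add span_scale span_zero representation_add representation_scale representation_zero)
  moreover have "S \<subseteq> ?K" using S by (auto simp: span_base representation_basis)
  ultimately have "convex_cone hull S \<subseteq> ?K" by (rule hull_minimal[rotated])
  thus "x \<in> span S" "representation S x s \<ge> 0" using x by auto
qed

text \<open>A face containing a nonnegative combination of \<open>S\<close> contains every generator
  with positive coefficient; in dimension 1 only one independent generator fits.\<close>

lemma simplicial_cone_ray:
  fixes S :: "'a::euclidean_space set"
  assumes S: "independent S" and face: "F face_of (convex_cone hull S)" and F: "convex_cone F" "dim F = 1"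
    and x: "x \<in> F" "x \<noteq> 0"
  shows "\<exists>s\<in>S. \<exists>a>0. x = a *\<^sub>R s \<and> F = (\<lambda>t. t *\<^sub>R s) ` {0..}"
proof -
  define C where "C = convex_cone hull S"
  define r where "r = representation S x"
  have C: "convex_cone C" unfolding C_def by (rule convex_cone_convex_cone_hull)
  have fin: "finite S" using S by (rule independent_imp_finite)
  have SC: "S \<subseteq> C" unfolding C_def by (rule hull_subset)
  have FC: "F \<subseteq> C" using face face_of_imp_subset by (auto simp: C_def)
  have xs: "x \<in> span S" "\<And>s. r s \<ge> 0"
    using representation_hull_nonneg[OF S] x FC by (auto simp: C_def r_def)
  have x_eq: "x = (\<Sum>s\<in>S. r s *\<^sub>R s)"
    unfolding r_def using sum_representation_eq[OF S xs(1) fin subset_refl] by simp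
  have in_F: "s \<in> F" if s: "s \<in> S" "r s > 0" for s
  proof -
    \<comment> \<open>The factor 2 makes \<open>x\<close> the midpoint of
      \<open>(2 * r s) *\<^sub>R s\<close> and \<open>y\<close>, so the face property applies unless
      the two endpoints coincide with \<open>x\<close>.\<close>
    define y where "y = 2 *\<^sub>R (\<Sum>s'\<in>S - {s}. r s' *\<^sub>R s')"
    have yC: "y \<in> C" unfolding y_def
      using xs SC by (intro convex_cone_scaleR[OF C] convex_cone_sum[OF C]) auto
    have zC: "(2 * r s) *\<^sub>R s \<in> C"
      using s SC by (intro convex_cone_scaleR[OF C]) auto
    have x_mid: "x = (1/2) *\<^sub>R ((2 * r s) *\<^sub>R s) + (1/2) *\<^sub>R y"
      unfolding y_def using sum.remove[OF fin s(1), of "\<lambda>s. r s *\<^sub>R s"] x_eq by simp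
    have "(2 * r s) *\<^sub>R s \<in> F"
    proof (cases "y = (2 * r s) *\<^sub>R s")
      case True
      hence "x = (2 * r s) *\<^sub>R s" using x_mid by (simp add: scaleR_add_left[symmetric])
      thus ?thesis using x by simp
    next
      case False
      have "x \<in> open_segment ((2 * r s) *\<^sub>R s) y"
        unfolding in_segment using False x_mid by (auto intro!: exI[of _ "1/2"])
      thus ?thesis using face_ofD[OF face[folded C_def] _ zC yC x(1)] by blast
    qed
    moreover have "0 \<le> 1 / (2 * r s)" using s by simp
    ultimately have "(1 / (2 * r s)) *\<^sub>R ((2 * r s) *\<^sub>R s) \<in> F"
      using convex_cone_scaleR[OF F(1)] by blast
    moreover have "(1 / (2 * r s)) *\<^sub>R ((2 * r s) *\<^sub>R s) = s" using s by simp
    ultimately show "s \<in> F" by (simp only:)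
  qed
  obtain s where s: "s \<in> S" "r s > 0"
  proof -
    have "\<exists>s\<in>S. r s \<noteq> 0"
    proof (rule ccontr)
      assume "\<not> (\<exists>s\<in>S. r s \<noteq> 0)"
      hence "(\<Sum>s\<in>S. r s *\<^sub>R s) = 0" by (intro sum.neutral) auto
      thus False using x(2) x_eq by simp
    qed
    thus ?thesis using that xs(2) by (force simp: less_le)
  qed
  have F_span: "F \<subseteq> span {s}"
  proof -
    have "s \<noteq> 0" using S s dependent_zero by blast
    hence "{s} \<subseteq> F" "independent {s}" "card {s} = dim F"
      using in_F[OF s] F by auto
    thus ?thesis using card_eq_dim[of "{s}" F] by simp
  qed
  have "r s' = 0" if "s' \<in> S" "s' \<noteq> s" for s'
  proof (rule ccontr)
    assume "r s' \<noteq> 0"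
    hence "s' \<in> F" using in_F[OF that(1)] xs(2)[of s'] by simp
    hence "s' \<in> span (S - {s'})"
      using F_span span_mono[of "{s}" "S - {s'}"] s that by auto
    thus False using S that unfolding dependent_def by blast
  qed
  hence "(\<Sum>s'\<in>S. r s' *\<^sub>R s') = (\<Sum>s'\<in>{s}. r s' *\<^sub>R s')"
    using s fin by (intro sum.mono_neutral_right) auto
  hence x_s: "x = r s *\<^sub>R s" using x_eq by simp
  have "F = (\<lambda>t. t *\<^sub>R s) ` {0..}"
  proof (intro subset_antisym subsetI)
    fix y assume y: "y \<in> F"
    then obtain t where t: "y = t *\<^sub>R s" using F_span by (auto simp: span_singleton)
    have "representation S y s = t"
      using S s by (simp add: t representation_scale span_base representation_basis)
    moreover have "representation S y s \<ge> 0"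
      using representation_hull_nonneg(2)[OF S] y FC by (auto simp: C_def)
    ultimately show "y \<in> (\<lambda>t. t *\<^sub>R s) ` {0..}" using t by auto
  qed (use in_F[OF s] convex_cone_scaleR[OF F(1)] in auto)
  thus ?thesis using s x_s by blast
qed

lemma strongly_convex_rational_coneD:
  assumes "strongly_convex_rational_cone L C"
  shows "convex_cone C" "C \<subseteq> span L"
proof -
  obtain S where S: "S \<subseteq> L" "C = convex_cone hull S"
    using assms unfolding strongly_convex_rational_cone_def by blast
  show "convex_cone C" unfolding S by (rule convex_cone_convex_cone_hull)
  show "C \<subseteq> span L" unfolding S
    by (rule hull_minimal) (use S(1) span_superset[of L] convex_cone_span in auto)
qed

lemma is_multi_fanD:
  assumes "is_multi_fan L \<Delta>"
  shows "finite (simplices \<Delta>)"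
    and "J \<in> simplices \<Delta> \<Longrightarrow> le \<Delta> J J"
    and "J \<in> simplices \<Delta> \<Longrightarrow> strongly_convex_rational_cone L (cone_at \<Delta> J)"
    and "\<lbrakk>K \<in> simplices \<Delta>; J \<in> simplices \<Delta>; le \<Delta> K J\<rbrakk> \<Longrightarrow> cone_at \<Delta> K face_of cone_at \<Delta> J"
    and "J \<in> simplices \<Delta> \<Longrightarrow> inj_on (cone_at \<Delta>) {K \<in> simplices \<Delta>. le \<Delta> K J}"
proof -
  note * = assms[unfolded is_multi_fan_def]
  show "finite (simplices \<Delta>)" using * by (elim conjE)
  show "J \<in> simplices \<Delta> \<Longrightarrow> le \<Delta> J J" using * by (elim conjE) (erule reflp_onD)
  show "J \<in> simplices \<Delta> \<Longrightarrow> strongly_convex_rational_cone L (cone_at \<Delta> J)"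
    using * by (elim conjE) (erule bspec)
  show "\<lbrakk>K \<in> simplices \<Delta>; J \<in> simplices \<Delta>; le \<Delta> K J\<rbrakk> \<Longrightarrow> cone_at \<Delta> K face_of cone_at \<Delta> J"
    using * unfolding cone_face_def by (elim conjE) (drule bspec, assumption, drule bspec, assumption, blast)
  show "J \<in> simplices \<Delta> \<Longrightarrow> inj_on (cone_at \<Delta>) {K \<in> simplices \<Delta>. le \<Delta> K J}"
    using * unfolding bij_betw_def by (elim conjE) blast
qed

lemma is_simplicial_multi_fanD:
  assumes "is_simplicial_multi_fan L n \<Delta>"
  shows "is_multi_fan L \<Delta>"
    and "J \<in> simplices \<Delta> \<Longrightarrow> finite J"
    and "\<lbrakk>J \<in> simplices \<Delta>; K \<subseteq> J\<rbrakk> \<Longrightarrow> K \<in> simplices \<Delta>"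
    and "\<lbrakk>J \<in> simplices \<Delta>; K \<in> simplices \<Delta>\<rbrakk> \<Longrightarrow> le \<Delta> J K \<longleftrightarrow> J \<subseteq> K"
    and "J \<in> simplices \<Delta> \<Longrightarrow> simplicial_cone (cone_at \<Delta> J)"
    and "J \<in> simplices \<Delta> \<Longrightarrow> dim (cone_at \<Delta> J) = card J"
    and "J \<in> simplices \<Delta> \<Longrightarrow> \<exists>I\<in>stratum \<Delta> n. J \<subseteq> I"
proof -
  note * = assms[unfolded is_simplicial_multi_fan_def]
  show "is_multi_fan L \<Delta>" using * by (elim conjE)
  show "J \<in> simplices \<Delta> \<Longrightarrow> finite J" using * by (elim conjE) (erule bspec)
  show "\<lbrakk>J \<in> simplices \<Delta>; K \<subseteq> J\<rbrakk> \<Longrightarrow> K \<in> simplices \<Delta>"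
    using conjunct1[OF conjunct2[OF conjunct2[OF conjunct2[OF *]]]] by blast
  show "\<lbrakk>J \<in> simplices \<Delta>; K \<in> simplices \<Delta>\<rbrakk> \<Longrightarrow> le \<Delta> J K \<longleftrightarrow> J \<subseteq> K"
    using conjunct1[OF conjunct2[OF conjunct2[OF conjunct2[OF conjunct2[OF *]]]]] by blast
  have "\<forall>J\<in>simplices \<Delta>. simplicial_cone (cone_at \<Delta> J) \<and> dim (cone_at \<Delta> J) = card J"
    using * by (elim conjE)
  thus "J \<in> simplices \<Delta> \<Longrightarrow> simplicial_cone (cone_at \<Delta> J)"
    "J \<in> simplices \<Delta> \<Longrightarrow> dim (cone_at \<Delta> J) = card J" by blast+
  have "\<forall>J\<in>simplices \<Delta>. \<exists>I\<in>stratum \<Delta> n. J \<subseteq> I" using * by (elim conjE)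
  thus "J \<in> simplices \<Delta> \<Longrightarrow> \<exists>I\<in>stratum \<Delta> n. J \<subseteq> I" by blast
qed

text \<open>Simpliciality only asserts that some independent set \<open>S\<close> generates the
  cone. Each edge vector spans a one-dimensional face and is thus a positive multiple of a member of
  \<open>S\<close>; faces of different vertices are different cones, and
  \<open>card I = n = card S\<close> makes the matching bijective. So the edge vectors generate the
  cone, and the dual coordinates describe it.\<close>

lemma simplicial_multi_fan_top_simplex:
  fixes \<Delta>' :: "('b set, 'a::euclidean_space) multi_fan"
  assumes lat: "lattice_of_rank L n" and fan: "is_simplicial_multi_fan L n \<Delta>'"
    and I: "I \<in> stratum \<Delta>' n"
    and v: "\<And>i. i \<in> I \<Longrightarrow> v {i} \<in> L \<and> v {i} \<noteq> 0 \<and> v {i} \<in> cone_at \<Delta>' {i}"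
  shows "lattice_simplex L n v I"
    and "cone_at \<Delta>' I = {x \<in> span L. \<forall>i\<in>I. dual_vector v I i x \<ge> 0}"
proof -
  define C where "C = cone_at \<Delta>' I"
  have mf: "is_multi_fan L \<Delta>'" by (rule is_simplicial_multi_fanD(1)[OF fan])
  have Is: "I \<in> simplices \<Delta>'" "dim C = n" using I by (auto simp: stratum_def C_def)
  have finI: "finite I" and cardI: "card I = n"
    using is_simplicial_multi_fanD(2,6)[OF fan Is(1)] Is by (auto simp: C_def)
  obtain S where S: "independent S" "C = convex_cone hull S"
    using is_simplicial_multi_fanD(5)[OF fan Is(1)] by (auto simp: simplicial_cone_def C_def)
  have fin: "finite S" using S by (intro independent_imp_finite)
  have scr: "strongly_convex_rational_cone L (cone_at \<Delta>' J)" if "J \<in> simplices \<Delta>'" for J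
    by (rule is_multi_fanD(3)[OF mf that])
  have C: "convex_cone C" "C \<subseteq> span L"
    using strongly_convex_rational_coneD[OF scr[OF Is(1)]] by (auto simp: C_def)
  have SC: "S \<subseteq> C" unfolding S by (rule hull_subset)
  have "C \<subseteq> span S" using representation_hull_nonneg(1)[OF S(1)] S by auto
  hence dimS: "card S = n" "span C = span S"
  proof -
    show "span C = span S" using \<open>C \<subseteq> span S\<close> SC by (simp add: span_minimal span_mono subset_antisym)
    hence "dim C = dim S" by (metis dim_span)
    thus "card S = n" using S(1) Is(2) by (simp add: dim_eq_card_independent)
  qed
  have spanS: "span S = span L"
  proof -
    have "S \<subseteq> span L" using SC C by blast
    moreover have "card S = dim (span L)" using dimS dim_lattice[OF lat] by simp
    ultimately have "span L \<subseteq> span S" using card_eq_dim[of S "span L"] S fin by blast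
    thus ?thesis using \<open>S \<subseteq> span L\<close> by (meson span_minimal subspace_span subset_antisym)
  qed
  have vert: "{i} \<in> simplices \<Delta>'" "le \<Delta>' {i} I" if "i \<in> I" for i
  proof -
    show "{i} \<in> simplices \<Delta>'" using is_simplicial_multi_fanD(3)[OF fan Is(1), of "{i}"] that by simp
    thus "le \<Delta>' {i} I" using is_simplicial_multi_fanD(4)[OF fan _ Is(1)] that by blast
  qed
  have ray: "\<exists>s\<in>S. \<exists>a>0. v {i} = a *\<^sub>R s \<and> cone_at \<Delta>' {i} = (\<lambda>t. t *\<^sub>R s) ` {0..}" if i: "i \<in> I" for i
  proof (rule simplicial_cone_ray[OF S(1)])
    show "cone_at \<Delta>' {i} face_of convex_cone hull S"
      using is_multi_fanD(4)[OF mf vert(1)[OF i] Is(1) vert(2)[OF i]] by (simp add: C_def[symmetric] S(2))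
    show "convex_cone (cone_at \<Delta>' {i})"
      using strongly_convex_rational_coneD[OF scr] vert[OF i] by blast
    show "dim (cone_at \<Delta>' {i}) = 1"
      using is_simplicial_multi_fanD(6)[OF fan vert(1)[OF i]] by simp
  qed (use v[OF i] in auto)
  then obtain s a where sa: "\<And>i. i \<in> I \<Longrightarrow> s i \<in> S" "\<And>i. i \<in> I \<Longrightarrow> a i > 0"
      "\<And>i. i \<in> I \<Longrightarrow> v {i} = a i *\<^sub>R s i"
      "\<And>i. i \<in> I \<Longrightarrow> cone_at \<Delta>' {i} = (\<lambda>t. t *\<^sub>R s i) ` {0..}"
    by metis
  have inj_cone: "inj_on (cone_at \<Delta>') {K \<in> simplices \<Delta>'. le \<Delta>' K I}"
    by (rule is_multi_fanD(5)[OF mf Is(1)])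
  have "inj_on s I"
  proof (rule inj_onI)
    fix i j assume ij: "i \<in> I" "j \<in> I" "s i = s j"
    hence "cone_at \<Delta>' {i} = cone_at \<Delta>' {j}" by (simp add: sa)
    thus "i = j" using inj_onD[OF inj_cone, of "{i}" "{j}"] vert ij by auto
  qed
  hence sI: "s ` I = S"
    using sa(1) cardI dimS fin by (intro card_subset_eq) (auto simp: card_image)
  have inj_v: "inj_on (\<lambda>i. v {i}) I"
  proof (rule inj_onI)
    fix i j assume ij: "i \<in> I" "j \<in> I" "v {i} = v {j}"
    have "representation S (a i *\<^sub>R s i) (s i) = representation S (a j *\<^sub>R s j) (s i)"
      using ij sa by simp
    hence "a i = (if s i = s j then a j else 0)"
      using ij sa(1) S(1) by (simp add: representation_scale span_base representation_basis)
    hence "s i = s j" using sa(2)[OF ij(1)] by (auto split: if_splits)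
    thus "i = j" using \<open>inj_on s I\<close> ij by (auto dest: inj_onD)
  qed
  have s_eq: "s i = (1 / a i) *\<^sub>R v {i}" if "i \<in> I" for i
    using sa(2,3)[OF that] by simp
  have "S \<subseteq> span ((\<lambda>i. v {i}) ` I)"
    using s_eq unfolding sI[symmetric] by (auto intro: span_scale span_base)
  hence "span L \<subseteq> span ((\<lambda>i. v {i}) ` I)"
    unfolding spanS[symmetric] by (rule span_minimal) simp
  moreover have "(\<lambda>i. v {i}) ` I \<subseteq> span L" using v by (auto intro: span_base)
  moreover have "card ((\<lambda>i. v {i}) ` I) = dim (span L)"
    using inj_v cardI dim_lattice[OF lat] by (simp add: card_image)
  ultimately have ind: "independent ((\<lambda>i. v {i}) ` I)"
    using card_eq_dim[of "(\<lambda>i. v {i}) ` I" "span L"] finI by blast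
  show ls: "lattice_simplex L n v I"
    by unfold_locales (use lat finI cardI inj_v ind v in auto)
  interpret lattice_simplex L n v I by (rule ls)
  let ?K = "{x \<in> span L. \<forall>i\<in>I. D i x \<ge> 0}"
  have "D i 0 = 0" for i using D_scale[of 0 i 0] by (simp add: span_zero)
  hence "convex_cone ?K"
    unfolding convex_cone_iff by (auto simp: span_add span_scale span_zero D_add D_scale)
  moreover have "S \<subseteq> ?K"
    unfolding sI[symmetric] using sa(2)
    by (auto simp: s_eq D_scale e_span D_e span_scale less_imp_le)
  ultimately have "C \<subseteq> ?K" unfolding S(2) by (rule hull_minimal[rotated])
  moreover have "?K \<subseteq> C"
  proof
    fix x assume x: "x \<in> ?K"
    have "(\<Sum>i\<in>I. D i x *\<^sub>R v {i}) \<in> C"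
      using x sa SC by (intro convex_cone_sum[OF C(1)] convex_cone_scaleR[OF C(1)])
        (auto intro!: convex_cone_scaleR[OF C(1)] less_imp_le)
    thus "x \<in> C" using D_expand[of x] x by simp
  qed
  ultimately show "cone_at \<Delta>' I = ?K" by (simp add: C_def)
qed

text \<open>A segment from any \<open>y\<close> of the cone to the interior point \<open>x\<close>
  can be prolonged beyond \<open>x\<close> within the cone. Then \<open>x\<close> lies strictly
  inside a segment of the cone, and the face property captures \<open>y\<close>.\<close>

lemma (in lattice_simplex) face_with_interior_point:
  assumes C: "C = {x \<in> span L. \<forall>i\<in>I. D i x \<ge> 0}" and face: "F face_of C"
    and x: "x \<in> F" "\<And>i. i \<in> I \<Longrightarrow> D i x > 0"
  shows "F = C"
proof
  show "F \<subseteq> C" using face by (rule face_of_imp_subset)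
  show "C \<subseteq> F"
  proof
    fix y assume y: "y \<in> C"
    have xs: "x \<in> span L" "y \<in> span L" using \<open>F \<subseteq> C\<close> x y C by auto
    \<comment> \<open>\<open>\<mu>\<close> bounds the coordinates of \<open>x\<close> from below,
      the 1 keeping \<open>Min\<close> defined when \<open>I\<close> is empty, and \<open>Y\<close>
      bounds those of \<open>y\<close> from above. Hence
      \<open>\<delta> * D i y \<le> D i x\<close>, which keeps the prolonged endpoint
      \<open>z\<close> in the cone.\<close>
    define \<mu> where "\<mu> = Min (insert 1 ((\<lambda>i. D i x) ` I))"
    define Y where "Y = 1 + (\<Sum>j\<in>I. D j y)"
    define \<delta> where "\<delta> = \<mu> / Y"
    have \<mu>: "\<mu> > 0" "\<And>i. i \<in> I \<Longrightarrow> \<mu> \<le> D i x"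
      using x(2) finI by (auto simp: \<mu>_def)
    have y0: "\<And>i. i \<in> I \<Longrightarrow> D i y \<ge> 0" using y C by auto
    hence Y: "Y \<ge> 1" by (auto simp: Y_def intro: sum_nonneg)
    have YD: "D i y \<le> Y" if "i \<in> I" for i
      using member_le_sum[OF that, of "\<lambda>j. D j y"] y0 finI by (simp add: Y_def)
    have \<delta>: "\<delta> > 0" using \<mu> Y by (simp add: \<delta>_def)
    define z where "z = x + \<delta> *\<^sub>R (x - y)"
    have "D i z \<ge> 0" if i: "i \<in> I" for i
    proof -
      have "\<delta> * D i y \<le> \<delta> * Y" using YD[OF i] \<delta> by simp
      also have "\<dots> = \<mu>" using Y by (simp add: \<delta>_def)
      also have "\<dots> \<le> D i x" by (rule \<mu>(2)[OF i])
      finally have "\<delta> * D i y \<le> D i x" .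
      moreover have "\<delta> * D i x \<ge> 0" using \<delta> x(2)[OF i] by simp
      ultimately show ?thesis
        using xs by (simp add: z_def D_add D_scale D_diff span_scale span_diff right_diff_distrib)
    qed
    moreover have "z \<in> span L" unfolding z_def using xs by (intro span_add span_scale span_diff)
    ultimately have zC: "z \<in> C" using C by simp
    show "y \<in> F"
    proof (cases "y = x")
      case False
      have "x = (1 - \<delta> / (1 + \<delta>)) *\<^sub>R z + (\<delta> / (1 + \<delta>)) *\<^sub>R y"
      proof -
        have "(1 + \<delta>) *\<^sub>R x = (1 + \<delta>) *\<^sub>R ((1 - \<delta> / (1 + \<delta>)) *\<^sub>R z + (\<delta> / (1 + \<delta>)) *\<^sub>R y)"
        proof -
          have "(1 + \<delta>) * (1 - \<delta> / (1 + \<delta>)) = 1" "(1 + \<delta>) * (\<delta> / (1 + \<delta>)) = \<delta>"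
            using \<delta> by (auto simp: field_simps)
          thus ?thesis by (simp only: scaleR_add_right scaleR_scaleR)
              (simp add: z_def scaleR_add_left scaleR_diff_right)
        qed
        thus ?thesis using \<delta> by simp
      qed
      moreover have "0 < \<delta> / (1 + \<delta>)" "\<delta> / (1 + \<delta>) < 1" using \<delta> by auto
      moreover have "z \<noteq> y"
      proof
        assume "z = y"
        hence "(1 + \<delta>) *\<^sub>R (x - y) = 0" by (simp add: z_def scaleR_add_left algebra_simps)
        thus False using \<delta> False by simp
      qed
      ultimately have "x \<in> open_segment z y" unfolding in_segment by blast
      thus ?thesis using face_ofD[OF face _ zC y x(1)] by blast
    qed (use x in simp)
  qed
qed

lemma is_triangulationD:
  assumes "is_triangulation L n \<Delta> \<Delta>' \<rho>"
  shows "is_simplicial_multi_fan L n \<Delta>'"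
    and "J' \<in> simplices \<Delta>' \<Longrightarrow> \<rho> J' \<in> simplices \<Delta>"
    and "\<lbrakk>J' \<in> simplices \<Delta>'; K' \<in> simplices \<Delta>'; le \<Delta>' J' K'\<rbrakk> \<Longrightarrow> le \<Delta> (\<rho> J') (\<rho> K')"
    and "i' \<in> stratum \<Delta>' 1 \<Longrightarrow> \<rho> i' \<in> stratum \<Delta> 1 \<and> cone_at \<Delta> (\<rho> i') = cone_at \<Delta>' i'"
    and "J' \<in> simplices \<Delta>' \<Longrightarrow> cone_at \<Delta>' J' \<subseteq> cone_at \<Delta> (\<rho> J')"
    and "J \<in> simplices \<Delta> \<Longrightarrow> inj_on (cone_at \<Delta>') {J'\<in>simplices \<Delta>'. le \<Delta> (\<rho> J') J}"
    and "J \<in> simplices \<Delta> \<Longrightarrow>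
      subdivides L (cone_at \<Delta>' ` {J'\<in>simplices \<Delta>'. le \<Delta> (\<rho> J') J}) (cone_at \<Delta> J)"
    and "I' \<in> stratum \<Delta>' n \<Longrightarrow> weight \<Delta>' I' = weight \<Delta> (\<rho> I')"
proof -
  note * = assms[unfolded is_triangulation_def]
  show "is_simplicial_multi_fan L n \<Delta>'" using * by (elim conjE)
  have "\<rho> ` simplices \<Delta>' \<subseteq> simplices \<Delta>" using * by (elim conjE)
  thus "J' \<in> simplices \<Delta>' \<Longrightarrow> \<rho> J' \<in> simplices \<Delta>" by blast
  have "monotone_on (simplices \<Delta>') (le \<Delta>') (le \<Delta>) \<rho>" using * by (elim conjE)
  thus "\<lbrakk>J' \<in> simplices \<Delta>'; K' \<in> simplices \<Delta>'; le \<Delta>' J' K'\<rbrakk> \<Longrightarrow> le \<Delta> (\<rho> J') (\<rho> K')"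
    by (rule monotone_onD)
  have "\<exists>\<kappa>. bij_betw \<kappa> (stratum \<Delta> 1) (stratum \<Delta>' 1) \<and>
        (\<forall>i\<in>stratum \<Delta> 1. cone_at \<Delta> i = cone_at \<Delta>' (\<kappa> i) \<and> \<rho> (\<kappa> i) = i)" using * by (elim conjE)
  then obtain \<kappa> where \<kappa>: "\<kappa> ` stratum \<Delta> 1 = stratum \<Delta>' 1"
      "\<forall>i\<in>stratum \<Delta> 1. cone_at \<Delta> i = cone_at \<Delta>' (\<kappa> i) \<and> \<rho> (\<kappa> i) = i"
    unfolding bij_betw_def by blast
  show "i' \<in> stratum \<Delta>' 1 \<Longrightarrow> \<rho> i' \<in> stratum \<Delta> 1 \<and> cone_at \<Delta> (\<rho> i') = cone_at \<Delta>' i'"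
    unfolding \<kappa>(1)[symmetric] using \<kappa>(2) by force
  have "\<forall>J'\<in>simplices \<Delta>'. cone_at \<Delta>' J' \<subseteq> cone_at \<Delta> (\<rho> J') \<and>
        (\<forall>K\<in>simplices \<Delta>. le \<Delta> K (\<rho> J') \<longrightarrow> cone_at \<Delta>' J' \<subseteq> cone_at \<Delta> K \<longrightarrow> K = \<rho> J')"
    using * by (elim conjE)
  thus "J' \<in> simplices \<Delta>' \<Longrightarrow> cone_at \<Delta>' J' \<subseteq> cone_at \<Delta> (\<rho> J')" by blast
  have "\<forall>J\<in>simplices \<Delta>.
        inj_on (cone_at \<Delta>') {J'\<in>simplices \<Delta>'. le \<Delta> (\<rho> J') J} \<and>
        subdivides L (cone_at \<Delta>' ` {J'\<in>simplices \<Delta>'. le \<Delta> (\<rho> J') J}) (cone_at \<Delta> J)"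
    using * by (elim conjE)
  thus "J \<in> simplices \<Delta> \<Longrightarrow> inj_on (cone_at \<Delta>') {J'\<in>simplices \<Delta>'. le \<Delta> (\<rho> J') J}"
    "J \<in> simplices \<Delta> \<Longrightarrow>
      subdivides L (cone_at \<Delta>' ` {J'\<in>simplices \<Delta>'. le \<Delta> (\<rho> J') J}) (cone_at \<Delta> J)"
    by (blast dest: bspec)+
  have "\<forall>I'\<in>stratum \<Delta>' n. w_plus \<Delta>' I' = w_plus \<Delta> (\<rho> I') \<and> w_minus \<Delta>' I' = w_minus \<Delta> (\<rho> I')"
    using * by (elim conjE)
  thus "I' \<in> stratum \<Delta>' n \<Longrightarrow> weight \<Delta>' I' = weight \<Delta> (\<rho> I')" by (simp add: weight_def)
qed

lemma stratumD: "J \<in> stratum \<Delta> k \<Longrightarrow> J \<in> simplices \<Delta>" "J \<in> stratum \<Delta> k \<Longrightarrow> dim (cone_at \<Delta> J) = k"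
  by (auto simp: stratum_def)

section \<open>Top simplices of a triangulation, grouped by the maximal cone they subdivide\<close>

locale triangulation =
  fixes L :: "'a::euclidean_space set" and n :: nat
    and \<Delta> :: "('s, 'a) multi_fan" and v :: "'s \<Rightarrow> 'a"
    and \<Delta>' :: "('b set, 'a) multi_fan" and \<rho> :: "'b set \<Rightarrow> 's"
  assumes lat: "lattice_of_rank L n"
    and mf: "is_multi_fan L \<Delta>"
    and ev: "edge_vectors L \<Delta> v"
    and tri: "is_triangulation L n \<Delta> \<Delta>' \<rho>"
begin

abbreviation v' where "v' \<equiv> induced_edge_vectors v \<rho>"
abbreviation maximal where "maximal J \<equiv> {I \<in> stratum \<Delta>' n. \<rho> I = J}"

lemmas simp_fan = is_triangulationD(1)[OF tri]
lemmas mf' = is_simplicial_multi_fanD(1)[OF simp_fan]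

lemma finite_stratum: "finite (stratum \<Delta>' n)"
  using is_multi_fanD(1)[OF mf'] by (simp add: stratum_def)

lemma vertex:
  assumes I: "I \<in> stratum \<Delta>' n" and i: "i \<in> I"
  shows "{i} \<in> simplices \<Delta>'" "\<rho> {i} \<in> stratum \<Delta> 1" "cone_at \<Delta> (\<rho> {i}) = cone_at \<Delta>' {i}"
    "le \<Delta> (\<rho> {i}) (\<rho> I)"
proof -
  have Is: "I \<in> simplices \<Delta>'" using I by (rule stratumD)
  show s: "{i} \<in> simplices \<Delta>'" using is_simplicial_multi_fanD(3)[OF simp_fan Is, of "{i}"] i by simp
  hence "{i} \<in> stratum \<Delta>' 1"
    using is_simplicial_multi_fanD(6)[OF simp_fan s] by (simp add: stratum_def)
  thus "\<rho> {i} \<in> stratum \<Delta> 1" "cone_at \<Delta> (\<rho> {i}) = cone_at \<Delta>' {i}"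
    using is_triangulationD(4)[OF tri] by blast+
  have "le \<Delta>' {i} I" using is_simplicial_multi_fanD(4)[OF simp_fan s Is] i by blast
  thus "le \<Delta> (\<rho> {i}) (\<rho> I)" by (rule is_triangulationD(3)[OF tri s Is])
qed

lemma v'_vertex:
  assumes I: "I \<in> stratum \<Delta>' n" and i: "i \<in> I"
  shows "v' {i} \<in> L \<and> v' {i} \<noteq> 0 \<and> v' {i} \<in> cone_at \<Delta>' {i}"
  using vertex[OF I i] ev unfolding edge_vectors_def induced_edge_vectors_def by auto

lemma top_simplex:
  assumes I: "I \<in> stratum \<Delta>' n"
  shows "lattice_simplex L n v' I"
    and "cone_at \<Delta>' I = {x \<in> span L. \<forall>i\<in>I. dual_vector v' I i x \<ge> 0}"
  using simplicial_multi_fan_top_simplex[OF lat simp_fan I, of v'] v'_vertex[OF I] by blast+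

text \<open>The dimension is squeezed between that of the smaller cone and the rank. It is this that
  allows the top simplices to be grouped over the maximal cones of \<open>\<Delta>\<close>.\<close>

lemma rho_stratum:
  assumes I: "I \<in> stratum \<Delta>' n"
  shows "\<rho> I \<in> stratum \<Delta> n"
proof -
  have Is: "I \<in> simplices \<Delta>'" using I by (rule stratumD)
  have s: "\<rho> I \<in> simplices \<Delta>" using Is by (rule is_triangulationD(2)[OF tri])
  have "dim (cone_at \<Delta>' I) \<le> dim (cone_at \<Delta> (\<rho> I))"
    using is_triangulationD(5)[OF tri Is] by (rule dim_subset)
  moreover have "dim (cone_at \<Delta> (\<rho> I)) \<le> dim (span L)"
    using strongly_convex_rational_coneD(2)[OF is_multi_fanD(3)[OF mf s]] by (rule dim_subset)
  ultimately show ?thesis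
    using s stratumD(2)[OF I] dim_lattice[OF lat] by (simp add: stratum_def)
qed

definition generic_point where
  "generic_point p \<longleftrightarrow> (\<forall>I\<in>stratum \<Delta>' n. lattice_simplex.generic L v' I p)"

text \<open>Genericity forces a lattice point whose shift lies in a top-dimensional cone to have its
  shift in the interior, so lower-dimensional cones contribute nothing. Disjointness holds because
  the intersection of two cones is a face of each and, once it contains an interior point of both,
  equals both.\<close>

lemma subdivision:
  assumes p: "generic_point p" and J: "J \<in> stratum \<Delta> n" and ps: "p \<in> span L"
  shows "(\<Union>I\<in>maximal J. {x \<in> L. \<forall>i\<in>I. dual_vector v' I i p < dual_vector v' I i x}) =
      {x \<in> L. x - p \<in> cone_at \<Delta> J}" (is "(\<Union>I\<in>_. ?X I) = _")
    and "\<lbrakk>I1 \<in> maximal J; I2 \<in> maximal J; I1 \<noteq> I2\<rbrakk> \<Longrightarrow>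
      {x \<in> L. \<forall>i\<in>I1. dual_vector v' I1 i p < dual_vector v' I1 i x} \<inter>
      {x \<in> L. \<forall>i\<in>I2. dual_vector v' I2 i p < dual_vector v' I2 i x} = {}"
proof -
  have Js: "J \<in> simplices \<Delta>" using J by (rule stratumD)
  let ?F = "{J'\<in>simplices \<Delta>'. le \<Delta> (\<rho> J') J}"
  have inj: "inj_on (cone_at \<Delta>') ?F" by (rule is_triangulationD(6)[OF tri Js])
  have sub: "subdivides L (cone_at \<Delta>' ` ?F) (cone_at \<Delta> J)" by (rule is_triangulationD(7)[OF tri Js])
  have maxF: "I \<in> ?F" if "I \<in> maximal J" for I
    using that is_multi_fanD(2)[OF mf Js] stratumD(1) by auto
  have inC: "x - p \<in> cone_at \<Delta>' I \<and> (\<forall>i\<in>I. dual_vector v' I i (x - p) > 0)"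
    if I: "I \<in> stratum \<Delta>' n" and x: "x \<in> ?X I" for I x
  proof -
    interpret lattice_simplex L n v' I by (rule top_simplex[OF I])
    have "x \<in> span L" using x L_span by simp
    thus ?thesis using x ps by (auto simp: top_simplex(2)[OF I] D_diff span_diff)
  qed
  show "(\<Union>I\<in>maximal J. ?X I) = {x \<in> L. x - p \<in> cone_at \<Delta> J}"
  proof (intro subset_antisym subsetI)
    fix x assume "x \<in> (\<Union>I\<in>maximal J. ?X I)"
    then obtain I where I: "I \<in> maximal J" "x \<in> ?X I" by blast
    hence "x - p \<in> cone_at \<Delta>' I" using inC by blast
    moreover have "cone_at \<Delta>' I \<subseteq> cone_at \<Delta> J"
      using is_triangulationD(5)[OF tri stratumD(1), of I] I by auto
    ultimately show "x \<in> {x \<in> L. x - p \<in> cone_at \<Delta> J}" using I by blast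
  next
    fix x assume x: "x \<in> {x \<in> L. x - p \<in> cone_at \<Delta> J}"
    have "cone_at \<Delta> J = \<Union>(cone_at \<Delta>' ` ?F)"
      using sub unfolding subdivides_def by (elim conjE) (rule sym)
    then obtain J' where J': "J' \<in> simplices \<Delta>'" "le \<Delta> (\<rho> J') J" "x - p \<in> cone_at \<Delta>' J'"
      using x by auto
    \<comment> \<open>This top simplex comes from the purity of \<open>\<Delta>'\<close>, not from
      the subdivision of \<open>J\<close>; that it lies over \<open>J\<close> is established only
      after \<open>J' = I\<close>.\<close>
    obtain I where I: "I \<in> stratum \<Delta>' n" "J' \<subseteq> I"
      using is_simplicial_multi_fanD(7)[OF simp_fan J'(1)] by blast
    have Is: "I \<in> simplices \<Delta>'" using I by (intro stratumD)
    interpret lattice_simplex L n v' I by (rule top_simplex[OF I(1)])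
    have le: "le \<Delta>' J' I" using is_simplicial_multi_fanD(4)[OF simp_fan J'(1) Is] I by simp
    have face: "cone_at \<Delta>' J' face_of cone_at \<Delta>' I"
      by (rule is_multi_fanD(4)[OF mf' J'(1) Is le])
    hence "x - p \<in> cone_at \<Delta>' I" using J' face_of_imp_subset by blast
    hence nonneg: "D i (x - p) \<ge> 0" if "i \<in> I" for i
      using that by (simp add: top_simplex(2)[OF I(1)])
    have D_xp: "D i (x - p) = D i x - D i p" for i
      using x ps by (simp add: D_diff L_span)
    have pos: "D i (x - p) > 0" if "i \<in> I" for i
    proof -
      have "generic p" using p I(1) by (simp add: generic_point_def)
      hence "D i x \<noteq> D i p" using that x unfolding generic_def by blast
      thus ?thesis using nonneg[OF that] D_xp[of i] by simp
    qed
    have "cone_at \<Delta>' J' = cone_at \<Delta>' I"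
      using face_with_interior_point[OF top_simplex(2)[OF I(1)] face J'(3) pos] .
    hence "J' = I"
      using inj_onD[OF is_multi_fanD(5)[OF mf' Is], of J' I] J'(1) le Is is_multi_fanD(2)[OF mf' Is] by blast
    hence leI: "le \<Delta> (\<rho> I) J" using J' by simp
    have \<rho>I: "\<rho> I \<in> stratum \<Delta> n" by (rule rho_stratum[OF I(1)])
    \<comment> \<open>A proper face would have smaller dimension, whereas both cones have dimension
      \<open>n\<close>.\<close>
    have "cone_at \<Delta> (\<rho> I) = cone_at \<Delta> J"
    proof (rule ccontr)
      assume neq: "cone_at \<Delta> (\<rho> I) \<noteq> cone_at \<Delta> J"
      have cc: "convex_cone (cone_at \<Delta> K)" if "K \<in> stratum \<Delta> n" for K
        using strongly_convex_rational_coneD(1)[OF is_multi_fanD(3)[OF mf stratumD(1)[OF that]]] .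
      have aff: "aff_dim (cone_at \<Delta> K) = int n" if "K \<in> stratum \<Delta> n" for K
        using aff_dim_zero[OF hull_inc[OF convex_cone_contains_0[OF cc[OF that]]]] stratumD(2)[OF that] by simp
      have "convex (cone_at \<Delta> J)" using cc[OF J] by (simp add: convex_cone_def)
      moreover have "cone_at \<Delta> (\<rho> I) face_of cone_at \<Delta> J"
        by (rule is_multi_fanD(4)[OF mf stratumD(1)[OF \<rho>I] Js leI])
      ultimately have "aff_dim (cone_at \<Delta> (\<rho> I)) < aff_dim (cone_at \<Delta> J)"
        using neq by (rule face_of_aff_dim_lt)
      thus False using aff J \<rho>I by simp
    qed
    hence "\<rho> I = J"
      using inj_onD[OF is_multi_fanD(5)[OF mf Js], of "\<rho> I" J] stratumD(1)[OF \<rho>I] leI Js is_multi_fanD(2)[OF mf Js] by blast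
    moreover have "x \<in> ?X I" using x pos D_xp by auto
    ultimately show "x \<in> (\<Union>I\<in>maximal J. ?X I)" using I by blast
  qed
  show "?X I1 \<inter> ?X I2 = {}" if I: "I1 \<in> maximal J" "I2 \<in> maximal J" "I1 \<noteq> I2"
  proof (rule ccontr)
    assume "?X I1 \<inter> ?X I2 \<noteq> {}"
    then obtain x where x: "x \<in> ?X I1" "x \<in> ?X I2" by blast
    have st: "I1 \<in> stratum \<Delta>' n" "I2 \<in> stratum \<Delta>' n" using I by auto
    let ?A = "cone_at \<Delta>' I1" and ?B = "cone_at \<Delta>' I2"
    have "\<forall>A\<in>cone_at \<Delta>' ` ?F. \<forall>B\<in>cone_at \<Delta>' ` ?F. cone_face (A \<inter> B) A \<and> cone_face (A \<inter> B) B"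
      using sub unfolding subdivides_def by (elim conjE)
    hence "cone_face (?A \<inter> ?B) ?A \<and> cone_face (?A \<inter> ?B) ?B"
      using maxF[OF I(1)] maxF[OF I(2)] by blast
    hence face: "?A \<inter> ?B face_of ?A" "?A \<inter> ?B face_of ?B" by (auto simp: cone_face_def)
    have xp: "x - p \<in> ?A \<inter> ?B" using inC[OF st(1) x(1)] inC[OF st(2) x(2)] by blast
    have "?A \<inter> ?B = ?A"
      using lattice_simplex.face_with_interior_point[OF top_simplex(1)[OF st(1)] top_simplex(2)[OF st(1)] face(1) xp]
        inC[OF st(1) x(1)] by blast
    moreover have "?A \<inter> ?B = ?B"
      using lattice_simplex.face_with_interior_point[OF top_simplex(1)[OF st(2)] top_simplex(2)[OF st(2)] face(2) xp]
        inC[OF st(2) x(2)] by blast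
    ultimately have "?A = ?B" by simp
    thus False using inj_onD[OF inj _ maxF[OF I(1)] maxF[OF I(2)]] I(3) by blast
  qed
qed

text \<open>Every vertex of \<open>I\<close> lies over an edge of \<open>J\<close>, so
  \<open>u\<close> is 1 on the whole basis and therefore agrees with the sum of its dual
  coordinates.\<close>

lemma degree:
  assumes u: "linear u" "\<And>i. i \<in> stratum \<Delta> 1 \<Longrightarrow> le \<Delta> i J \<Longrightarrow> u (v i) = 1"
    and I: "I \<in> maximal J" and x: "x \<in> span L"
  shows "(\<Sum>i\<in>I. dual_vector v' I i x) = u x"
proof -
  have st: "I \<in> stratum \<Delta>' n" using I by simp
  interpret lattice_simplex L n v' I by (rule top_simplex[OF st])
  have "u (v' {i}) = 1" if "i \<in> I" for i
    using vertex[OF st that] I u(2)[of "\<rho> {i}"] by (simp add: induced_edge_vectors_def)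
  hence "u (\<Sum>i\<in>I. D i x *\<^sub>R v' {i}) = (\<Sum>i\<in>I. D i x)"
    using u(1) by (simp add: linear_sum linear_cmul)
  thus ?thesis using D_expand[OF x] by simp
qed

text \<open>The weight of a top simplex depends only on its image under \<open>\<rho>\<close>;
  collecting fibres reduces the theorem to one maximal cone at a time.\<close>

lemma genus_eq:
  "orbifold_elliptic_genus L n \<Delta>' v' \<tau> \<sigma> w =
    (\<Sum>J\<in>stratum \<Delta> n. of_int (weight \<Delta> J) *
      (\<Sum>I\<in>maximal J. lattice_simplex.local_genus L v' I \<tau> \<sigma> w))"
proof -
  have fin: "finite (stratum \<Delta> n)" using is_multi_fanD(1)[OF mf] by (simp add: stratum_def)
  have "orbifold_elliptic_genus L n \<Delta>' v' \<tau> \<sigma> w =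
      (\<Sum>I\<in>stratum \<Delta>' n. of_int (weight \<Delta> (\<rho> I)) * lattice_simplex.local_genus L v' I \<tau> \<sigma> w)"
    unfolding orbifold_elliptic_genus_def
  proof (rule sum.cong)
    fix I assume I: "I \<in> stratum \<Delta>' n"
    interpret lattice_simplex L n v' I by (rule top_simplex[OF I])
    show "of_int (weight \<Delta>' I) / of_nat (card (H_group L v' I)) *
        (\<Sum>(h1, h2)\<in>H_group L v' I \<times> H_group L v' I.
           \<Prod>i\<in>I. e2pi (of_real (dual_vector v' I i (coset_rep h1)) * \<sigma>) *
             phi_st (orbi_arg v' I i \<tau> w (coset_rep h1) (coset_rep h2)) \<tau> \<sigma>) =
        of_int (weight \<Delta> (\<rho> I)) * local_genus \<tau> \<sigma> w"
      unfolding local_genus_def genus_summand_def is_triangulationD(8)[OF tri I] by simp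
  qed auto
  also have "\<dots> = (\<Sum>J\<in>stratum \<Delta> n. \<Sum>I\<in>maximal J.
      of_int (weight \<Delta> (\<rho> I)) * lattice_simplex.local_genus L v' I \<tau> \<sigma> w)"
    by (rule sum.group[symmetric]) (use fin finite_stratum rho_stratum in auto)
  also have "\<dots> = (\<Sum>J\<in>stratum \<Delta> n. of_int (weight \<Delta> J) *
      (\<Sum>I\<in>maximal J. lattice_simplex.local_genus L v' I \<tau> \<sigma> w))"
    by (simp add: sum_distrib_left)
  finally show ?thesis .
qed

definition cone_coeff where
  "cone_coeff J \<tau> \<sigma> p m = (\<Sum>I\<in>maximal J. lattice_simplex.theta_coeff L v' I \<tau> \<sigma> p m)"

lemma cone_genus_has_sum:
  assumes \<tau>: "Im \<tau> > 0" and \<sigma>: "\<sigma> \<notin> period_lattice \<tau>"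
    and w: "fst w \<in> span L" "snd w \<in> span L"
    and p: "p = (1 / Im \<tau>) *\<^sub>R snd w" "generic_point p"
  shows "((\<lambda>m. e2pi (- complex_ext ((\<bullet>) m) w) * cone_coeff J \<tau> \<sigma> p m) has_sum
    (\<Sum>I\<in>maximal J. lattice_simplex.local_genus L v' I \<tau> \<sigma> w)) (dual_lattice L)"
  unfolding cone_coeff_def sum_distrib_left
proof (rule has_sum_finite_sum)
  fix I assume "I \<in> maximal J"
  hence st: "I \<in> stratum \<Delta>' n" by simp
  show "((\<lambda>m. e2pi (- complex_ext ((\<bullet>) m) w) * lattice_simplex.theta_coeff L v' I \<tau> \<sigma> p m) has_sum
      lattice_simplex.local_genus L v' I \<tau> \<sigma> w) (dual_lattice L)"
    using lattice_simplex.local_genus_has_sum[OF top_simplex(1)[OF st] \<tau> \<sigma> w p(1)] p(2) st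
    by (simp add: generic_point_def)
qed (use finite_stratum in simp)

text \<open>Neither the terms nor the index set refer to \<open>\<Delta>'\<close>, so on this range
  of \<open>\<sigma>\<close> uniqueness of sums identifies the coefficients of any two
  triangulations.\<close>

lemma cone_coeff_has_sum:
  assumes m: "m \<in> dual_lattice L" and \<tau>: "Im \<tau> > 0" and p: "generic_point p" "p \<in> span L"
    and \<sigma>: "\<And>I i. I \<in> stratum \<Delta>' n \<Longrightarrow> i \<in> I \<Longrightarrow> Im \<sigma> + (m \<bullet> v' {i}) * Im \<tau> > 0"
    and J: "J \<in> stratum \<Delta> n"
    and u: "linear u" "\<And>i. i \<in> stratum \<Delta> 1 \<Longrightarrow> le \<Delta> i J \<Longrightarrow> u (v i) = 1"
  shows "((\<lambda>x. e2pi (of_real (u x) * \<sigma> + of_real (m \<bullet> x) * \<tau>)) has_sum cone_coeff J \<tau> \<sigma> p m)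
    {x \<in> L. x - p \<in> cone_at \<Delta> J}"
  unfolding cone_coeff_def subdivision(1)[OF p(1) J p(2), symmetric]
proof (rule sum_has_sum)
  fix I assume I: "I \<in> maximal J"
  hence st: "I \<in> stratum \<Delta>' n" by simp
  let ?X = "{x \<in> L. \<forall>i\<in>I. dual_vector v' I i p < dual_vector v' I i x}"
  have "((\<lambda>x. e2pi (of_real (\<Sum>i\<in>I. dual_vector v' I i x) * \<sigma> + of_real (m \<bullet> x) * \<tau>)) has_sum
      lattice_simplex.theta_coeff L v' I \<tau> \<sigma> p m) ?X"
    by (rule lattice_simplex.theta_coeff_has_sum[OF top_simplex(1)[OF st] m \<tau>])
      (use p st \<sigma> in \<open>auto simp: generic_point_def\<close>)
  also have "?this \<longleftrightarrow> ((\<lambda>x. e2pi (of_real (u x) * \<sigma> + of_real (m \<bullet> x) * \<tau>)) has_sum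
      lattice_simplex.theta_coeff L v' I \<tau> \<sigma> p m) ?X"
  proof (rule has_sum_cong)
    fix x assume "x \<in> ?X"
    hence "(\<Sum>i\<in>I. dual_vector v' I i x) = u x" using degree[OF u I] by (simp add: span_base)
    thus "e2pi (of_real (\<Sum>i\<in>I. dual_vector v' I i x) * \<sigma> + of_real (m \<bullet> x) * \<tau>) =
        e2pi (of_real (u x) * \<sigma> + of_real (m \<bullet> x) * \<tau>)" by (simp only:)
  qed
  finally show "((\<lambda>x. e2pi (of_real (u x) * \<sigma> + of_real (m \<bullet> x) * \<tau>)) has_sum
      lattice_simplex.theta_coeff L v' I \<tau> \<sigma> p m) ?X" .
qed (use finite_stratum subdivision(2)[OF p(1) J p(2)] in auto)

end

section \<open>Independence of the triangulation\<close>

text \<open>If \<open>Im \<sigma>\<close> is large, depending on \<open>m\<close>, both sides are the same lattice point sum over the shifted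
  cone; the general case follows by analytic continuation in \<open>\<sigma>\<close>.\<close>
lemma cone_coeff_eq:
  fixes L :: "'a::euclidean_space set" and u :: "'a \<Rightarrow> real"
  assumes T1: "triangulation L n \<Delta> v \<Delta>1 \<rho>1" and T2: "triangulation L n \<Delta> v \<Delta>2 \<rho>2"
    and \<tau>: "Im \<tau> > 0" and \<sigma>: "\<sigma> \<notin> period_lattice \<tau>" and p: "p \<in> span L"
    and g1: "triangulation.generic_point L n v \<Delta>1 \<rho>1 p"
    and g2: "triangulation.generic_point L n v \<Delta>2 \<rho>2 p"
    and J: "J \<in> stratum \<Delta> n" and m: "m \<in> dual_lattice L"
    and u: "linear u" "\<And>i. i \<in> stratum \<Delta> 1 \<Longrightarrow> le \<Delta> i J \<Longrightarrow> u (v i) = 1"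
  shows "triangulation.cone_coeff L n v \<Delta>1 \<rho>1 J \<tau> \<sigma> p m =
    triangulation.cone_coeff L n v \<Delta>2 \<rho>2 J \<tau> \<sigma> p m"
proof -
  interpret T1: triangulation L n \<Delta> v \<Delta>1 \<rho>1 by (rule T1)
  interpret T2: triangulation L n \<Delta> v \<Delta>2 \<rho>2 by (rule T2)
  \<comment> \<open>The slopes of \<open>m\<close> on the edges of both triangulations: each pole of
    either coefficient satisfies \<open>e2pi (\<sigma> + r * \<tau>) = 1\<close> for one of these
    \<open>r\<close>. The set \<open>Z\<close> of such points is countable and closed, so its
    complement is a connected open domain for the continuation.\<close>
  define K where "K = (\<Union>I\<in>stratum \<Delta>1 n. (\<lambda>i. m \<bullet> T1.v' {i}) ` I) \<union>
    (\<Union>I\<in>stratum \<Delta>2 n. (\<lambda>i. m \<bullet> T2.v' {i}) ` I)"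
  have finK: "finite K"
    unfolding K_def using T1.finite_stratum T2.finite_stratum
      lattice_simplex.finI[OF T1.top_simplex(1)] lattice_simplex.finI[OF T2.top_simplex(1)] by blast
  define Z where "Z = (\<Union>r\<in>K. {\<sigma>. e2pi (\<sigma> + of_real r * \<tau>) = 1})"
  have "countable {\<sigma>. e2pi (\<sigma> + of_real r * \<tau>) = 1}" for r
  proof (rule countable_subset)
    show "{\<sigma>. e2pi (\<sigma> + of_real r * \<tau>) = 1} \<subseteq> range (\<lambda>j::int. of_int j - of_real r * \<tau>)"
      by (auto simp: e2pi_eq_1_iff algebra_simps elim!: Ints_cases intro!: image_eqI)
  qed simp
  hence "countable Z" unfolding Z_def by (rule countable_UN[OF countable_finite[OF finK]])
  hence connected: "connected (- Z)"
    using path_connected_imp_connected path_connected_complement_countable[of Z] by simp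
  have "closed {\<sigma>. e2pi (\<sigma> + of_real r * \<tau>) = 1}" for r
    unfolding e2pi_def by (intro closed_Collect_eq continuous_intros)
  hence open_S: "open (- Z)" unfolding Z_def by (intro open_Compl closed_UN[OF finK] ballI)
  \<comment> \<open>The sum dominates \<open>\<bar>r\<bar> * Im \<tau>\<close> for each slope, so
    above height \<open>R\<close> every geometric ratio of both triangulations has norm below
    1.\<close>
  define R where "R = 1 + (\<Sum>r\<in>K. \<bar>r\<bar> * Im \<tau>)"
  have R: "Im s + r * Im \<tau> > 0" if "Im s > R" "r \<in> K" for s r
  proof -
    have "\<bar>r\<bar> * Im \<tau> \<le> (\<Sum>r\<in>K. \<bar>r\<bar> * Im \<tau>)"
      using finK that \<tau> by (intro member_le_sum) auto
    moreover have "- (r * Im \<tau>) \<le> \<bar>r\<bar> * Im \<tau>"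
      using \<tau> mult_right_mono[of "- r" "\<bar>r\<bar>" "Im \<tau>"] by simp
    ultimately show ?thesis using that(1) by (simp add: R_def)
  qed
  have K1: "m \<bullet> T1.v' {i} \<in> K" if "I \<in> stratum \<Delta>1 n" "i \<in> I" for I i
    using that by (auto simp: K_def)
  have K2: "m \<bullet> T2.v' {i} \<in> K" if "I \<in> stratum \<Delta>2 n" "i \<in> I" for I i
    using that by (auto simp: K_def)
  show ?thesis
  proof (rule analytic_continuation_open[OF _ open_S _ connected,
      where f = "\<lambda>\<sigma>. T1.cone_coeff J \<tau> \<sigma> p m" and g = "\<lambda>\<sigma>. T2.cone_coeff J \<tau> \<sigma> p m"])
    show "open {s. Im s > R}" by (rule open_halfspace_Im_gt)
    have "Complex 0 (R + 1) \<in> {s. Im s > R}" by simp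
    thus "{s. Im s > R} \<noteq> {}" by blast
    show "{s. Im s > R} \<subseteq> - Z"
    proof
      fix s assume s: "s \<in> {s. Im s > R}"
      have "e2pi (s + of_real r * \<tau>) \<noteq> 1" if "r \<in> K" for r
      proof -
        have "norm (e2pi (s + of_real r * \<tau>)) < 1"
          using R[OF _ that, of s] s by (simp add: norm_e2pi)
        thus ?thesis by auto
      qed
      thus "s \<in> - Z" by (auto simp: Z_def)
    qed
    show "(\<lambda>\<sigma>. T1.cone_coeff J \<tau> \<sigma> p m) holomorphic_on - Z"
      unfolding T1.cone_coeff_def
    proof (intro holomorphic_intros)
      fix I assume "I \<in> T1.maximal J"
      hence st: "I \<in> stratum \<Delta>1 n" by simp
      show "(\<lambda>\<sigma>. lattice_simplex.theta_coeff L T1.v' I \<tau> \<sigma> p m) holomorphic_on - Z"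
        by (rule holomorphic_on_subset[OF lattice_simplex.theta_coeff_holomorphic[OF T1.top_simplex(1)[OF st]]])
          (use K1[OF st] in \<open>auto simp: Z_def\<close>)
    qed
    show "(\<lambda>\<sigma>. T2.cone_coeff J \<tau> \<sigma> p m) holomorphic_on - Z"
      unfolding T2.cone_coeff_def
    proof (intro holomorphic_intros)
      fix I assume "I \<in> T2.maximal J"
      hence st: "I \<in> stratum \<Delta>2 n" by simp
      show "(\<lambda>\<sigma>. lattice_simplex.theta_coeff L T2.v' I \<tau> \<sigma> p m) holomorphic_on - Z"
        by (rule holomorphic_on_subset[OF lattice_simplex.theta_coeff_holomorphic[OF T2.top_simplex(1)[OF st]]])
          (use K2[OF st] in \<open>auto simp: Z_def\<close>)
    qed
    show "T1.cone_coeff J \<tau> s p m = T2.cone_coeff J \<tau> s p m" if s: "s \<in> {s. Im s > R}" for s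
    proof (rule has_sum_unique)
      show "((\<lambda>x. e2pi (of_real (u x) * s + of_real (m \<bullet> x) * \<tau>)) has_sum T1.cone_coeff J \<tau> s p m)
          {x \<in> L. x - p \<in> cone_at \<Delta> J}"
        using s by (intro T1.cone_coeff_has_sum[OF m \<tau> g1 p _ J u] R K1) auto
      show "((\<lambda>x. e2pi (of_real (u x) * s + of_real (m \<bullet> x) * \<tau>)) has_sum T2.cone_coeff J \<tau> s p m)
          {x \<in> L. x - p \<in> cone_at \<Delta> J}"
        using s by (intro T2.cone_coeff_has_sum[OF m \<tau> g2 p _ J u] R K2) auto
    qed
    \<comment> \<open>Edge vectors lie in \<open>L\<close> and \<open>m\<close> is integral there,
      so the slopes are integers; a pole at \<open>\<sigma>\<close> would then place it in the
      period lattice.\<close>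
    show "\<sigma> \<in> - Z"
    proof -
      have "e2pi (\<sigma> + of_real r * \<tau>) \<noteq> 1" if "r \<in> K" for r
      proof -
        have "r \<in> \<int>"
          using that T1.v'_vertex T2.v'_vertex m unfolding K_def dual_lattice_def by auto
        then obtain k where "r = of_int k" by (rule Ints_cases)
        thus ?thesis using \<sigma> in_period_lattice_iff[of \<sigma> \<tau>] by auto
      qed
      thus ?thesis by (auto simp: Z_def)
    qed
  qed
qed

text \<open>Both genera are sums of Fourier series with the same exponentials. Only the easy
  direction is used: equal coefficients give equal sums.\<close>

lemma genus_eq_generic:
  assumes T1: "triangulation L n \<Delta> v \<Delta>1 \<rho>1" and T2: "triangulation L n \<Delta> v \<Delta>2 \<rho>2"
    and gor: "Q_Gorenstein L n \<Delta> v"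
    and \<tau>: "Im \<tau> > 0" and \<sigma>: "\<sigma> \<notin> period_lattice \<tau>"
    and w: "w \<in> complexification L"
    and g1: "triangulation.generic_point L n v \<Delta>1 \<rho>1 ((1 / Im \<tau>) *\<^sub>R snd w)"
    and g2: "triangulation.generic_point L n v \<Delta>2 \<rho>2 ((1 / Im \<tau>) *\<^sub>R snd w)"
  shows "orbifold_elliptic_genus L n \<Delta>1 (induced_edge_vectors v \<rho>1) \<tau> \<sigma> w =
    orbifold_elliptic_genus L n \<Delta>2 (induced_edge_vectors v \<rho>2) \<tau> \<sigma> w"
proof -
  interpret T1: triangulation L n \<Delta> v \<Delta>1 \<rho>1 by (rule T1)
  interpret T2: triangulation L n \<Delta> v \<Delta>2 \<rho>2 by (rule T2)
  define p where "p = (1 / Im \<tau>) *\<^sub>R snd w"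
  have ws: "fst w \<in> span L" "snd w \<in> span L" using w by (auto simp: complexification_def)
  hence ps: "p \<in> span L" by (simp add: p_def span_scale)
  have "(\<Sum>I\<in>T1.maximal J. lattice_simplex.local_genus L T1.v' I \<tau> \<sigma> w) =
      (\<Sum>I\<in>T2.maximal J. lattice_simplex.local_genus L T2.v' I \<tau> \<sigma> w)" if J: "J \<in> stratum \<Delta> n" for J
  proof -
    obtain u :: "'a \<Rightarrow> real" where u': "linear u" "\<forall>i\<in>stratum \<Delta> 1. le \<Delta> i J \<longrightarrow> u (v i) = 1"
      using bspec[OF gor[unfolded Q_Gorenstein_def] J] by (elim exE conjE)
    note u = u'(1) u'(2)[rule_format]
    have "((\<lambda>m. e2pi (- complex_ext ((\<bullet>) m) w) * T2.cone_coeff J \<tau> \<sigma> p m) has_sum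
        (\<Sum>I\<in>T2.maximal J. lattice_simplex.local_genus L T2.v' I \<tau> \<sigma> w)) (dual_lattice L)"
      by (rule T2.cone_genus_has_sum[OF \<tau> \<sigma> ws p_def g2[folded p_def]])
    also have "?this \<longleftrightarrow> ((\<lambda>m. e2pi (- complex_ext ((\<bullet>) m) w) * T1.cone_coeff J \<tau> \<sigma> p m) has_sum
        (\<Sum>I\<in>T2.maximal J. lattice_simplex.local_genus L T2.v' I \<tau> \<sigma> w)) (dual_lattice L)"
    proof (rule has_sum_cong)
      fix m assume m: "m \<in> dual_lattice L"
      have "T1.cone_coeff J \<tau> \<sigma> p m = T2.cone_coeff J \<tau> \<sigma> p m"
        by (rule cone_coeff_eq[OF T1 T2 \<tau> \<sigma> ps g1[folded p_def] g2[folded p_def] J m u(1)])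
          (rule u(2))
      thus "e2pi (- complex_ext ((\<bullet>) m) w) * T2.cone_coeff J \<tau> \<sigma> p m =
          e2pi (- complex_ext ((\<bullet>) m) w) * T1.cone_coeff J \<tau> \<sigma> p m" by simp
    qed
    finally show ?thesis
      using T1.cone_genus_has_sum[OF \<tau> \<sigma> ws p_def g1[folded p_def]] has_sum_unique by blast
  qed
  thus ?thesis unfolding T1.genus_eq T2.genus_eq by simp
qed

section \<open>Generic directions and the limit to arbitrary regular points\<close>

text \<open>A real vector space is not a finite union of proper hyperplanes. Linearity is required
  on \<open>V\<close> only, because \<open>dual_vector\<close> is linear on \<open>span L\<close>
  but not in general outside it.\<close>

lemma ex_nonzero_for_all_functionals:
  fixes V :: "'a::real_vector set" and F :: "('a \<Rightarrow> real) set"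
  assumes "finite F" and V: "subspace V"
    and "\<And>f x y. f \<in> F \<Longrightarrow> x \<in> V \<Longrightarrow> y \<in> V \<Longrightarrow> f (x + y) = f x + f y"
    and "\<And>f x c. f \<in> F \<Longrightarrow> x \<in> V \<Longrightarrow> f (c *\<^sub>R x) = c * f x"
    and "\<And>f. f \<in> F \<Longrightarrow> \<exists>x\<in>V. f x \<noteq> 0"
  shows "\<exists>d\<in>V. \<forall>f\<in>F. f d \<noteq> 0"
  using assms(1,3-)
proof (induction F rule: finite_induct)
  case empty
  thus ?case using subspace_0[OF V] by blast
next
  case (insert f F)
  have "\<exists>d\<in>V. \<forall>f\<in>F. f d \<noteq> 0" by (rule insert.IH) (use insert.prems in auto)
  then obtain d where d: "d \<in> V" "\<forall>g\<in>F. g d \<noteq> 0" by blast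
  obtain e where e: "e \<in> V" "f e \<noteq> 0" using insert.prems(3) by blast
  \<comment> \<open>Each functional that does not vanish at \<open>e\<close> excludes one value of
    \<open>t\<close>. A functional vanishing at \<open>e\<close> is not \<open>f\<close>, and keeps
    its nonzero value at \<open>d\<close>.\<close>
  define B where "B = (\<lambda>g. - g d / g e) ` insert f F"
  have "infinite ((UNIV :: real set) - B)"
    unfolding B_def using insert.hyps by (intro Diff_infinite_finite infinite_UNIV_char_0) auto
  then obtain t where t: "t \<notin> B" "t \<noteq> 0"
    by (metis DiffE finite.emptyI finite_insert finite_subset insertI1 subsetI)
  have te: "t *\<^sub>R e \<in> V" using V e by (simp add: subspace_scale)
  have "g (d + t *\<^sub>R e) \<noteq> 0" if g: "g \<in> insert f F" for g
  proof
    assume "g (d + t *\<^sub>R e) = 0"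
    hence *: "g d + t * g e = 0"
      using insert.prems(1)[OF g d(1) te] insert.prems(2)[OF g e(1), of t] by simp
    show False
    proof (cases "g e = 0")
      case True
      thus False using * g d(2) e(2) by auto
    next
      case False
      hence "t = - g d / g e" using * by (simp add: field_simps)
      thus False using t(1) g by (auto simp: B_def)
    qed
  qed
  thus ?case using subspace_add[OF V d(1) te] by blast
qed

context triangulation
begin

definition "functionals = {dual_vector v' I i | I i. I \<in> stratum \<Delta>' n \<and> i \<in> I}"

lemma finite_functionals: "finite functionals"
proof -
  have "functionals = (\<Union>I\<in>stratum \<Delta>' n. dual_vector v' I ` I)"
    by (auto simp: functionals_def)
  thus ?thesis
    using finite_stratum lattice_simplex.finI[OF top_simplex(1)] by simp
qed

lemma functionals_linear:
  assumes "f \<in> functionals"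
  shows "x \<in> span L \<Longrightarrow> y \<in> span L \<Longrightarrow> f (x + y) = f x + f y"
    and "x \<in> span L \<Longrightarrow> f (c *\<^sub>R x) = c * f x"
    and "\<exists>x\<in>span L. f x \<noteq> 0"
proof -
  obtain I i where f: "f = dual_vector v' I i" "I \<in> stratum \<Delta>' n" "i \<in> I"
    using assms by (auto simp: functionals_def)
  interpret lattice_simplex L n v' I by (rule top_simplex(1)[OF f(2)])
  show "x \<in> span L \<Longrightarrow> y \<in> span L \<Longrightarrow> f (x + y) = f x + f y"
    and "x \<in> span L \<Longrightarrow> f (c *\<^sub>R x) = c * f x"
    by (simp_all add: f(1) D_add D_scale)
  show "\<exists>x\<in>span L. f x \<noteq> 0"
    using e_span[OF f(3)] D_e[OF f(3) f(3)] by (intro bexI[of _ "v' {i}"]) (simp_all add: f(1))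
qed

text \<open>Without top simplices the quantifier in \<open>generic_point\<close> is vacuous and does
  not place \<open>p\<close> in \<open>span L\<close>; hence the first alternative.\<close>

lemma generic_point_iff:
  "generic_point p \<longleftrightarrow> stratum \<Delta>' n = {} \<or> p \<in> span L \<and> (\<forall>f\<in>functionals. \<forall>x\<in>L. f x \<noteq> f p)"
  unfolding generic_point_def functionals_def
  using lattice_simplex.generic_def[OF top_simplex(1)] by blast

text \<open>Since no functional vanishes at \<open>d\<close>, each pair of a functional and a
  lattice point excludes exactly one \<open>t\<close>; there are finitely many functionals and
  countably many lattice points.\<close>

lemma countable_nongeneric:
  assumes w: "y \<in> span L" and d: "d \<in> span L" "\<forall>f\<in>functionals. f d \<noteq> 0" and c: "c \<noteq> 0"
  shows "countable {t::real. \<not> generic_point (c *\<^sub>R (y + t *\<^sub>R d))}"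
proof (rule countable_subset)
  show "{t. \<not> generic_point (c *\<^sub>R (y + t *\<^sub>R d))} \<subseteq>
      (\<Union>f\<in>functionals. (\<lambda>x. (f x / c - f y) / f d) ` L)"
  proof
    fix t assume "t \<in> {t. \<not> generic_point (c *\<^sub>R (y + t *\<^sub>R d))}"
    moreover have s: "y + t *\<^sub>R d \<in> span L" "t *\<^sub>R d \<in> span L" using w d by (auto intro: span_add span_scale)
    ultimately obtain f x where f: "f \<in> functionals" "x \<in> L" "f x = f (c *\<^sub>R (y + t *\<^sub>R d))"
      by (auto simp: generic_point_iff span_scale)
    have "f x = c * (f y + t * f d)"
      using f(3) functionals_linear(1)[OF f(1) w s(2)] functionals_linear(2)[OF f(1)] s d by simp
    hence "t = (f x / c - f y) / f d" using c d(2) f(1) by (simp add: field_simps)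
    thus "t \<in> (\<Union>f\<in>functionals. (\<lambda>x. (f x / c - f y) / f d) ` L)" using f by blast
  qed
  show "countable (\<Union>f\<in>functionals. (\<lambda>x. (f x / c - f y) / f d) ` L)"
    by (rule countable_UN[OF countable_finite[OF finite_functionals]])
      (rule countable_image[OF countable_lattice[OF lat]])
qed

text \<open>The representatives lie in \<open>L\<close>, so regularity of \<open>w\<close> keeps
  every argument of \<open>phi_st\<close> off its poles. Moving \<open>snd w\<close> alone suffices,
  because genericity concerns only the imaginary part.\<close>

lemma genus_tendsto:
  assumes \<tau>: "Im \<tau> > 0" and \<sigma>: "\<sigma> \<notin> period_lattice \<tau>"
    and w: "w \<in> regular_points L n \<Delta>' v' \<tau>" and d: "d \<in> span L" and t: "t \<longlonglongrightarrow> 0"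
  shows "(\<lambda>k. orbifold_elliptic_genus L n \<Delta>' v' \<tau> \<sigma> (fst w, snd w + t k *\<^sub>R d)) \<longlonglongrightarrow>
    orbifold_elliptic_genus L n \<Delta>' v' \<tau> \<sigma> w"
  unfolding orbifold_elliptic_genus_def case_prod_unfold
proof (intro tendsto_intros)
  fix I h i
  assume I: "I \<in> stratum \<Delta>' n" and h: "h \<in> H_group L v' I \<times> H_group L v' I" and i: "i \<in> I"
  interpret lattice_simplex L n v' I by (rule top_simplex(1)[OF I])
  let ?x = "coset_rep (fst h)" and ?y = "coset_rep (snd h)"
  have ws: "snd w \<in> span L" using w by (auto simp: regular_points_def complexification_def)
  have rep: "coset_rep a \<in> L" if "a \<in> H_group L v' I" for a
  proof -
    have "a \<subseteq> L" "a \<noteq> {}"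
      using that in_quotient_imp_subset[OF equiv_R] in_quotient_imp_non_empty[OF equiv_R]
      unfolding H_group_eq by blast+
    thus ?thesis unfolding coset_rep_def by (metis someI_ex all_not_in_conv subsetD)
  qed
  show "(\<lambda>k. phi_st (orbi_arg v' I i \<tau> (fst w, snd w + t k *\<^sub>R d) ?x ?y) \<tau> \<sigma>) \<longlonglongrightarrow>
      phi_st (orbi_arg v' I i \<tau> w ?x ?y) \<tau> \<sigma>"
  proof (rule isCont_tendsto_compose[OF isCont_phi_st[OF \<tau> _ \<sigma>]])
    show "orbi_arg v' I i \<tau> w ?x ?y \<notin> period_lattice \<tau>"
      using w I i rep h by (auto simp: regular_points_def)
    have "D i (snd w + t k *\<^sub>R d) = D i (snd w) + t k * D i d" for k
      using ws d by (simp add: D_add D_scale span_scale)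
    moreover have "(\<lambda>k. - (of_real (D i (fst w)) + \<i> * of_real (D i (snd w) + t k * D i d)) +
        \<tau> * of_real (D i ?x) - of_real (D i ?y)) \<longlonglongrightarrow>
        - (of_real (D i (fst w)) + \<i> * of_real (D i (snd w) + 0 * D i d)) +
        \<tau> * of_real (D i ?x) - of_real (D i ?y)"
      by (intro tendsto_intros t)
    ultimately show "(\<lambda>k. orbi_arg v' I i \<tau> (fst w, snd w + t k *\<^sub>R d) ?x ?y) \<longlonglongrightarrow>
        orbi_arg v' I i \<tau> w ?x ?y"
      by (simp add: orbi_arg_def complex_ext_def)
  qed
qed

end

theorem corollary9p2:
  fixes L :: "'a::euclidean_space set" and n :: nat
    and \<Delta> :: "('s, 'a) multi_fan" and v :: "'s \<Rightarrow> 'a"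
    and \<Delta>1 :: "('b set, 'a) multi_fan" and \<rho>1 :: "'b set \<Rightarrow> 's"
    and \<Delta>2 :: "('c set, 'a) multi_fan" and \<rho>2 :: "'c set \<Rightarrow> 's"
    and \<tau> \<sigma> :: complex
  assumes "lattice_of_rank L n"
    and "is_multi_fan L \<Delta>"
    and "\<forall>J\<in>simplices \<Delta>. \<exists>I\<in>stratum \<Delta> n. le \<Delta> J I"
    and "edge_vectors L \<Delta> v"
    and "Q_Gorenstein L n \<Delta> v"
    and "is_triangulation L n \<Delta> \<Delta>1 \<rho>1"
    and "is_triangulation L n \<Delta> \<Delta>2 \<rho>2"
    and "Im \<tau> > 0"
    and "\<sigma> \<notin> period_lattice \<tau>"
  shows "\<forall>w \<in> regular_points L n \<Delta>1 (induced_edge_vectors v \<rho>1) \<tau> \<inter>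
              regular_points L n \<Delta>2 (induced_edge_vectors v \<rho>2) \<tau>.
           orbifold_elliptic_genus L n \<Delta>1 (induced_edge_vectors v \<rho>1) \<tau> \<sigma> w =
           orbifold_elliptic_genus L n \<Delta>2 (induced_edge_vectors v \<rho>2) \<tau> \<sigma> w"
proof
  have T1: "triangulation L n \<Delta> v \<Delta>1 \<rho>1" and T2: "triangulation L n \<Delta> v \<Delta>2 \<rho>2"
    using assms by unfold_locales
  interpret T1: triangulation L n \<Delta> v \<Delta>1 \<rho>1 by (rule T1)
  interpret T2: triangulation L n \<Delta> v \<Delta>2 \<rho>2 by (rule T2)
  fix w
  assume w: "w \<in> regular_points L n \<Delta>1 T1.v' \<tau> \<inter> regular_points L n \<Delta>2 T2.v' \<tau>"
  have ws: "fst w \<in> span L" "snd w \<in> span L"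
    using w by (auto simp: regular_points_def complexification_def)
  \<comment> \<open>A single direction transverse to all walls of both triangulations, along which
    \<open>w\<close> is perturbed.\<close>
  have "\<exists>d\<in>span L. \<forall>f\<in>T1.functionals \<union> T2.functionals. f d \<noteq> 0"
    by (rule ex_nonzero_for_all_functionals)
      (use T1.finite_functionals T2.finite_functionals T1.functionals_linear T2.functionals_linear in auto)
  then obtain d where d: "d \<in> span L" "\<forall>f\<in>T1.functionals. f d \<noteq> 0"
      "\<forall>f\<in>T2.functionals. f d \<noteq> 0" by blast
  let ?p = "\<lambda>t. (1 / Im \<tau>) *\<^sub>R (snd w + t *\<^sub>R d)"
  have "countable ({t. \<not> T1.generic_point (?p t)} \<union> {t. \<not> T2.generic_point (?p t)})" (is "countable ?bad")
    using T1.countable_nongeneric[OF ws(2) d(1,2)] T2.countable_nongeneric[OF ws(2) d(1,3)] \<open>Im \<tau> > 0\<close>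
    by (intro countable_Un) auto
  \<comment> \<open>An interval is uncountable, so parameters generic for both triangulations exist
    arbitrarily close to 0.\<close>
  hence "\<exists>t. 0 < t \<and> t < 1 / Suc k \<and> t \<notin> ?bad" for k
  proof -
    have "uncountable ({0<..<1 / real (Suc k)} - ?bad)"
      using uncountable_open_interval[of 0 "1 / real (Suc k)"] \<open>countable ?bad\<close>
      by (intro uncountable_minus_countable) auto
    hence "{0<..<1 / real (Suc k)} - ?bad \<noteq> {}" by (metis countable_empty)
    thus ?thesis by auto
  qed
  then obtain t where t: "\<And>k. 0 < t k" "\<And>k. t k < 1 / Suc k"
      "\<And>k. T1.generic_point (?p (t k))" "\<And>k. T2.generic_point (?p (t k))"
    unfolding Un_iff mem_Collect_eq by metis
  have "t \<longlonglongrightarrow> 0"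
  proof (rule tendsto_sandwich[of "\<lambda>_. 0" t _ "\<lambda>k. 1 / real (Suc k)"])
    show "(\<lambda>k. 1 / real (Suc k)) \<longlonglongrightarrow> 0" by (rule lim_inverse_n'[THEN LIMSEQ_Suc])
  qed (use t in \<open>auto intro!: always_eventually less_imp_le\<close>)
  let ?w = "\<lambda>k. (fst w, snd w + t k *\<^sub>R d)"
  have "orbifold_elliptic_genus L n \<Delta>1 T1.v' \<tau> \<sigma> (?w k) =
      orbifold_elliptic_genus L n \<Delta>2 T2.v' \<tau> \<sigma> (?w k)" for k
    by (rule genus_eq_generic[OF T1 T2 assms(5,8,9)])
      (use t ws d in \<open>auto simp: complexification_def intro: span_add span_scale\<close>)
  hence "(\<lambda>k. orbifold_elliptic_genus L n \<Delta>1 T1.v' \<tau> \<sigma> (?w k)) \<longlonglongrightarrow>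
      orbifold_elliptic_genus L n \<Delta>2 T2.v' \<tau> \<sigma> w"
    using T2.genus_tendsto[OF assms(8,9) _ d(1) \<open>t \<longlonglongrightarrow> 0\<close>] w by simp
  thus "orbifold_elliptic_genus L n \<Delta>1 T1.v' \<tau> \<sigma> w = orbifold_elliptic_genus L n \<Delta>2 T2.v' \<tau> \<sigma> w"
    using T1.genus_tendsto[OF assms(8,9) _ d(1) \<open>t \<longlonglongrightarrow> 0\<close>] w LIMSEQ_unique by blast
qed

end
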